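(* Let $D\subset\mathbb{R}^d$ be an open set whose boundary $\partial D$ is locally $C^{1,1}$ regular. Let $T^\ast\in(0,+\infty]$, $u_M:D\to\mathbb{R}$ be a Lebesgue measurable function, and $F\in L^2(D;\mathbb{R}^d)$. Let $(u_1,\mu_1)$ and $(u_2,\mu_2)$ be a Neumann enthalpy subsolution and a Neumann enthalpy supersolution, respectively, in $D_{T^\ast}$ with melting temperature $u_M$ and heat source $F$. Assume that $$u_1(x,0)\le u_2(x,0)\quad\text{and}\quad\mu_1(x,0)\le\mu_2(x,0)\quad\text{for almost every }x\in D.$$ Then, for all $T\in(0,T^\ast)$, $$u_1(x,T)\le u_2(x,T)\quad\text{and}\quad\mu_1(x,T)\le\mu_2(x,T)\quad\text{for almost every }x\in D.$$
   Context: For $D\subset\mathbb{R}^d$ open and $t\in(0,+\infty]$, $D_t:=D\times[0,t)$; $\nabla$ is the gradient in $x$ only. A Neumann enthalpy subsolution (resp. supersolution) in $D_{T^\ast}$ with melting temperature $u_M$ and heat source $F$ is a pair of measurable functions $(u,\mu)$ on $D_{T^\ast}$ such that: (i) $u\in L^2_{loc}([0,T^\ast);H^1(D))$ and $\partial_tu\in L^2_{loc}([0,T^\ast);L^2(D))$ (so $u(\cdot,t)$ is understood as the representative continuous in $t$ with values in $L^2(D)$); (ii) $\mu:[0,T^\ast)\to L^\infty(D)$ is continuous for the weak-$\ast$ topology of $L^\infty(D)=(L^1(D))^*$; (iii) for all $t\in[0,T^\ast)$ and a.e. $x\in D$: $|\mu(x,t)|\le1$, $\mu(x,t)=1$ if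 $u(x,t)>u_M(x)$, and $\mu(x,t)=-1$ if $u(x,t)<u_M(x)$; (iv) for all $0\le t_1\le t_2<T^\ast$ and all nonnegative $\eta\in C^\infty_c(\mathbb{R}^d\times\mathbb{R})$, $$\int_D(u+\mu)\eta\,dx\Big|_{t=t_1}^{t_2}\le\int_{t_1}^{t_2}\int_D\big[(u+\mu)\partial_t\eta-\nabla u\cdot\nabla\eta-F\cdot\nabla\eta\big]\,dx\,dt\qquad(\text{resp. }\ge).$$ *)

theory Defs
  imports "HOL-Analysis.Analysis"
begin

section \<open>Test functions\<close>

primrec Ck :: "nat \<Rightarrow> ('a::euclidean_space \<Rightarrow> real) \<Rightarrow> bool" where
  "Ck 0 f \<longleftrightarrow> continuous_on UNIV f"
| "Ck (Suc n) f \<longleftrightarrow> (\<forall>x. f differentiable (at x)) \<and>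
     (\<forall>b\<in>Basis. Ck n (\<lambda>x. frechet_derivative f (at x) b))"

definition test_function :: "'a::euclidean_space set \<Rightarrow> ('a \<Rightarrow> real) \<Rightarrow> bool" where
  "test_function S \<phi> \<longleftrightarrow>
     (\<forall>n. Ck n \<phi>) \<and> compact (closure {x. \<phi> x \<noteq> 0}) \<and> closure {x. \<phi> x \<noteq> 0} \<subseteq> S"

definition gradient :: "('a::euclidean_space \<Rightarrow> real) \<Rightarrow> 'a \<Rightarrow> 'a" where
  "gradient f x = (\<Sum>b\<in>Basis. frechet_derivative f (at x) b *\<^sub>R b)"

section \<open>Lebesgue and Sobolev spaces\<close>

text \<open>The elements of the spaces below are functions on the whole type, of which only the
  restriction to the set \<open>D\<close> up to a null set matters; the norms are
  seminorms on these sets of functions.\<close>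

definition L1 :: "'a::euclidean_space set \<Rightarrow> ('a \<Rightarrow> real) set" where
  "L1 D = {f. set_integrable lebesgue D f}"

definition L2 :: "'a::euclidean_space set \<Rightarrow> ('a \<Rightarrow> 'b::euclidean_space) set" where
  "L2 D = {f. set_borel_measurable lebesgue D f \<and>
              set_integrable lebesgue D (\<lambda>x. (norm (f x))\<^sup>2)}"

definition Linf :: "'a::euclidean_space set \<Rightarrow> ('a \<Rightarrow> real) set" where
  "Linf D = {f. set_borel_measurable lebesgue D f \<and>
                (\<exists>C. AE x\<in>D in lebesgue. \<bar>f x\<bar> \<le> C)}"

definition norm_L2 :: "'a::euclidean_space set \<Rightarrow> ('a \<Rightarrow> 'b::euclidean_space) \<Rightarrow> real" where
  "norm_L2 D f = sqrt (LINT x:D|lebesgue. (norm (f x))\<^sup>2)"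

definition weak_gradient ::
    "'a::euclidean_space set \<Rightarrow> ('a \<Rightarrow> real) \<Rightarrow> ('a \<Rightarrow> 'a) \<Rightarrow> bool" where
  "weak_gradient D f g \<longleftrightarrow>
     (\<forall>\<phi>. test_function D \<phi> \<longrightarrow>
        (LINT x:D|lebesgue. f x *\<^sub>R gradient \<phi> x) = - (LINT x:D|lebesgue. \<phi> x *\<^sub>R g x))"

definition H1 :: "'a::euclidean_space set \<Rightarrow> ('a \<Rightarrow> real) set" where
  "H1 D = {f \<in> L2 D. \<exists>g\<in>L2 D. weak_gradient D f g}"

text \<open>For \<open>f\<close> in \<open>H1 D\<close> and open \<open>D\<close> the weak gradient is
  determined almost everywhere in \<open>D\<close>; for other \<open>f\<close> this is an arbitrary value.\<close>

definition wgrad :: "'a::euclidean_space set \<Rightarrow> ('a \<Rightarrow> real) \<Rightarrow> 'a \<Rightarrow> 'a" where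
  "wgrad D f = (SOME g. g \<in> L2 D \<and> weak_gradient D f g)"

definition norm_H1 :: "'a::euclidean_space set \<Rightarrow> ('a \<Rightarrow> real) \<Rightarrow> real" where
  "norm_H1 D f = sqrt ((norm_L2 D f)\<^sup>2 + (norm_L2 D (wgrad D f))\<^sup>2)"

section \<open>Functions of time with values in a function space\<close>

definition times :: "ereal \<Rightarrow> real set" where
  "times T = {t. 0 \<le> t \<and> ereal t < T}"

definition slice :: "('a \<times> real \<Rightarrow> real) \<Rightarrow> real \<Rightarrow> 'a \<Rightarrow> real" where
  "slice u t = (\<lambda>x. u (x, t))"

text \<open>The Bochner space \<open>L\<^sup>2(J; X)\<close> for a set of functions \<open>X\<close> with seminorm \<open>N\<close>:
  a curve is strongly measurable if it is almost everywhere the limit of simple functions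
  with values in \<open>X\<close>.\<close>

definition bochner_measurable ::
    "real set \<Rightarrow> ('a \<Rightarrow> real) set \<Rightarrow> (('a \<Rightarrow> real) \<Rightarrow> real) \<Rightarrow> (real \<Rightarrow> 'a \<Rightarrow> real) \<Rightarrow> bool" where
  "bochner_measurable J X N f \<longleftrightarrow>
     (\<exists>s. (\<forall>n::nat. simple_function lebesgue (s n) \<and> range (s n) \<subseteq> X) \<and>
          (AE t\<in>J in lebesgue. (\<lambda>n. N (\<lambda>x. s n t x - f t x)) \<longlonglongrightarrow> 0))"

definition bochner_L2 ::
    "real set \<Rightarrow> ('a \<Rightarrow> real) set \<Rightarrow> (('a \<Rightarrow> real) \<Rightarrow> real) \<Rightarrow> (real \<Rightarrow> 'a \<Rightarrow> real) \<Rightarrow> bool" where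
  "bochner_L2 J X N f \<longleftrightarrow>
     (AE t\<in>J in lebesgue. f t \<in> X) \<and>
     bochner_measurable J X N f \<and>
     set_integrable lebesgue J (\<lambda>t. (N (f t))\<^sup>2)"

definition bochner_L2_loc ::
    "ereal \<Rightarrow> ('a \<Rightarrow> real) set \<Rightarrow> (('a \<Rightarrow> real) \<Rightarrow> real) \<Rightarrow> (real \<Rightarrow> 'a \<Rightarrow> real) \<Rightarrow> bool" where
  "bochner_L2_loc Tstar X N f \<longleftrightarrow>
     (\<forall>T. 0 < T \<and> ereal T < Tstar \<longrightarrow> bochner_L2 {0..T} X N f)"

definition weak_time_derivative ::
    "'a::euclidean_space set \<Rightarrow> ereal \<Rightarrow> ('a \<times> real \<Rightarrow> real) \<Rightarrow> ('a \<times> real \<Rightarrow> real) \<Rightarrow> bool" where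
  "weak_time_derivative D Tstar u w \<longleftrightarrow>
     (\<forall>\<phi>. test_function (D \<times> {t. 0 < t \<and> ereal t < Tstar}) \<phi> \<longrightarrow>
        (LINT t:times Tstar|lebesgue. LINT x:D|lebesgue. u (x, t) * deriv (\<lambda>s. \<phi> (x, s)) t) =
        - (LINT t:times Tstar|lebesgue. LINT x:D|lebesgue. w (x, t) * \<phi> (x, t)))"

section \<open>Domains with locally \<open>C\<^sup>1\<^sup>,\<^sup>1\<close> boundary\<close>

definition C11 :: "('a::euclidean_space \<Rightarrow> real) \<Rightarrow> bool" where
  "C11 \<gamma> \<longleftrightarrow> (\<exists>g L. (\<forall>x. GDERIV \<gamma> x :> g x) \<and> L-lipschitz_on UNIV g)"

text \<open>Near each boundary point \<open>D\<close> is the strict epigraph of a \<open>C\<^sup>1\<^sup>,\<^sup>1\<close> function, in the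
  direction of a unit vector \<open>e\<close>, over the hyperplane orthogonal to \<open>e\<close>. The function \<open>\<gamma>\<close> is
  defined on the whole space, but only its values on this hyperplane are used. In particular
  \<open>D\<close> lies locally on one side of its boundary. The radius and the Lipschitz constant may
  depend on the boundary point.\<close>

definition locally_C11_boundary :: "'a::euclidean_space set \<Rightarrow> bool" where
  "locally_C11_boundary D \<longleftrightarrow>
     (\<forall>x0\<in>frontier D. \<exists>r>0. \<exists>e \<gamma>. norm e = 1 \<and> C11 \<gamma> \<and>
        D \<inter> ball x0 r = {x \<in> ball x0 r. \<gamma> (x - (x \<bullet> e) *\<^sub>R e) < x \<bullet> e})"

section \<open>Neumann enthalpy sub- and supersolutions\<close>

text \<open>The function \<open>u\<close> itself is required to be the representative that is continuous in time
  with values in \<open>L\<^sup>2(D)\<close>, so that every slice \<open>u(\<cdot>, t)\<close> is meaningful.\<close>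

definition enthalpy_pair ::
    "'a::euclidean_space set \<Rightarrow> ereal \<Rightarrow> ('a \<Rightarrow> real) \<Rightarrow>
     ('a \<times> real \<Rightarrow> real) \<Rightarrow> ('a \<times> real \<Rightarrow> real) \<Rightarrow> bool" where
  "enthalpy_pair D Tstar uM u \<mu> \<longleftrightarrow>
     set_borel_measurable lebesgue (D \<times> times Tstar) u \<and>
     set_borel_measurable lebesgue (D \<times> times Tstar) \<mu> \<and>
     bochner_L2_loc Tstar (H1 D) (norm_H1 D) (slice u) \<and>
     (\<exists>w. bochner_L2_loc Tstar (L2 D) (norm_L2 D) (slice w) \<and> weak_time_derivative D Tstar u w) \<and>
     (\<forall>t\<in>times Tstar. slice u t \<in> L2 D) \<and>
     (\<forall>t0\<in>times Tstar.
        ((\<lambda>t. norm_L2 D (\<lambda>x. u (x, t) - u (x, t0))) \<longlongrightarrow> 0) (at t0 within times Tstar)) \<and>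
     (\<forall>t\<in>times Tstar. slice \<mu> t \<in> Linf D) \<and>
     (\<forall>g\<in>L1 D. continuous_on (times Tstar) (\<lambda>t. LINT x:D|lebesgue. \<mu> (x, t) * g x)) \<and>
     (\<forall>t\<in>times Tstar. AE x\<in>D in lebesgue.
        \<bar>\<mu> (x, t)\<bar> \<le> 1 \<and>
        (u (x, t) > uM x \<longrightarrow> \<mu> (x, t) = 1) \<and>
        (u (x, t) < uM x \<longrightarrow> \<mu> (x, t) = - 1))"

definition enthalpy_increment ::
    "'a::euclidean_space set \<Rightarrow> ('a \<times> real \<Rightarrow> real) \<Rightarrow> ('a \<times> real \<Rightarrow> real) \<Rightarrow>
     ('a \<times> real \<Rightarrow> real) \<Rightarrow> real \<Rightarrow> real \<Rightarrow> real" where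
  "enthalpy_increment D u \<mu> \<eta> t1 t2 =
     (LINT x:D|lebesgue. (u (x, t2) + \<mu> (x, t2)) * \<eta> (x, t2)) -
     (LINT x:D|lebesgue. (u (x, t1) + \<mu> (x, t1)) * \<eta> (x, t1))"

definition enthalpy_flux ::
    "'a::euclidean_space set \<Rightarrow> ('a \<Rightarrow> 'a) \<Rightarrow> ('a \<times> real \<Rightarrow> real) \<Rightarrow> ('a \<times> real \<Rightarrow> real) \<Rightarrow>
     ('a \<times> real \<Rightarrow> real) \<Rightarrow> real \<Rightarrow> real \<Rightarrow> real" where
  "enthalpy_flux D F u \<mu> \<eta> t1 t2 =
     (LINT t:{t1..t2}|lebesgue. LINT x:D|lebesgue.
        (u (x, t) + \<mu> (x, t)) * deriv (\<lambda>s. \<eta> (x, s)) t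
        - wgrad D (slice u t) x \<bullet> gradient (slice \<eta> t) x
        - F x \<bullet> gradient (slice \<eta> t) x)"

definition neumann_enthalpy_subsolution ::
    "'a::euclidean_space set \<Rightarrow> ereal \<Rightarrow> ('a \<Rightarrow> real) \<Rightarrow> ('a \<Rightarrow> 'a) \<Rightarrow>
     ('a \<times> real \<Rightarrow> real) \<Rightarrow> ('a \<times> real \<Rightarrow> real) \<Rightarrow> bool" where
  "neumann_enthalpy_subsolution D Tstar uM F u \<mu> \<longleftrightarrow>
     enthalpy_pair D Tstar uM u \<mu> \<and>
     (\<forall>t1 t2 \<eta>. 0 \<le> t1 \<and> t1 \<le> t2 \<and> ereal t2 < Tstar \<and> test_function UNIV \<eta> \<and> (\<forall>z. 0 \<le> \<eta> z) \<longrightarrow>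
        enthalpy_increment D u \<mu> \<eta> t1 t2 \<le> enthalpy_flux D F u \<mu> \<eta> t1 t2)"

definition neumann_enthalpy_supersolution ::
    "'a::euclidean_space set \<Rightarrow> ereal \<Rightarrow> ('a \<Rightarrow> real) \<Rightarrow> ('a \<Rightarrow> 'a) \<Rightarrow>
     ('a \<times> real \<Rightarrow> real) \<Rightarrow> ('a \<times> real \<Rightarrow> real) \<Rightarrow> bool" where
  "neumann_enthalpy_supersolution D Tstar uM F u \<mu> \<longleftrightarrow>
     enthalpy_pair D Tstar uM u \<mu> \<and>
     (\<forall>t1 t2 \<eta>. 0 \<le> t1 \<and> t1 \<le> t2 \<and> ereal t2 < Tstar \<and> test_function UNIV \<eta> \<and> (\<forall>z. 0 \<le> \<eta> z) \<longrightarrow>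
        enthalpy_increment D u \<mu> \<eta> t1 t2 \<ge> enthalpy_flux D F u \<mu> \<eta> t1 t2)"

end

theory Submission
  imports Defs
begin

text \<open>Put \<open>w = u\<^sub>1 - u\<^sub>2\<close> and \<open>b = (u\<^sub>1 + \<mu>\<^sub>1) - (u\<^sub>2 + \<mu>\<^sub>2)\<close>. By the monotonicity of the enthalpy relation
  \<open>b\<close> and \<open>w\<close> never have opposite signs, and \<open>b \<le> 0\<close> already implies both inequalities of the claim.
  Subtracting the two weak inequalities gives \<open>\<integral> (b t\<^sub>2 - b t\<^sub>1) \<phi> \<le> - \<integral> \<nabla>W \<cdot> \<nabla>\<phi>\<close> with \<open>W = \<integral>\<^sub>t\<^sub>1\<^sup>t\<^sup>2 w\<close> for
  time-independent \<open>\<phi> \<ge> 0\<close>. Given a test function \<open>\<zeta> \<ge> 0\<close> at the final time, choose test functions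
  backwards along a partition of \<open>[0, T]\<close> by \<open>\<eta>\<^sub>n = max 0 (\<eta>\<^sub>n\<^sub>+\<^sub>1 + W\<^sub>n / \<epsilon>)\<close>, starting from \<open>\<zeta>\<close>. The gradient
  terms telescope to at most \<open>(\<epsilon> / 2) \<integral> |\<nabla>\<zeta>|\<^sup>2\<close>, and after summation by parts the remaining terms are
  \<open>- b (\<eta>\<^sub>n - \<eta>\<^sub>n\<^sub>+\<^sub>1)\<close>, which up to the modulus of continuity of \<open>w\<close> are at most \<open>0\<close>. Refining the partition
  and letting \<open>\<epsilon> \<rightarrow> 0\<close> yields \<open>\<integral> b T \<zeta> \<le> 0\<close>. The regularity of
  \<open>\<partial>D\<close> enters through the density in \<open>H\<^sup>1(D)\<close> of functions that are smooth up to the boundary,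
  which makes the \<open>\<eta>\<^sub>n\<close> admissible.\<close>

section \<open>Smooth functions\<close>

text \<open>For two solutions one would test with \<open>\<integral>\<^sub>t\<^sup>T w\<close>,
  Oleinik's choice. Sub- and supersolutions admit only nonnegative test functions, so the increment
  \<open>W\<^sub>n / \<epsilon>\<close> has to be truncated at zero in every step; the recursion
  discretises the backward equation \<open>- \<partial>\<^sub>t \<eta> = w / \<epsilon>\<close> with
  reflection at zero. Freezing the test function in time on each subinterval keeps
  \<open>\<partial>\<^sub>t \<eta>\<close>, which would be paired with \<mu>, out of the flux, and
  the common \<open>F\<close> cancels on subtraction. Two obstacles fix the order of the choices.
  \<open>D\<close> may be unbounded, so every test function is multiplied by a wide cutoff \<theta>;
  the resulting error is a bound for the gradient of \<theta> times a quantity of order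
  \<open>1 / \<epsilon>\<close>, hence \<theta> is chosen after \<epsilon>. Moreover the
  \<open>\<eta>\<^sub>n\<close> must be smooth, so \<open>W\<^sub>n\<close> and the positive part
  are replaced by smooth substitutes, whose tolerances are picked anew in each step, once
  \<open>\<eta>\<^sub>n\<^sub>+\<^sub>1\<close> is known.\<close>

lemma Ck_SucI:
  assumes "\<And>x. (f has_derivative f' x) (at x)" "\<And>b. b \<in> Basis \<Longrightarrow> Ck n (\<lambda>x. f' x b)"
  shows "Ck (Suc n) f"
proof -
  have "frechet_derivative f (at x) = f' x" for x
    using assms(1)[of x] by (metis frechet_derivative_at)
  then show ?thesis
    using assms by (auto simp: differentiable_def)
qed

lemma Ck_SucD:
  assumes "Ck (Suc n) f"
  shows "(f has_derivative frechet_derivative f (at x)) (at x)"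
    and "b \<in> Basis \<Longrightarrow> Ck n (\<lambda>x. frechet_derivative f (at x) b)"
  using assms by (auto simp: frechet_derivative_works)

lemma Ck_Suc_imp: "Ck (Suc n) f \<Longrightarrow> Ck n f"
proof (induction n arbitrary: f)
  case 0
  then show ?case
    by (auto simp: continuous_at_imp_continuous_on differentiable_imp_continuous_within)
qed auto

lemma Ck_imp_continuous_on: "Ck n f \<Longrightarrow> continuous_on A f"
proof (induction n)
  case 0
  then show ?case by (auto intro: continuous_on_subset)
next
  case (Suc n)
  then show ?case using Ck_Suc_imp by blast
qed

lemma Ck_const [simp]: "Ck n (\<lambda>x. c)"
  by (induction n arbitrary: c) (auto intro!: Ck_SucI[where f' = "\<lambda>x h. 0"] simp del: Ck.simps(2))

lemma Ck_add: "Ck n f \<Longrightarrow> Ck n g \<Longrightarrow> Ck n (\<lambda>x. f x + g x)"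
proof (induction n arbitrary: f g)
  case 0
  then show ?case by (auto intro: continuous_intros)
next
  case (Suc n)
  show ?case
    by (rule Ck_SucI[OF has_derivative_add[OF Ck_SucD(1)[OF Suc.prems(1)] Ck_SucD(1)[OF Suc.prems(2)]]])
       (intro Suc.IH Ck_SucD(2) Suc.prems; assumption)
qed

lemma Ck_mult: "Ck n f \<Longrightarrow> Ck n g \<Longrightarrow> Ck n (\<lambda>x. f x * g x)"
proof (induction n arbitrary: f g)
  case 0
  then show ?case by (auto intro: continuous_intros)
next
  case (Suc n)
  show ?case
    by (rule Ck_SucI[OF has_derivative_mult[OF Ck_SucD(1)[OF Suc.prems(1)] Ck_SucD(1)[OF Suc.prems(2)]]])
       (intro Ck_add Suc.IH Ck_SucD(2) Suc.prems Ck_Suc_imp; assumption)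
qed

lemma Ck_cmult: "Ck n f \<Longrightarrow> Ck n (\<lambda>x. c * f x)"
  by (intro Ck_mult Ck_const)

lemma Ck_diff: "Ck n f \<Longrightarrow> Ck n g \<Longrightarrow> Ck n (\<lambda>x. f x - g x)"
  using Ck_add[of n f "\<lambda>x. (-1) * g x"] Ck_cmult[of n g "-1"] by simp

lemma Ck_sum: "(\<And>i. i \<in> I \<Longrightarrow> Ck n (f i)) \<Longrightarrow> Ck n (\<lambda>x. \<Sum>i\<in>I. f i x)"
  by (induction I rule: infinite_finite_induct) (auto intro: Ck_add)

text \<open>Partial derivatives of the composition are combinations of partial derivatives of
  \<open>f\<close> with constant coefficients, the coordinates of \<open>L b\<close>. This expansion
  is what the induction needs, as \<open>Ck\<close> speaks only of derivatives along
  \<open>Basis\<close>.\<close>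

lemma Ck_compose_affine:
  fixes f :: "'b::euclidean_space \<Rightarrow> real" and L :: "'a::euclidean_space \<Rightarrow> 'b"
  assumes "bounded_linear L" "Ck n f"
  shows "Ck n (\<lambda>x. f (L x + c))"
  using assms(2)
proof (induction n arbitrary: f)
  case 0
  have "continuous_on UNIV (\<lambda>x. L x + c)"
    using assms(1) by (intro continuous_intros linear_continuous_on)
  with 0 show ?case
    using continuous_on_compose2[of UNIV f UNIV "\<lambda>x. L x + c"] by auto
next
  case (Suc n)
  have aff: "((\<lambda>x. L x + c) has_derivative L) (at x)" for x
    using has_derivative_add_const[OF bounded_linear_imp_has_derivative[OF assms(1)]] .
  have der: "((\<lambda>x. f (L x + c)) has_derivative (\<lambda>h. frechet_derivative f (at (L x + c)) (L h))) (at x)" for x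
    using has_derivative_compose[OF aff Ck_SucD(1)[OF Suc.prems, of "L x + c"]] .
  show ?case
  proof (rule Ck_SucI[OF der])
    fix b :: 'a
    have "frechet_derivative f (at (L x + c)) (L b)
        = (\<Sum>i\<in>Basis. (L b \<bullet> i) * frechet_derivative f (at (L x + c)) i)" for x
    proof -
      have lin: "linear (frechet_derivative f (at (L x + c)))"
        using Suc.prems by (simp add: linear_frechet_derivative)
      have "frechet_derivative f (at (L x + c)) (L b)
          = frechet_derivative f (at (L x + c)) (\<Sum>i\<in>Basis. (L b \<bullet> i) *\<^sub>R i)"
        by (simp add: euclidean_representation)
      then show ?thesis
        by (simp add: linear_sum[OF lin] linear_scale[OF lin])
    qed
    moreover have "Ck n (\<lambda>x. \<Sum>i\<in>Basis. (L b \<bullet> i) * frechet_derivative f (at (L x + c)) i)"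
      by (intro Ck_sum Ck_cmult Suc.IH[OF Ck_SucD(2)[OF Suc.prems]])
    ultimately show "Ck n (\<lambda>x. frechet_derivative f (at (L x + c)) (L b))"
      by simp
  qed
qed

text \<open>The derivative of \<open>1 / f\<close> contains \<open>1 / f\<close> itself, but needs
  it only one order lower, so the induction hypothesis for the same \<open>f\<close> closes the
  argument. The square root below works in the same way.\<close>

lemma Ck_inverse:
  "Ck n f \<Longrightarrow> (\<And>x. f x \<noteq> 0) \<Longrightarrow> Ck n (\<lambda>x. inverse (f x))"
proof (induction n arbitrary: f)
  case 0
  then show ?case by (auto intro: continuous_intros)
next
  case (Suc n)
  have "Ck n (\<lambda>x. inverse (f x))"
    using Suc.IH[OF Ck_Suc_imp[OF Suc.prems(1)] Suc.prems(2)] .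
  then have "b \<in> Basis \<Longrightarrow> Ck n (\<lambda>x. (-1) * (inverse (f x) * frechet_derivative f (at x) b * inverse (f x)))" for b
    by (intro Ck_cmult Ck_mult Ck_SucD(2)[OF Suc.prems(1)])
  then show ?case
    by (intro Ck_SucI[OF Deriv.has_derivative_inverse[OF Suc.prems(2) Ck_SucD(1)[OF Suc.prems(1)]]]) auto
qed

lemma Ck_sqrt:
  "Ck n f \<Longrightarrow> (\<And>x. 0 < f x) \<Longrightarrow> Ck n (\<lambda>x. sqrt (f x))"
proof (induction n arbitrary: f)
  case 0
  then show ?case by (auto intro: continuous_intros)
next
  case (Suc n)
  have "Ck n (\<lambda>x. sqrt (f x))"
    using Suc.IH[OF Ck_Suc_imp[OF Suc.prems(1)] Suc.prems(2)] .
  then have *: "b \<in> Basis \<Longrightarrow> Ck n (\<lambda>x. (1/2) * (frechet_derivative f (at x) b * inverse (sqrt (f x))))" for b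
    using Suc.prems(2) by (intro Ck_cmult Ck_mult Ck_SucD(2)[OF Suc.prems(1)] Ck_inverse)
      (auto simp: less_imp_neq[symmetric])
  have "((\<lambda>x. sqrt (f x)) has_derivative
      (\<lambda>h. (1/2) * (frechet_derivative f (at x) h * inverse (sqrt (f x))))) (at x)" for x
    using Suc.prems(2)[of x]
    by (auto intro!: derivative_eq_intros Ck_SucD(1)[OF Suc.prems(1)] simp: fun_eq_iff field_simps)
  then show ?case
    using * by (rule Ck_SucI)
qed

definition smooth :: "('a::euclidean_space \<Rightarrow> real) \<Rightarrow> bool" where
  "smooth f \<longleftrightarrow> (\<forall>n. Ck n f)"

lemma smooth_const [simp]: "smooth (\<lambda>x. c)"
  by (simp add: smooth_def)

lemma smooth_add: "smooth f \<Longrightarrow> smooth g \<Longrightarrow> smooth (\<lambda>x. f x + g x)"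
  by (simp add: smooth_def Ck_add)

lemma smooth_diff: "smooth f \<Longrightarrow> smooth g \<Longrightarrow> smooth (\<lambda>x. f x - g x)"
  by (simp add: smooth_def Ck_diff)

lemma smooth_mult: "smooth f \<Longrightarrow> smooth g \<Longrightarrow> smooth (\<lambda>x. f x * g x)"
  by (simp add: smooth_def Ck_mult)

lemma smooth_cmult: "smooth f \<Longrightarrow> smooth (\<lambda>x. c * f x)"
  by (simp add: smooth_def Ck_cmult)

lemma smooth_sum: "(\<And>i. i \<in> I \<Longrightarrow> smooth (f i)) \<Longrightarrow> smooth (\<lambda>x. \<Sum>i\<in>I. f i x)"
  by (simp add: smooth_def Ck_sum)

lemma smooth_divide: "smooth f \<Longrightarrow> smooth g \<Longrightarrow> (\<And>x. g x \<noteq> 0) \<Longrightarrow> smooth (\<lambda>x. f x / g x)"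
  by (simp add: smooth_def Ck_mult Ck_inverse divide_inverse)

lemma smooth_sqrt: "smooth f \<Longrightarrow> (\<And>x. 0 < f x) \<Longrightarrow> smooth (\<lambda>x. sqrt (f x))"
  by (simp add: smooth_def Ck_sqrt)

lemma smooth_compose_affine:
  assumes "bounded_linear L" "smooth f"
  shows "smooth (\<lambda>x. f (L x + c))"
  using assms by (simp add: smooth_def Ck_compose_affine)

lemma smooth_inner: "smooth (\<lambda>x. x \<bullet> b)"
  unfolding smooth_def
proof
  fix n
  show "Ck n (\<lambda>x. x \<bullet> b)"
  proof (cases n)
    case (Suc m)
    have "((\<lambda>x. x \<bullet> b) has_derivative (\<lambda>h. h \<bullet> b)) (at x)" for x
      by (auto intro!: derivative_eq_intros)
    then show ?thesis
      unfolding Suc by (rule Ck_SucI) simp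
  qed (auto intro: continuous_intros)
qed

lemma smooth_norm_sq: "smooth (\<lambda>x::'a::euclidean_space. (norm (x - a))\<^sup>2)"
proof -
  have "smooth (\<lambda>x::'a. \<Sum>b\<in>Basis. (x \<bullet> b - a \<bullet> b) * (x \<bullet> b - a \<bullet> b))"
    by (intro smooth_sum smooth_mult smooth_diff smooth_inner smooth_const)
  moreover have "(norm (x - a))\<^sup>2 = (\<Sum>b\<in>Basis. (x \<bullet> b - a \<bullet> b) * (x \<bullet> b - a \<bullet> b))" for x :: 'a
    unfolding power2_norm_eq_inner
    by (subst euclidean_inner) (simp add: inner_diff_left)
  ultimately show ?thesis by simp
qed

lemma smooth_continuous_on: "smooth f \<Longrightarrow> continuous_on A f"
  by (auto simp: smooth_def intro: Ck_imp_continuous_on)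

lemma smooth_has_derivative: "smooth f \<Longrightarrow> (f has_derivative frechet_derivative f (at x)) (at x)"
  unfolding smooth_def by (meson Ck_SucD(1))

lemma smooth_frechet_derivative: "smooth f \<Longrightarrow> b \<in> Basis \<Longrightarrow> smooth (\<lambda>x. frechet_derivative f (at x) b)"
  unfolding smooth_def using Ck_SucD(2) by blast

lemma gradient_eqI:
  assumes "GDERIV f x :> d"
  shows "gradient f x = d"
proof -
  have "frechet_derivative f (at x) = (\<lambda>h. h \<bullet> d)"
    using assms unfolding gderiv_def by (metis frechet_derivative_at)
  then show ?thesis
    by (simp add: gradient_def inner_commute[of _ d] euclidean_representation)
qed

lemma gradient_inner_Basis: "b \<in> Basis \<Longrightarrow> gradient f x \<bullet> b = frechet_derivative f (at x) b"
  by (simp add: gradient_def inner_sum_left inner_Basis if_distrib sum.delta cong: if_cong)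

lemma GDERIV_gradient:
  assumes "f differentiable (at x)"
  shows "GDERIV f x :> gradient f x"
proof -
  have lin: "linear (frechet_derivative f (at x))"
    using assms by (rule linear_frechet_derivative)
  have "frechet_derivative f (at x) h = h \<bullet> gradient f x" for h
  proof -
    have "frechet_derivative f (at x) h = frechet_derivative f (at x) (\<Sum>i\<in>Basis. (h \<bullet> i) *\<^sub>R i)"
      by (simp add: euclidean_representation)
    also have "\<dots> = h \<bullet> gradient f x"
      by (simp add: linear_sum[OF lin] linear_scale[OF lin] gradient_def inner_sum_right mult.commute)
    finally show ?thesis .
  qed
  then show ?thesis
    using assms unfolding gderiv_def frechet_derivative_works by presburger
qed

lemma smooth_GDERIV: "smooth f \<Longrightarrow> GDERIV f x :> gradient f x"
  by (intro GDERIV_gradient differentiableI[OF smooth_has_derivative])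

lemma smooth_gradient_inner: "smooth f \<Longrightarrow> b \<in> Basis \<Longrightarrow> smooth (\<lambda>x. gradient f x \<bullet> b)"
  by (simp add: gradient_inner_Basis smooth_frechet_derivative)

lemma continuous_on_gradient: "smooth f \<Longrightarrow> continuous_on A (gradient f)"
  unfolding gradient_def
  by (intro continuous_intros smooth_continuous_on smooth_frechet_derivative)

lemma gradient_add: "smooth f \<Longrightarrow> smooth g \<Longrightarrow> gradient (\<lambda>x. f x + g x) x = gradient f x + gradient g x"
  by (intro gradient_eqI GDERIV_add smooth_GDERIV)

lemma gradient_diff: "smooth f \<Longrightarrow> smooth g \<Longrightarrow> gradient (\<lambda>x. f x - g x) x = gradient f x - gradient g x"
  by (intro gradient_eqI GDERIV_diff smooth_GDERIV)

lemma gradient_mult: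
  "smooth f \<Longrightarrow> smooth g \<Longrightarrow> gradient (\<lambda>x. f x * g x) x = f x *\<^sub>R gradient g x + g x *\<^sub>R gradient f x"
  by (intro gradient_eqI GDERIV_mult smooth_GDERIV)

lemma gradient_cmult: "smooth f \<Longrightarrow> gradient (\<lambda>x. c * f x) x = c *\<^sub>R gradient f x"
proof -
  assume f: "smooth f"
  have "GDERIV (\<lambda>x. c) x :> 0" by (rule GDERIV_const)
  from gradient_eqI[OF GDERIV_mult[OF this smooth_GDERIV[OF f]]] show ?thesis by simp
qed

lemma gradient_sum:
  assumes "\<And>i. i \<in> I \<Longrightarrow> smooth (f i)"
  shows "gradient (\<lambda>x. \<Sum>i\<in>I. f i x) x = (\<Sum>i\<in>I. gradient (f i) x)"
  using assms
proof (induction I rule: infinite_finite_induct)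
  case (insert i I)
  have "gradient (\<lambda>x. f i x + (\<Sum>i\<in>I. f i x)) x = gradient (f i) x + gradient (\<lambda>x. \<Sum>i\<in>I. f i x) x"
    using insert.prems by (intro gradient_add smooth_sum) auto
  with insert show ?case by simp
qed (auto intro!: gradient_eqI GDERIV_const)

lemma gradient_local:
  assumes "open S" "x \<in> S" "\<And>y. y \<in> S \<Longrightarrow> f y = g y" "smooth f"
  shows "gradient g x = gradient f x"
proof (rule gradient_eqI)
  have "GDERIV f x :> gradient f x" by (rule smooth_GDERIV[OF assms(4)])
  then show "GDERIV g x :> gradient f x"
    unfolding gderiv_def using has_derivative_transform_within_open[of f _ x UNIV S g] assms by auto
qed

lemma gradient_eq_0_open:
  assumes "open S" "x \<in> S" "\<And>y. y \<in> S \<Longrightarrow> g y = c"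
  shows "gradient g x = 0"
proof -
  have "gradient g x = gradient (\<lambda>x. c) x"
    using assms by (intro gradient_local[of S]) auto
  then show ?thesis by (simp add: gradient_eqI[OF GDERIV_const])
qed

section \<open>Cutoff functions\<close>

text \<open>The derivatives of \<open>exp (- 1 / x)\<close> for \<open>x > 0\<close> are combinations of the members of this family.\<close>

definition flat_exp :: "nat \<Rightarrow> real \<Rightarrow> real" where
  "flat_exp k x = (if x \<le> 0 then 0 else inverse x ^ k * exp (- inverse x))"

text \<open>With \<open>y = 1 / x\<close>, the single term \<open>y ^ (k + 2) / fact (k + 2)\<close>
  of the exponential series is at most \<open>exp y\<close>. The two extra powers of
  \<open>y\<close> give the factor \<open>x\<^sup>2\<close>, which makes the derivative at zero
  vanish.\<close>

lemma flat_exp_bound: "\<bar>flat_exp k x\<bar> \<le> fact (k + 2) * x\<^sup>2"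
proof (cases "x \<le> 0")
  case False
  define y where "y = inverse x"
  have y: "y > 0" using False by (simp add: y_def)
  have "(\<Sum>n\<in>{k+2}. y ^ n /\<^sub>R fact n) \<le> (\<Sum>n. y ^ n /\<^sub>R fact n)"
    using y by (intro sum_le_suminf summable_exp_generic) auto
  then have "y ^ (k + 2) / fact (k + 2) \<le> exp y"
    by (simp add: exp_def divide_inverse mult.commute)
  then have "y ^ k * y\<^sup>2 \<le> fact (k + 2) * exp y"
    by (simp add: pos_divide_le_eq power_add power2_eq_square mult.commute)
  then have "y ^ k * exp (- y) * y\<^sup>2 \<le> fact (k + 2)"
    by (simp add: exp_minus divide_simps mult.commute mult.left_commute)
  then have "y ^ k * exp (- y) \<le> fact (k + 2) / y\<^sup>2"
    using y by (simp add: pos_le_divide_eq)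
  then show ?thesis
    using False y by (simp add: flat_exp_def y_def divide_inverse power_inverse)
qed (simp add: flat_exp_def)

lemma flat_exp_DERIV: "(flat_exp k has_real_derivative flat_exp (k + 2) x - k * flat_exp (k + 1) x) (at x)"
proof -
  consider "x < 0" | "x > 0" | "x = 0" by linarith
  then show ?thesis
  proof cases
    case 1
    have "((\<lambda>x. 0) has_real_derivative 0) (at x)" by simp
    then have "(flat_exp k has_real_derivative 0) (at x)"
      by (rule has_field_derivative_transform_within_open[of _ _ _ "{..<0}"])
         (use 1 in \<open>auto simp: flat_exp_def\<close>)
    with 1 show ?thesis by (simp add: flat_exp_def)
  next
    case 2
    have pow: "((\<lambda>x. inverse x ^ k) has_real_derivative - (k * inverse x ^ (k + 1))) (at x)"
    proof (cases k)
      case (Suc m)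
      have "x \<noteq> 0" using 2 by simp
      from DERIV_power[OF DERIV_inverse[OF this], of k] show ?thesis
        by (rule DERIV_cong) (simp add: Suc power2_eq_square)
    qed simp
    have "((\<lambda>x. exp (- inverse x)) has_real_derivative exp (- inverse x) * (inverse x)\<^sup>2) (at x)"
      using 2 by (auto intro!: derivative_eq_intros simp: power2_eq_square)
    from DERIV_mult[OF pow this]
    have "((\<lambda>x. inverse x ^ k * exp (- inverse x)) has_real_derivative
        flat_exp (k + 2) x - k * flat_exp (k + 1) x) (at x)"
      by (rule DERIV_cong) (use 2 in \<open>simp add: flat_exp_def power_add power2_eq_square algebra_simps\<close>)
    then show ?thesis
      by (rule has_field_derivative_transform_within_open[of _ _ _ "{0<..}"])
         (use 2 in \<open>auto simp: flat_exp_def\<close>)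
  next
    case 3
    have "((\<lambda>h. flat_exp k h / h) \<longlongrightarrow> 0) (at 0)"
    proof (rule Lim_null_comparison)
      show "\<forall>\<^sub>F h in at 0. norm (flat_exp k h / h) \<le> fact (k + 2) * \<bar>h\<bar>"
      proof (rule eventually_at_filter[THEN iffD2], rule always_eventually, intro allI impI)
        fix h :: real assume "h \<noteq> 0"
        have "\<bar>flat_exp k h\<bar> \<le> (fact (k + 2) * \<bar>h\<bar>) * \<bar>h\<bar>"
          using flat_exp_bound[of k h] by (simp add: power2_eq_square mult.assoc)
        with \<open>h \<noteq> 0\<close> show "norm (flat_exp k h / h) \<le> fact (k + 2) * \<bar>h\<bar>"
          by (simp add: abs_divide pos_divide_le_eq)
      qed
      show "((\<lambda>h. fact (k + 2) * \<bar>h\<bar>) \<longlongrightarrow> 0) (at (0::real))"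
        by (auto intro!: tendsto_eq_intros)
    qed
    then have "(flat_exp k has_real_derivative 0) (at 0)"
      by (simp add: has_field_derivative_def field_has_derivative_at DERIV_def flat_exp_def)
    with 3 show ?thesis by (simp add: flat_exp_def)
  qed
qed

lemma Ck_flat_exp: "Ck n f \<Longrightarrow> Ck n (\<lambda>x. flat_exp k (f x))"
proof (induction n arbitrary: k)
  case 0
  have "continuous_on UNIV (flat_exp k)"
    by (meson DERIV_isCont continuous_at_imp_continuous_on flat_exp_DERIV)
  with 0 show ?case
    using continuous_on_compose2[of UNIV "flat_exp k" UNIV f] by auto
next
  case (Suc n)
  have "((\<lambda>x. flat_exp k (f x)) has_derivative
      (\<lambda>h. (flat_exp (k + 2) (f x) - k * flat_exp (k + 1) (f x)) * frechet_derivative f (at x) h)) (at x)" for x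
    using has_derivative_compose[OF Ck_SucD(1)[OF Suc.prems] flat_exp_DERIV[unfolded has_field_derivative_def]] .
  then show ?case
    by (rule Ck_SucI)
       (intro Ck_mult Ck_diff Ck_cmult Suc.IH Ck_Suc_imp[OF Suc.prems] Ck_SucD(2)[OF Suc.prems])
qed

lemma smooth_flat_exp: "smooth f \<Longrightarrow> smooth (\<lambda>x. flat_exp k (f x))"
  by (simp add: smooth_def Ck_flat_exp)

text \<open>With \<open>f = flat_exp 0\<close>, the quotient \<open>f(s) / (f(s) + f(1 - s))\<close>
  is a smooth step from 0 for \<open>s \<le> 0\<close> to 1 for \<open>s \<ge> 1\<close>. It is
  composed with a function that is affine in the squared distance, because the distance itself is
  not smooth at the centre.\<close>

lemma bump_exists:
  fixes a :: "'a::euclidean_space"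
  assumes "0 < r" "r < R"
  obtains \<psi> :: "'a \<Rightarrow> real" where "smooth \<psi>" "\<And>x. 0 \<le> \<psi> x" "\<And>x. \<psi> x \<le> 1"
    "\<And>x. dist a x \<le> r \<Longrightarrow> \<psi> x = 1" "\<And>x. R \<le> dist a x \<Longrightarrow> \<psi> x = 0"
proof -
  define s where "s x = (R\<^sup>2 - (norm (x - a))\<^sup>2) / (R\<^sup>2 - r\<^sup>2)" for x
  define \<psi> where "\<psi> x = flat_exp 0 (s x) / (flat_exp 0 (s x) + flat_exp 0 (1 - s x))" for x
  have pos: "0 < R\<^sup>2 - r\<^sup>2"
    using assms by (simp add: power_strict_mono)
  have fpos: "0 < flat_exp 0 t" if "t > 0" for t
    using that by (simp add: flat_exp_def)
  have fnn: "0 \<le> flat_exp 0 t" for t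
    by (simp add: flat_exp_def)
  \<comment> \<open>The numbers \<open>t\<close> and \<open>1 - t\<close> are never both
    nonpositive, so one of the two summands is positive.\<close>
  have den: "0 < flat_exp 0 t + flat_exp 0 (1 - t)" for t
    using fpos[of t] fpos[of "1 - t"] fnn[of t] fnn[of "1 - t"] by (cases "t > 0") auto
  have s: "smooth s"
    using smooth_divide[OF smooth_diff[OF smooth_const[of "R\<^sup>2"] smooth_norm_sq[of a]] smooth_const[of "R\<^sup>2 - r\<^sup>2"]] pos
    unfolding s_def by auto
  have "smooth \<psi>"
    unfolding \<psi>_def
    by (intro smooth_divide smooth_add smooth_flat_exp smooth_diff smooth_const s)
       (use den in \<open>simp add: less_imp_neq[symmetric]\<close>)
  moreover have "0 \<le> \<psi> x" "\<psi> x \<le> 1" for x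
    unfolding \<psi>_def using den[of "s x"] fnn[of "s x"] fnn[of "1 - s x"] by (auto simp: divide_simps)
  moreover have "\<psi> x = 1" if "dist a x \<le> r" for x
  proof -
    have "(norm (x - a))\<^sup>2 \<le> r\<^sup>2"
      using that by (simp add: dist_norm norm_minus_commute power_mono)
    then have "1 \<le> s x"
      using pos by (simp add: s_def pos_le_divide_eq)
    then show ?thesis
      using fpos[of "s x"] by (simp add: \<psi>_def flat_exp_def[of 0 "1 - s x"])
  qed
  moreover have "\<psi> x = 0" if "R \<le> dist a x" for x
  proof -
    have "R\<^sup>2 \<le> (norm (x - a))\<^sup>2"
      using that assms by (simp add: dist_norm norm_minus_commute power_mono)
    then have "s x \<le> 0"
      using pos by (simp add: s_def divide_le_0_iff)
    then show ?thesis
      by (simp add: \<psi>_def flat_exp_def)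
  qed
  ultimately show ?thesis by (rule that)
qed

lemma test_functionI:
  assumes "smooth \<phi>" "compact K" "K \<subseteq> S" "\<And>x. x \<notin> K \<Longrightarrow> \<phi> x = 0"
  shows "test_function S \<phi>"
proof -
  have "{x. \<phi> x \<noteq> 0} \<subseteq> K" using assms(4) by blast
  then have "closure {x. \<phi> x \<noteq> 0} \<subseteq> K"
    by (simp add: assms(2) closure_minimal compact_imp_closed)
  then show ?thesis
    using assms(1,2,3) unfolding test_function_def smooth_def
    by (metis closed_closure compact_Int_closed inf.absorb_iff2 order_trans)
qed

lemma test_function_smooth: "test_function S \<phi> \<Longrightarrow> smooth \<phi>"
  by (simp add: test_function_def smooth_def)

section \<open>Square integrable functions\<close>

lemma set_lebesgue_integral_eq_restrict:
  fixes f :: "'a::euclidean_space \<Rightarrow> 'b::euclidean_space"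
  assumes "S \<in> sets lebesgue"
  shows "set_lebesgue_integral lebesgue S f = integral\<^sup>L (lebesgue_on S) f"
  using assms by (simp add: set_lebesgue_integral_def integral_restrict_space)

lemma set_integrable_eq_restrict:
  fixes f :: "'a::euclidean_space \<Rightarrow> 'b::euclidean_space"
  assumes "S \<in> sets lebesgue"
  shows "set_integrable lebesgue S f \<longleftrightarrow> integrable (lebesgue_on S) f"
  using assms by (simp add: set_integrable_def integrable_restrict_space)

lemma AE_eq_restrict:
  assumes "S \<in> sets lebesgue"
  shows "(AE x\<in>S in lebesgue. P x) \<longleftrightarrow> (AE x in lebesgue_on S. P x)"
  using assms by (simp add: AE_restrict_space_iff)

lemma set_borel_measurable_eq_restrict:
  fixes f :: "'a::euclidean_space \<Rightarrow> 'b::euclidean_space"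
  assumes "S \<in> sets lebesgue"
  shows "set_borel_measurable lebesgue S f \<longleftrightarrow> f \<in> borel_measurable (lebesgue_on S)"
  using assms by (simp add: set_borel_measurable_def borel_measurable_restrict_space_iff)

lemma L2_iff:
  fixes f :: "'a::euclidean_space \<Rightarrow> 'b::euclidean_space"
  assumes "S \<in> sets lebesgue"
  shows "f \<in> L2 S \<longleftrightarrow> f \<in> borel_measurable (lebesgue_on S) \<and> integrable (lebesgue_on S) (\<lambda>x. (norm (f x))\<^sup>2)"
  unfolding L2_def mem_Collect_eq set_borel_measurable_eq_restrict[OF assms] set_integrable_eq_restrict[OF assms] ..

lemma norm_L2_eq:
  assumes "S \<in> sets lebesgue"
  shows "norm_L2 S f = sqrt (LINT x|lebesgue_on S. (norm (f x))\<^sup>2)"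
  by (simp add: norm_L2_def set_lebesgue_integral_eq_restrict[OF assms])

lemma norm_L2_nonneg [simp]: "0 \<le> norm_L2 S f"
  unfolding norm_L2_def set_lebesgue_integral_def by (auto intro!: integral_nonneg_AE)

lemma norm_L2_sq:
  assumes "S \<in> sets lebesgue"
  shows "(norm_L2 S f)\<^sup>2 = (LINT x|lebesgue_on S. (norm (f x))\<^sup>2)"
  unfolding norm_L2_eq[OF assms] by (rule real_sqrt_pow2) (auto intro!: integral_nonneg_AE)

lemma L2_mono:
  fixes f :: "'a::euclidean_space \<Rightarrow> 'b::euclidean_space" and g :: "'a \<Rightarrow> 'c::euclidean_space"
  assumes S: "S \<in> sets lebesgue" and g: "g \<in> L2 S" and f: "f \<in> borel_measurable (lebesgue_on S)"
    and le: "AE x in lebesgue_on S. norm (f x) \<le> norm (g x)"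
  shows "f \<in> L2 S" "norm_L2 S f \<le> norm_L2 S g"
proof -
  have gi: "integrable (lebesgue_on S) (\<lambda>x. (norm (g x))\<^sup>2)"
    using g L2_iff[OF S] by blast
  have le2: "AE x in lebesgue_on S. (norm (f x))\<^sup>2 \<le> (norm (g x))\<^sup>2"
    using le by (auto intro: power_mono)
  have fi: "integrable (lebesgue_on S) (\<lambda>x. (norm (f x))\<^sup>2)"
    by (rule Bochner_Integration.integrable_bound[OF gi]) (use f le2 in auto)
  with f show "f \<in> L2 S" by (simp add: L2_iff[OF S])
  show "norm_L2 S f \<le> norm_L2 S g"
    unfolding norm_L2_eq[OF S] by (intro real_sqrt_le_mono integral_mono_AE fi gi le2)
qed

lemma norm_L2_cong_AE:
  assumes "S \<in> sets lebesgue" "f \<in> borel_measurable (lebesgue_on S)" "g \<in> borel_measurable (lebesgue_on S)"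
    "AE x in lebesgue_on S. f x = g x"
  shows "norm_L2 S f = norm_L2 S g"
  unfolding norm_L2_eq[OF assms(1)]
  by (intro arg_cong[where f = sqrt] integral_cong_AE) (use assms in auto)

lemma norm_L2_cong:
  assumes "S \<in> sets lebesgue" "\<And>x. x \<in> S \<Longrightarrow> f x = g x"
  shows "norm_L2 S f = norm_L2 S g"
  unfolding norm_L2_eq[OF assms(1)]
  by (intro arg_cong[where f = sqrt] Bochner_Integration.integral_cong) (use assms in auto)

lemma L2_measurable:
  fixes f :: "'a::euclidean_space \<Rightarrow> 'b::euclidean_space"
  shows "S \<in> sets lebesgue \<Longrightarrow> f \<in> L2 S \<Longrightarrow> f \<in> borel_measurable (lebesgue_on S)"
  using L2_iff by blast

lemma L2_integrable_sq:
  fixes f :: "'a::euclidean_space \<Rightarrow> 'b::euclidean_space"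
  shows "S \<in> sets lebesgue \<Longrightarrow> f \<in> L2 S \<Longrightarrow> integrable (lebesgue_on S) (\<lambda>x. (norm (f x))\<^sup>2)"
  using L2_iff by blast

lemma L2_subset:
  fixes f :: "'a::euclidean_space \<Rightarrow> 'b::euclidean_space"
  assumes S: "S \<in> sets lebesgue" and T: "T \<in> sets lebesgue" "T \<subseteq> S" and f: "f \<in> L2 S"
  shows "f \<in> L2 T" "norm_L2 T f \<le> norm_L2 S f"
proof -
  have fm: "f \<in> borel_measurable (lebesgue_on T)"
    using L2_measurable[OF S f] T(2) by (rule measurable_restrict_mono)
  have i: "integrable lebesgue (\<lambda>x. indicator S x *\<^sub>R (norm (f x))\<^sup>2)"
    using L2_integrable_sq[OF S f] S by (subst (asm) integrable_restrict_space) auto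
  have m: "(\<lambda>x. indicator T x *\<^sub>R (norm (f x))\<^sup>2) \<in> borel_measurable lebesgue"
    using fm T by (subst borel_measurable_restrict_space_iff[symmetric]) auto
  have iT: "integrable lebesgue (\<lambda>x. indicator T x *\<^sub>R (norm (f x))\<^sup>2)"
    by (rule Bochner_Integration.integrable_bound[OF i m]) (use T in \<open>auto split: split_indicator\<close>)
  then have "integrable (lebesgue_on T) (\<lambda>x. (norm (f x))\<^sup>2)"
    using T by (subst integrable_restrict_space) auto
  with fm show "f \<in> L2 T" using L2_iff[OF T(1)] by blast
  show "norm_L2 T f \<le> norm_L2 S f"
    unfolding norm_L2_def set_lebesgue_integral_def
    by (rule real_sqrt_le_mono, rule integral_mono[OF iT i])
       (use T in \<open>simp add: indicator_def subset_iff\<close>)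
qed

lemma L2_mult_integrable:
  fixes f :: "'a::euclidean_space \<Rightarrow> 'b::euclidean_space" and g :: "'a \<Rightarrow> 'c::euclidean_space"
  assumes S: "S \<in> sets lebesgue" and f: "f \<in> L2 S" and g: "g \<in> L2 S"
  shows "integrable (lebesgue_on S) (\<lambda>x. norm (f x) * norm (g x))"
proof (rule Bochner_Integration.integrable_bound)
  show "integrable (lebesgue_on S) (\<lambda>x. (norm (f x))\<^sup>2 + (norm (g x))\<^sup>2)"
    using L2_integrable_sq[OF S f] L2_integrable_sq[OF S g] by (rule Bochner_Integration.integrable_add)
  show "(\<lambda>x. norm (f x) * norm (g x)) \<in> borel_measurable (lebesgue_on S)"
    using L2_measurable[OF S f] L2_measurable[OF S g] by measurable
  have "norm (norm (f x) * norm (g x)) \<le> norm ((norm (f x))\<^sup>2 + (norm (g x))\<^sup>2)" for x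
  proof -
    have "0 \<le> norm (f x) * norm (g x)" "2 * (norm (f x) * norm (g x)) \<le> (norm (f x))\<^sup>2 + (norm (g x))\<^sup>2"
      using sum_squares_bound[of "norm (f x)" "norm (g x)"] by auto
    then have "norm (f x) * norm (g x) \<le> (norm (f x))\<^sup>2 + (norm (g x))\<^sup>2" by linarith
    then show ?thesis by simp
  qed
  then show "AE x in lebesgue_on S. norm (norm (f x) * norm (g x)) \<le> norm ((norm (f x))\<^sup>2 + (norm (g x))\<^sup>2)"
    by simp
qed

text \<open>The product is bounded pointwise by a weighted mean of the two squares, with the weight
  \<open>t\<close> that balances the two norms. Adding \<open>e\<close> to both norms keeps the
  weight positive when a norm vanishes; at the end \<open>e\<close> tends to zero.\<close>

lemma L2_Cauchy_Schwarz_norm: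
  fixes f :: "'a::euclidean_space \<Rightarrow> 'b::euclidean_space" and g :: "'a \<Rightarrow> 'c::euclidean_space"
  assumes S: "S \<in> sets lebesgue" and f: "f \<in> L2 S" and g: "g \<in> L2 S"
  shows "(LINT x|lebesgue_on S. norm (f x) * norm (g x)) \<le> norm_L2 S f * norm_L2 S g"
proof -
  define a b where "a = norm_L2 S f" and "b = norm_L2 S g"
  have ab: "0 \<le> a" "0 \<le> b" by (auto simp: a_def b_def)
  have fi: "integrable (lebesgue_on S) (\<lambda>x. (norm (f x))\<^sup>2)"
    and gi: "integrable (lebesgue_on S) (\<lambda>x. (norm (g x))\<^sup>2)"
    using L2_integrable_sq[OF S f] L2_integrable_sq[OF S g] by auto
  have *: "(LINT x|lebesgue_on S. norm (f x) * norm (g x)) \<le> (a + e) * (b + e)" if "e > 0" for e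
  proof -
    define t where "t = (b + e) / (a + e)"
    have t: "t > 0" using ab that by (simp add: t_def)
    have pt: "norm (f x) * norm (g x) \<le> (t * (norm (f x))\<^sup>2 + (norm (g x))\<^sup>2 / t) / 2" for x
    proof -
      have "0 \<le> (t * norm (f x) - norm (g x))\<^sup>2 / t" using t by simp
      also have "\<dots> = t * (norm (f x))\<^sup>2 + (norm (g x))\<^sup>2 / t - 2 * (norm (f x) * norm (g x))"
        using t by (simp add: power2_eq_square field_simps)
      finally show ?thesis by simp
    qed
    have "(LINT x|lebesgue_on S. norm (f x) * norm (g x))
        \<le> (LINT x|lebesgue_on S. (t * (norm (f x))\<^sup>2 + (norm (g x))\<^sup>2 / t) / 2)"
      using pt by (intro integral_mono L2_mult_integrable assms) (use fi gi in auto)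
    also have "\<dots> = (t * a\<^sup>2 + b\<^sup>2 / t) / 2"
      using fi gi by (simp add: a_def b_def norm_L2_sq[OF S])
    also have "\<dots> \<le> (a + e) * (b + e)"
    proof -
      have "t * a\<^sup>2 \<le> t * (a + e)\<^sup>2" using t ab that by (intro mult_left_mono power_mono) auto
      also have "\<dots> = (a + e) * (b + e)" using ab that by (simp add: t_def power2_eq_square)
      finally have 1: "t * a\<^sup>2 \<le> (a + e) * (b + e)" .
      have "b\<^sup>2 / t \<le> (b + e)\<^sup>2 / t" using t ab that by (intro divide_right_mono power_mono) auto
      also have "\<dots> = (a + e) * (b + e)" using ab that by (simp add: t_def power2_eq_square)
      finally show ?thesis using 1 by simp
    qed
    finally show ?thesis .
  qed
  have "((\<lambda>e. (a + e) * (b + e)) \<longlongrightarrow> (a + 0) * (b + 0)) (at_right 0)"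
    by (intro tendsto_intros)
  then have "(LINT x|lebesgue_on S. norm (f x) * norm (g x)) \<le> (a + 0) * (b + 0)"
    by (rule tendsto_lowerbound) (auto intro!: eventually_at_rightI[of 0 1] *)
  then show ?thesis by (simp add: a_def b_def)
qed

lemma L2_inner:
  fixes f g :: "'a::euclidean_space \<Rightarrow> 'b::euclidean_space"
  assumes S: "S \<in> sets lebesgue" and f: "f \<in> L2 S" and g: "g \<in> L2 S"
  shows "integrable (lebesgue_on S) (\<lambda>x. f x \<bullet> g x)"
    and "\<bar>LINT x|lebesgue_on S. f x \<bullet> g x\<bar> \<le> norm_L2 S f * norm_L2 S g"
proof -
  have m: "(\<lambda>x. f x \<bullet> g x) \<in> borel_measurable (lebesgue_on S)"
    using L2_measurable[OF S f] L2_measurable[OF S g] by measurable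
  have le: "\<bar>f x \<bullet> g x\<bar> \<le> norm (f x) * norm (g x)" for x by (rule Cauchy_Schwarz_ineq2)
  show i: "integrable (lebesgue_on S) (\<lambda>x. f x \<bullet> g x)"
    by (rule Bochner_Integration.integrable_bound[OF L2_mult_integrable[OF assms] m]) (use le in auto)
  have "\<bar>LINT x|lebesgue_on S. f x \<bullet> g x\<bar> \<le> (LINT x|lebesgue_on S. \<bar>f x \<bullet> g x\<bar>)"
    by (rule integral_abs_bound)
  also have "\<dots> \<le> (LINT x|lebesgue_on S. norm (f x) * norm (g x))"
    using le i by (intro integral_mono L2_mult_integrable assms) auto
  also note L2_Cauchy_Schwarz_norm[OF assms]
  finally show "\<bar>LINT x|lebesgue_on S. f x \<bullet> g x\<bar> \<le> norm_L2 S f * norm_L2 S g" .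
qed

lemma L2_mult:
  fixes f g :: "'a::euclidean_space \<Rightarrow> real"
  assumes S: "S \<in> sets lebesgue" and f: "f \<in> L2 S" and g: "g \<in> L2 S"
  shows "integrable (lebesgue_on S) (\<lambda>x. f x * g x)"
    and "\<bar>LINT x|lebesgue_on S. f x * g x\<bar> \<le> norm_L2 S f * norm_L2 S g"
  using L2_inner[OF assms] by auto

lemma L2_add:
  fixes f g :: "'a::euclidean_space \<Rightarrow> 'b::euclidean_space"
  assumes S: "S \<in> sets lebesgue" and f: "f \<in> L2 S" and g: "g \<in> L2 S"
  shows "(\<lambda>x. f x + g x) \<in> L2 S"
    and "norm_L2 S (\<lambda>x. f x + g x) \<le> norm_L2 S f + norm_L2 S g"
proof -
  have m: "(\<lambda>x. f x + g x) \<in> borel_measurable (lebesgue_on S)"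
    using L2_measurable[OF S f] L2_measurable[OF S g] by measurable
  have fi: "integrable (lebesgue_on S) (\<lambda>x. (norm (f x))\<^sup>2)"
    and gi: "integrable (lebesgue_on S) (\<lambda>x. (norm (g x))\<^sup>2)"
    using L2_integrable_sq[OF S f] L2_integrable_sq[OF S g] by auto
  note fg = L2_mult_integrable[OF assms]
  have le: "(norm (f x + g x))\<^sup>2 \<le> (norm (f x))\<^sup>2 + (norm (g x))\<^sup>2 + 2 * (norm (f x) * norm (g x))" for x
  proof -
    have "(norm (f x + g x))\<^sup>2 \<le> (norm (f x) + norm (g x))\<^sup>2"
      by (intro power_mono norm_triangle_ineq) auto
    then show ?thesis by (simp add: power2_sum)
  qed
  have ri: "integrable (lebesgue_on S) (\<lambda>x. (norm (f x))\<^sup>2 + (norm (g x))\<^sup>2 + 2 * (norm (f x) * norm (g x)))"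
    using fi gi fg by auto
  have i: "integrable (lebesgue_on S) (\<lambda>x. (norm (f x + g x))\<^sup>2)"
    by (rule Bochner_Integration.integrable_bound[OF ri]) (use m le in \<open>auto intro!: AE_I2 order_trans[OF _ abs_ge_self]\<close>)
  with m show "(\<lambda>x. f x + g x) \<in> L2 S" using L2_iff[OF S] by blast
  have "(norm_L2 S (\<lambda>x. f x + g x))\<^sup>2 \<le> (LINT x|lebesgue_on S. (norm (f x))\<^sup>2 + (norm (g x))\<^sup>2 + 2 * (norm (f x) * norm (g x)))"
    unfolding norm_L2_sq[OF S] by (intro integral_mono i ri le)
  also have "\<dots> = (norm_L2 S f)\<^sup>2 + (norm_L2 S g)\<^sup>2 + 2 * (LINT x|lebesgue_on S. norm (f x) * norm (g x))"
    using fi gi fg by (simp add: norm_L2_sq[OF S])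
  also have "\<dots> \<le> (norm_L2 S f + norm_L2 S g)\<^sup>2"
    using L2_Cauchy_Schwarz_norm[OF assms] by (simp add: power2_sum)
  finally show "norm_L2 S (\<lambda>x. f x + g x) \<le> norm_L2 S f + norm_L2 S g"
    by (rule power2_le_imp_le) auto
qed

lemma L2_scaleR:
  fixes f :: "'a::euclidean_space \<Rightarrow> 'b::euclidean_space"
  assumes S: "S \<in> sets lebesgue" and f: "f \<in> L2 S"
  shows "(\<lambda>x. c *\<^sub>R f x) \<in> L2 S" and "norm_L2 S (\<lambda>x. c *\<^sub>R f x) = \<bar>c\<bar> * norm_L2 S f"
proof -
  show "(\<lambda>x. c *\<^sub>R f x) \<in> L2 S"
    using L2_measurable[OF S f] L2_integrable_sq[OF S f] unfolding L2_iff[OF S]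
    by (auto simp: power_mult_distrib)
  have "norm_L2 S (\<lambda>x. c *\<^sub>R f x) = sqrt (c\<^sup>2 * (LINT x|lebesgue_on S. (norm (f x))\<^sup>2))"
    by (simp add: norm_L2_eq[OF S] power_mult_distrib)
  then show "norm_L2 S (\<lambda>x. c *\<^sub>R f x) = \<bar>c\<bar> * norm_L2 S f"
    by (simp add: norm_L2_eq[OF S] real_sqrt_mult)
qed

lemma L2_cmult:
  fixes f :: "'a::euclidean_space \<Rightarrow> real"
  assumes S: "S \<in> sets lebesgue" and f: "f \<in> L2 S"
  shows "(\<lambda>x. c * f x) \<in> L2 S" and "norm_L2 S (\<lambda>x. c * f x) = \<bar>c\<bar> * norm_L2 S f"
  using L2_scaleR[OF assms, of c] by simp_all

lemma L2_diff:
  fixes f g :: "'a::euclidean_space \<Rightarrow> 'b::euclidean_space"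
  assumes S: "S \<in> sets lebesgue" and f: "f \<in> L2 S" and g: "g \<in> L2 S"
  shows "(\<lambda>x. f x - g x) \<in> L2 S"
    and "norm_L2 S (\<lambda>x. f x - g x) \<le> norm_L2 S f + norm_L2 S g"
  using L2_add[OF S f L2_scaleR(1)[OF S g, of "-1"]] L2_scaleR(2)[OF S g, of "-1"] by simp_all

lemma norm_L2_minus_commute: "norm_L2 S (\<lambda>x. f x - g x) = norm_L2 S (\<lambda>x. g x - f x)"
  by (simp add: norm_L2_def norm_minus_commute)

lemma norm_L2_triangle:
  fixes f g h :: "'a::euclidean_space \<Rightarrow> 'b::euclidean_space"
  assumes S: "S \<in> sets lebesgue" and f: "f \<in> L2 S" and g: "g \<in> L2 S" and h: "h \<in> L2 S"
  shows "norm_L2 S (\<lambda>x. f x - h x) \<le> norm_L2 S (\<lambda>x. f x - g x) + norm_L2 S (\<lambda>x. g x - h x)"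
  using L2_add(2)[OF S L2_diff(1)[OF S f g] L2_diff(1)[OF S g h]] by simp

lemma norm_L2_triangle':
  fixes f g :: "'a::euclidean_space \<Rightarrow> 'b::euclidean_space"
  assumes S: "S \<in> sets lebesgue" and f: "f \<in> L2 S" and g: "g \<in> L2 S"
  shows "norm_L2 S f \<le> norm_L2 S (\<lambda>x. f x - g x) + norm_L2 S g"
  using L2_add(2)[OF S L2_diff(1)[OF S f g] g] by simp

lemma L2_zero [simp]: "(\<lambda>x. 0) \<in> L2 S" "norm_L2 S (\<lambda>x. 0) = 0"
  by (auto simp: L2_def norm_L2_def set_borel_measurable_def set_integrable_def)

lemma L2_sum:
  fixes f :: "'i \<Rightarrow> 'a::euclidean_space \<Rightarrow> 'b::euclidean_space"
  assumes S: "S \<in> sets lebesgue" and f: "\<And>i. i \<in> I \<Longrightarrow> f i \<in> L2 S"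
  shows "(\<lambda>x. \<Sum>i\<in>I. f i x) \<in> L2 S"
    and "norm_L2 S (\<lambda>x. \<Sum>i\<in>I. f i x) \<le> (\<Sum>i\<in>I. norm_L2 S (f i))"
proof -
  have "(\<lambda>x. \<Sum>i\<in>I. f i x) \<in> L2 S \<and> norm_L2 S (\<lambda>x. \<Sum>i\<in>I. f i x) \<le> (\<Sum>i\<in>I. norm_L2 S (f i))"
    using f
  proof (induction I rule: infinite_finite_induct)
    case (insert i I)
    then have "f i \<in> L2 S" "(\<lambda>x. \<Sum>i\<in>I. f i x) \<in> L2 S" by auto
    from L2_add[OF S this] insert show ?case by auto
  qed auto
  then show "(\<lambda>x. \<Sum>i\<in>I. f i x) \<in> L2 S"
    and "norm_L2 S (\<lambda>x. \<Sum>i\<in>I. f i x) \<le> (\<Sum>i\<in>I. norm_L2 S (f i))" by auto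
qed

lemma L2_bounded_scaleR:
  fixes f :: "'a::euclidean_space \<Rightarrow> 'b::euclidean_space"
  assumes S: "S \<in> sets lebesgue" and f: "f \<in> L2 S"
    and k: "k \<in> borel_measurable (lebesgue_on S)" "\<And>x. x \<in> S \<Longrightarrow> \<bar>k x\<bar> \<le> C" and C: "0 \<le> C"
  shows "(\<lambda>x. k x *\<^sub>R f x) \<in> L2 S" and "norm_L2 S (\<lambda>x. k x *\<^sub>R f x) \<le> C * norm_L2 S f"
proof -
  note g = L2_scaleR[OF S f, of C]
  have m: "(\<lambda>x. k x *\<^sub>R f x) \<in> borel_measurable (lebesgue_on S)"
    using L2_measurable[OF S f] k(1) by measurable
  have le: "AE x in lebesgue_on S. norm (k x *\<^sub>R f x) \<le> norm (C *\<^sub>R f x)"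
    using k(2) C by (intro AE_I2) (auto intro!: mult_right_mono)
  show "(\<lambda>x. k x *\<^sub>R f x) \<in> L2 S" "norm_L2 S (\<lambda>x. k x *\<^sub>R f x) \<le> C * norm_L2 S f"
    using L2_mono[OF S g(1) m le] g(2) C by auto
qed

lemma L2_scaleR_vector:
  fixes f :: "'a::euclidean_space \<Rightarrow> real" and g :: "'a \<Rightarrow> 'b::euclidean_space"
  assumes S: "S \<in> sets lebesgue" and f: "f \<in> L2 S"
    and g: "g \<in> borel_measurable (lebesgue_on S)" "\<And>x. x \<in> S \<Longrightarrow> norm (g x) \<le> C" and C: "0 \<le> C"
  shows "(\<lambda>x. f x *\<^sub>R g x) \<in> L2 S" and "norm_L2 S (\<lambda>x. f x *\<^sub>R g x) \<le> C * norm_L2 S f"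
proof -
  note h = L2_cmult[OF S f, of C]
  have m: "(\<lambda>x. f x *\<^sub>R g x) \<in> borel_measurable (lebesgue_on S)"
    using L2_measurable[OF S f] g(1) by measurable
  have le: "AE x in lebesgue_on S. norm (f x *\<^sub>R g x) \<le> norm (C * f x)"
    using g(2) C by (intro AE_I2) (auto simp: abs_mult mult.commute[of C] intro!: mult_left_mono)
  show "(\<lambda>x. f x *\<^sub>R g x) \<in> L2 S" "norm_L2 S (\<lambda>x. f x *\<^sub>R g x) \<le> C * norm_L2 S f"
    using L2_mono[OF S h(1) m le] h(2) C by auto
qed

lemma borel_measurable_lebesgue_on_continuous:
  fixes f :: "'a::euclidean_space \<Rightarrow> 'b::euclidean_space"
  assumes "S \<in> sets lebesgue" "continuous_on UNIV f"
  shows "f \<in> borel_measurable (lebesgue_on S)"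
  using assms by (meson continuous_imp_measurable_on_sets_lebesgue continuous_on_subset subset_UNIV)

lemma L2_bounded:
  fixes f :: "'a::euclidean_space \<Rightarrow> 'b::euclidean_space"
  assumes S: "S \<in> lmeasurable" and f: "f \<in> borel_measurable (lebesgue_on S)"
    and le: "AE x in lebesgue_on S. norm (f x) \<le> C" and C: "0 \<le> C"
  shows "f \<in> L2 S" "norm_L2 S f \<le> C * sqrt (measure lebesgue S)"
proof -
  have S': "S \<in> sets lebesgue" using S by auto
  have meas: "measure (lebesgue_on S) S = measure lebesgue S"
    using S' by (simp add: measure_restrict_space)
  have ci: "integrable (lebesgue_on S) (\<lambda>x. (norm C)\<^sup>2)"
    using S S' by (simp add: integrable_restrict_space lmeasurable_iff_integrable)
  have c: "(\<lambda>x. C) \<in> L2 S" using ci by (simp add: L2_iff[OF S'])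
  have n: "norm_L2 S (\<lambda>x. C) = C * sqrt (measure lebesgue S)"
    using C by (simp add: norm_L2_eq[OF S'] real_sqrt_mult meas mult.commute)
  have le': "AE x in lebesgue_on S. norm (f x) \<le> norm C" using le C by auto
  show "f \<in> L2 S" "norm_L2 S f \<le> C * sqrt (measure lebesgue S)"
    using L2_mono[OF S' c f le'] n by auto
qed

lemma L2_continuous_bounded_set:
  fixes f :: "'a::euclidean_space \<Rightarrow> 'b::euclidean_space"
  assumes S: "S \<in> sets lebesgue" "bounded S" and f: "continuous_on UNIV f"
  shows "f \<in> L2 S"
proof -
  have "compact (closure S)" using S by (simp add: compact_closure)
  then have "bounded (f ` closure S)"
    using f by (intro compact_imp_bounded compact_continuous_image) (auto intro: continuous_on_subset)
  then obtain C where C: "\<And>x. x \<in> S \<Longrightarrow> norm (f x) \<le> C" "0 \<le> C"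
    unfolding bounded_pos using closure_subset[of S] by (metis image_eqI less_imp_le subsetD)
  show ?thesis
    using S C f by (intro L2_bounded(1)[of _ _ C] borel_measurable_lebesgue_on_continuous AE_I2 bounded_set_imp_lmeasurable) auto
qed

lemma L2_extend:
  fixes f :: "'a::euclidean_space \<Rightarrow> 'b::euclidean_space"
  assumes S: "S \<in> sets lebesgue" and T: "T \<in> sets lebesgue" "T \<subseteq> S" and f: "f \<in> L2 T"
    and 0: "\<And>x. x \<in> S \<Longrightarrow> x \<notin> T \<Longrightarrow> f x = 0"
  shows "f \<in> L2 S" "norm_L2 S f = norm_L2 T f"
proof -
  have eq: "(\<lambda>x. indicator S x *\<^sub>R f x) = (\<lambda>x. indicator T x *\<^sub>R f x)"
    using 0 T(2) by (intro ext) (auto split: split_indicator)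
  have eq2: "(\<lambda>x. indicator S x *\<^sub>R (norm (f x))\<^sup>2) = (\<lambda>x. indicator T x *\<^sub>R (norm (f x))\<^sup>2)"
    using 0 T(2) by (intro ext) (auto split: split_indicator)
  show "f \<in> L2 S" "norm_L2 S f = norm_L2 T f"
    using f unfolding L2_def mem_Collect_eq norm_L2_def set_borel_measurable_def set_integrable_def set_lebesgue_integral_def
    by (simp_all only: eq eq2)
qed

lemma test_function_bounded_support:
  assumes "test_function S \<phi>"
  obtains R where "0 < R" "\<And>x. \<phi> x \<noteq> 0 \<Longrightarrow> x \<in> ball 0 R"
proof -
  have "bounded {x. \<phi> x \<noteq> 0}"
    using assms closure_subset unfolding test_function_def by (meson bounded_subset compact_imp_bounded)
  then obtain R where "\<forall>x\<in>{x. \<phi> x \<noteq> 0}. norm x < R" "0 < R"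
    by (auto simp: bounded_pos_less)
  then show ?thesis using that by auto
qed

lemma gradient_eq_0:
  assumes "\<And>x. x \<notin> cball a R \<Longrightarrow> \<phi> x = 0" "x \<notin> cball a R"
  shows "gradient \<phi> x = 0"
  using assms by (intro gradient_eq_0_open[of "- cball a R"]) auto

lemma test_function_L2:
  fixes \<phi> :: "'a::euclidean_space \<Rightarrow> real"
  assumes S: "S \<in> sets lebesgue" and \<phi>: "test_function T \<phi>"
  shows "\<phi> \<in> L2 S" "gradient \<phi> \<in> L2 S"
proof -
  obtain R where R: "0 < R" "\<And>x. \<phi> x \<noteq> 0 \<Longrightarrow> x \<in> ball 0 R"
    using test_function_bounded_support[OF \<phi>] by blast
  have s: "smooth \<phi>" using \<phi> by (rule test_function_smooth)
  have B: "S \<inter> cball 0 R \<in> sets lebesgue" "bounded (S \<inter> cball 0 R)" using S by auto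
  have z: "\<phi> x = 0" if "x \<notin> cball 0 R" for x
    using R(2)[of x] that by (auto simp: dist_norm)
  show "\<phi> \<in> L2 S"
    by (rule L2_extend(1)[OF S B(1) _ L2_continuous_bounded_set[OF B smooth_continuous_on[OF s]]]) (use z in auto)
  show "gradient \<phi> \<in> L2 S"
    by (rule L2_extend(1)[OF S B(1) _ L2_continuous_bounded_set[OF B continuous_on_gradient[OF s]]])
       (use z gradient_eq_0[of 0 R \<phi>] in auto)
qed

section \<open>Mollification\<close>

definition conv :: "('a::euclidean_space \<Rightarrow> real) \<Rightarrow> ('a \<Rightarrow> real) \<Rightarrow> 'a \<Rightarrow> real" where
  "conv k F x = (LINT y|lebesgue. F y * k (x - y))"

lemma continuous_compact_support_bounded:
  fixes k :: "'a::euclidean_space \<Rightarrow> 'b::real_normed_vector"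
  assumes "continuous_on UNIV k" "\<And>z. z \<notin> cball a R \<Longrightarrow> k z = 0"
  obtains C where "0 \<le> C" "\<And>z. norm (k z) \<le> C"
proof -
  have "bounded (k ` cball a R)"
    using assms(1) by (intro compact_imp_bounded compact_continuous_image) (auto intro: continuous_on_subset)
  then obtain C where C: "0 < C" "\<And>z. z \<in> cball a R \<Longrightarrow> norm (k z) \<le> C"
    unfolding bounded_pos by blast
  have "norm (k z) \<le> C" for z
    using C assms(2)[of z] by (cases "z \<in> cball a R") auto
  with C show ?thesis using that less_imp_le by blast
qed

lemma conv_integrable:
  fixes k :: "'a::euclidean_space \<Rightarrow> 'b::euclidean_space"
  assumes F: "integrable lebesgue (F :: 'a \<Rightarrow> real)" and k: "continuous_on UNIV k" "\<And>z. norm (k z) \<le> C"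
  shows "integrable lebesgue (\<lambda>y. F y *\<^sub>R k (x - y))"
proof (rule Bochner_Integration.integrable_bound)
  have C: "0 \<le> C" using k(2)[of 0] norm_ge_zero order_trans by blast
  show "integrable lebesgue (\<lambda>y. C * F y)" using F by simp
  have "continuous_on UNIV (\<lambda>y. k (x - y))"
    by (rule continuous_on_compose2[OF k(1)]) (auto intro: continuous_intros)
  then have "(\<lambda>y. k (x - y)) \<in> borel_measurable lebesgue"
    using borel_measurable_lebesgue_on_continuous[of UNIV] by (simp add: lebesgue_on_UNIV_eq)
  then show "(\<lambda>y. F y *\<^sub>R k (x - y)) \<in> borel_measurable lebesgue"
    using F by (intro borel_measurable_scaleR) auto
  show "AE y in lebesgue. norm (F y *\<^sub>R k (x - y)) \<le> norm (C * F y)"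
    using k(2) C by (intro AE_I2) (auto simp: abs_mult mult.commute[of C] intro!: mult_left_mono)
qed

text \<open>A Taylor formula whose error is uniform in the base point, from the mean value theorem
  along the segment and the uniform continuity of the gradient on a slightly larger ball.\<close>

lemma uniform_gradient:
  fixes k :: "'a::euclidean_space \<Rightarrow> real"
  assumes k: "smooth k" "\<And>z. z \<notin> cball a R \<Longrightarrow> k z = 0" and e: "0 < e"
  obtains d where "0 < d"
    "\<And>z v. norm v < d \<Longrightarrow> \<bar>k (z + v) - k z - v \<bullet> gradient k z\<bar> \<le> e * norm v"
proof -
  have "uniformly_continuous_on (cball a (R + 2)) (gradient k)"
    by (intro compact_uniformly_continuous continuous_on_gradient k compact_cball)
  then obtain d where d: "0 < d" "\<And>x y. x \<in> cball a (R + 2) \<Longrightarrow> y \<in> cball a (R + 2) \<Longrightarrow> dist y x < d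
      \<Longrightarrow> dist (gradient k y) (gradient k x) < e"
    using e unfolding uniformly_continuous_on_def by metis
  show thesis
  proof (rule that[of "min d 1"])
    show "0 < min d 1" using d by simp
    fix z v :: 'a assume v: "norm v < min d 1"
    \<comment> \<open>Since \<open>norm v < 1\<close>, a segment that starts within radius
      \<open>R + 1\<close> stays within radius \<open>R + 2\<close>; if it starts outside radius
      \<open>R + 1\<close>, both of its endpoints are outside the support.\<close>
    show "\<bar>k (z + v) - k z - v \<bullet> gradient k z\<bar> \<le> e * norm v"
    proof (cases "z \<in> cball a (R + 1)")
      case True
      have "((\<lambda>t. k (z + t *\<^sub>R v)) has_real_derivative v \<bullet> gradient k (z + t *\<^sub>R v)) (at t)" for t
      proof -
        have "((\<lambda>t. z + t *\<^sub>R v) has_derivative (\<lambda>h. h *\<^sub>R v)) (at t)"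
          by (auto intro!: derivative_eq_intros)
        from has_derivative_compose[OF this smooth_GDERIV[OF k(1), unfolded gderiv_def]]
        show ?thesis
          unfolding has_field_derivative_def by (simp add: mult_commute_abs mult.commute)
      qed
      then have "\<exists>t. 0 < t \<and> t < 1 \<and> k (z + 1 *\<^sub>R v) - k (z + 0 *\<^sub>R v) = (1 - 0) * (v \<bullet> gradient k (z + t *\<^sub>R v))"
        by (intro MVT2[of 0 1 "\<lambda>t. k (z + t *\<^sub>R v)"]) auto
      then obtain t where t: "0 < t" "t < 1" "k (z + v) - k z = v \<bullet> gradient k (z + t *\<^sub>R v)"
        by auto
      have tv: "norm (t *\<^sub>R v) \<le> norm v"
        using t by (simp add: mult_left_le_one_le)
      have "dist a (z + t *\<^sub>R v) \<le> dist a z + norm (t *\<^sub>R v)"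
        by (metis add.commute dist_norm dist_triangle_le norm_minus_commute add_diff_cancel_left' order_refl dist_commute)
      with True tv v have "z + t *\<^sub>R v \<in> cball a (R + 2)" "z \<in> cball a (R + 2)" by auto
      moreover have "dist (z + t *\<^sub>R v) z < d" using tv v by (simp add: dist_norm)
      ultimately have "norm (gradient k (z + t *\<^sub>R v) - gradient k z) < e"
        using d(2) by (auto simp: dist_norm)
      moreover have "\<bar>v \<bullet> (gradient k (z + t *\<^sub>R v) - gradient k z)\<bar>
          \<le> norm v * norm (gradient k (z + t *\<^sub>R v) - gradient k z)"
        by (rule Cauchy_Schwarz_ineq2)
      ultimately have "\<bar>v \<bullet> (gradient k (z + t *\<^sub>R v) - gradient k z)\<bar> \<le> norm v * e"
        by (meson less_imp_le mult_left_mono norm_ge_zero order_trans)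
      then show ?thesis
        unfolding t(3) by (simp add: inner_diff_right mult.commute)
    next
      case False
      have "dist a z \<le> dist a (z + v) + norm v"
        by (metis add_diff_cancel_left' dist_commute dist_norm dist_triangle)
      with False v have "z \<notin> cball a R" "z + v \<notin> cball a R" by auto
      then show ?thesis
        using k(2) gradient_eq_0[of a R k z] e by simp
    qed
  qed
qed

text \<open>The Taylor remainder of \<open>k\<close> is uniform in the base point, so it can be
  integrated against the absolute value of \<open>F\<close>; the integral of the latter is the only
  constant that appears.\<close>

lemma conv_GDERIV:
  fixes F :: "'a::euclidean_space \<Rightarrow> real"
  assumes F: "integrable lebesgue F" and k: "smooth k" "\<And>z. z \<notin> cball a R \<Longrightarrow> k z = 0"
  shows "GDERIV (conv k F) x :> (LINT y|lebesgue. F y *\<^sub>R gradient k (x - y))"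
proof -
  obtain C1 where C1: "\<And>z. norm (k z) \<le> C1"
    using continuous_compact_support_bounded[OF smooth_continuous_on[OF k(1)] k(2)] by blast
  have gz: "gradient k z = 0" if "z \<notin> cball a R" for z
    using that by (rule gradient_eq_0[of a R k, rotated]) (rule k(2))
  obtain C2 where C2: "\<And>z. norm (gradient k z) \<le> C2"
    using continuous_compact_support_bounded[OF continuous_on_gradient[OF k(1)] gz] by blast
  have i1: "integrable lebesgue (\<lambda>y. F y * k (x - y))" for x
    using conv_integrable[OF F smooth_continuous_on[OF k(1)] C1] by simp
  have i2: "integrable lebesgue (\<lambda>y. F y *\<^sub>R gradient k (x - y))" for x
    using conv_integrable[OF F continuous_on_gradient[OF k(1)] C2] .
  define I where "I = (LINT y|lebesgue. \<bar>F y\<bar>)"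
  have I: "0 \<le> I" by (simp add: I_def integral_nonneg_AE)
  show ?thesis
    unfolding gderiv_def has_derivative_at_alt
  proof (intro conjI allI impI)
    show "bounded_linear (\<lambda>h. h \<bullet> (LINT y|lebesgue. F y *\<^sub>R gradient k (x - y)))"
      by (rule bounded_linear_inner_left)
    fix e :: real assume e: "0 < e"
    define e' where "e' = e / (I + 1)"
    have e': "0 < e'" using e I by (simp add: e'_def)
    obtain d where d: "0 < d"
      "\<And>z v. norm v < d \<Longrightarrow> \<bar>k (z + v) - k z - v \<bullet> gradient k z\<bar> \<le> e' * norm v"
      using uniform_gradient[OF k e'] by blast
    show "\<exists>d>0. \<forall>y. norm (y - x) < d \<longrightarrow> norm (conv k F y - conv k F x
        - (y - x) \<bullet> (LINT y|lebesgue. F y *\<^sub>R gradient k (x - y))) \<le> e * norm (y - x)"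
    proof (intro exI[of _ d] conjI allI impI d(1))
      fix x' assume x': "norm (x' - x) < d"
      define v where "v = x' - x"
      have eq: "conv k F x' - conv k F x - v \<bullet> (LINT y|lebesgue. F y *\<^sub>R gradient k (x - y))
        = (LINT y|lebesgue. F y * (k ((x - y) + v) - k (x - y) - v \<bullet> gradient k (x - y)))"
      proof -
        have "v \<bullet> (LINT y|lebesgue. F y *\<^sub>R gradient k (x - y)) = (LINT y|lebesgue. v \<bullet> (F y *\<^sub>R gradient k (x - y)))"
          using integral_inner_right[of v lebesgue "\<lambda>y. F y *\<^sub>R gradient k (x - y)"] i2 by simp
        moreover have "integrable lebesgue (\<lambda>y. v \<bullet> (F y *\<^sub>R gradient k (x - y)))"
          using i2 by (rule integrable_inner_right)
        moreover have "x' - y = (x - y) + v" for y by (simp add: v_def)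
        ultimately show ?thesis
          unfolding conv_def using i1[of x] i1[of x']
          by (simp add: algebra_simps)
      qed
      have "norm (\<dots>) \<le> (LINT y|lebesgue. (e' * norm v) * \<bar>F y\<bar>)"
      proof (rule Bochner_Integration.integral_norm_bound_integral)
        show "integrable lebesgue (\<lambda>y. F y * (k ((x - y) + v) - k (x - y) - v \<bullet> gradient k (x - y)))"
        proof -
          have "integrable lebesgue (\<lambda>y. F y * k (x' - y) - F y * k (x - y) - v \<bullet> (F y *\<^sub>R gradient k (x - y)))"
            using i1 i2 by (intro Bochner_Integration.integrable_diff integrable_inner_right) auto
          then show ?thesis by (simp add: v_def algebra_simps)
        qed
        show "integrable lebesgue (\<lambda>y. (e' * norm v) * \<bar>F y\<bar>)" using F by auto
        fix y
        have "\<bar>k ((x - y) + v) - k (x - y) - v \<bullet> gradient k (x - y)\<bar> \<le> e' * norm v"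
          using d(2)[of v "x - y"] x' unfolding v_def by blast
        then show "norm (F y * (k ((x - y) + v) - k (x - y) - v \<bullet> gradient k (x - y))) \<le> (e' * norm v) * \<bar>F y\<bar>"
          by (simp add: abs_mult mult.commute mult_left_mono)
      qed
      also have "\<dots> = (e' * I) * norm v" by (simp add: I_def)
      also have "\<dots> \<le> e * norm v"
        using I e by (intro mult_right_mono) (auto simp: e'_def divide_simps)
      finally show "norm (conv k F x' - conv k F x
        - (x' - x) \<bullet> (LINT y|lebesgue. F y *\<^sub>R gradient k (x - y))) \<le> e * norm (x' - x)"
        using eq by (simp add: v_def)
    qed
  qed
qed

text \<open>The induction runs over all kernels at once: a partial derivative of the convolution is
  the convolution with the partial derivative of the kernel, and that is supported in the same
  ball.\<close>

lemma Ck_conv: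
  fixes F :: "'a::euclidean_space \<Rightarrow> real"
  assumes F: "integrable lebesgue F"
  shows "smooth k \<Longrightarrow> (\<And>z. z \<notin> cball a R \<Longrightarrow> k z = 0) \<Longrightarrow> Ck n (conv k F)"
proof (induction n arbitrary: k)
  case 0
  have "isCont (conv k F) x" for x
    using conv_GDERIV[OF F 0] unfolding gderiv_def by (rule has_derivative_continuous)
  then show ?case by (simp add: continuous_at_imp_continuous_on)
next
  case (Suc n)
  note k = Suc.prems
  have gz: "gradient k z = 0" if "z \<notin> cball a R" for z
    using that by (rule gradient_eq_0[of a R k, rotated]) (rule k(2))
  obtain C2 where C2: "\<And>z. norm (gradient k z) \<le> C2"
    using continuous_compact_support_bounded[OF continuous_on_gradient[OF k(1)] gz] by blast
  have i2: "integrable lebesgue (\<lambda>y. F y *\<^sub>R gradient k (x - y))" for x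
    using conv_integrable[OF F continuous_on_gradient[OF k(1)] C2] .
  show ?case
  proof (rule Ck_SucI[OF conv_GDERIV[OF F k, unfolded gderiv_def]])
    fix b :: 'a assume b: "b \<in> Basis"
    have "(b \<bullet> (LINT y|lebesgue. F y *\<^sub>R gradient k (x - y))) = conv (\<lambda>z. gradient k z \<bullet> b) F x" for x
    proof -
      have "(b \<bullet> (LINT y|lebesgue. F y *\<^sub>R gradient k (x - y))) = (LINT y|lebesgue. b \<bullet> (F y *\<^sub>R gradient k (x - y)))"
        using integral_inner_right[of b lebesgue "\<lambda>y. F y *\<^sub>R gradient k (x - y)"] i2 by simp
      then show ?thesis by (simp add: conv_def inner_commute)
    qed
    moreover have "Ck n (conv (\<lambda>z. gradient k z \<bullet> b) F)"
    proof (rule Suc.IH)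
      show "smooth (\<lambda>z. gradient k z \<bullet> b)" using k(1) b by (rule smooth_gradient_inner)
      fix z assume "z \<notin> cball a R"
      from gz[OF this] show "gradient k z \<bullet> b = 0" by simp
    qed
    ultimately show "Ck n (\<lambda>x. b \<bullet> (LINT y|lebesgue. F y *\<^sub>R gradient k (x - y)))" by simp
  qed
qed

lemma smooth_conv:
  fixes F :: "'a::euclidean_space \<Rightarrow> real"
  assumes "integrable lebesgue F" "smooth k" "\<And>z. z \<notin> cball a R \<Longrightarrow> k z = 0"
  shows "smooth (conv k F)"
  unfolding smooth_def using Ck_conv[OF assms] by blast

lemma gradient_conv:
  fixes F :: "'a::euclidean_space \<Rightarrow> real"
  assumes "integrable lebesgue F" "smooth k" "\<And>z. z \<notin> cball a R \<Longrightarrow> k z = 0"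
  shows "gradient (conv k F) x = (LINT y|lebesgue. F y *\<^sub>R gradient k (x - y))"
  by (rule gradient_eqI[OF conv_GDERIV[OF assms]])

text \<open>The support set is a parameter because near the boundary the kernels live in small balls
  that avoid the origin, so that the convolution samples only points of the domain.\<close>

definition mollifier :: "'a::euclidean_space set \<Rightarrow> ('a \<Rightarrow> real) \<Rightarrow> bool" where
  "mollifier A k \<longleftrightarrow> smooth k \<and> (\<forall>z. 0 \<le> k z) \<and> (\<forall>z. z \<notin> A \<longrightarrow> k z = 0) \<and> integral\<^sup>L lebesgue k = 1"

lemma mollifier_mono: "mollifier A k \<Longrightarrow> A \<subseteq> B \<Longrightarrow> mollifier B k"
  unfolding mollifier_def by blast

lemma mollifier_exists:
  fixes a :: "'a::euclidean_space"
  assumes r: "0 < r"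
  obtains k where "mollifier (cball a r) k"
proof -
  obtain \<psi> :: "'a \<Rightarrow> real" where \<psi>: "smooth \<psi>" "\<And>x. 0 \<le> \<psi> x" "\<And>x. \<psi> x \<le> 1"
    "\<And>x. dist a x \<le> r / 2 \<Longrightarrow> \<psi> x = 1" "\<And>x. r \<le> dist a x \<Longrightarrow> \<psi> x = 0"
    using bump_exists[of "r / 2" r a] r by auto
  have \<psi>m: "\<psi> \<in> borel_measurable lebesgue"
    using borel_measurable_lebesgue_on_continuous[of UNIV \<psi>] smooth_continuous_on[OF \<psi>(1)]
    by (simp add: lebesgue_on_UNIV_eq)
  have ci: "integrable lebesgue (indicator (cball a s) :: 'a \<Rightarrow> real)" for s
    using lmeasurable_cball by (simp add: lmeasurable_iff_integrable[symmetric])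
  have \<psi>i: "integrable lebesgue \<psi>"
    by (rule Bochner_Integration.integrable_bound[OF ci[of r] \<psi>m])
       (use \<psi> in \<open>auto simp: indicator_def intro!: AE_I2\<close>)
  define J where "J = integral\<^sup>L lebesgue \<psi>"
  have "measure lebesgue (cball a (r / 2)) = integral\<^sup>L lebesgue (indicator (cball a (r / 2)) :: 'a \<Rightarrow> real)"
    by simp
  also have "\<dots> \<le> J"
    unfolding J_def using \<psi> by (intro integral_mono ci \<psi>i) (auto simp: indicator_def)
  finally have "measure lebesgue (cball a (r / 2)) \<le> J" .
  moreover have "0 < measure lebesgue (cball a (r / 2))"
    using content_cball_pos[of "r / 2" a] r by simp
  ultimately have J: "0 < J" by linarith
  have "mollifier (cball a r) (\<lambda>z. (1 / J) * \<psi> z)"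
    unfolding mollifier_def
  proof (intro conjI allI impI)
    show "smooth (\<lambda>z. (1 / J) * \<psi> z)" by (rule smooth_cmult[OF \<psi>(1)])
    show "integral\<^sup>L lebesgue (\<lambda>z. (1 / J) * \<psi> z) = 1"
      using J by (subst integral_mult_right_zero) (simp add: J_def)
  qed (use J \<psi> in auto)
  then show ?thesis by (rule that)
qed

section \<open>Contractivity of mollification in \<open>L2\<close>\<close>

lemma L2_UNIV_nn_integral:
  fixes f :: "'a::euclidean_space \<Rightarrow> real"
  assumes f: "f \<in> borel_measurable lebesgue" and le: "(\<integral>\<^sup>+x. ennreal ((f x)\<^sup>2) \<partial>lborel) \<le> ennreal (C\<^sup>2)" and C: "0 \<le> C"
  shows "f \<in> L2 UNIV" "norm_L2 UNIV f \<le> C"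
proof -
  have le': "(\<integral>\<^sup>+x. ennreal ((f x)\<^sup>2) \<partial>lebesgue) \<le> ennreal (C\<^sup>2)"
    using le by (simp add: nn_integral_completion)
  have i: "integrable lebesgue (\<lambda>x. (f x)\<^sup>2)"
    using f le' by (intro integrableI_bounded) (auto simp: le_less_trans)
  then show "f \<in> L2 UNIV" using f by (simp add: L2_iff lebesgue_on_UNIV_eq)
  have "ennreal (integral\<^sup>L lebesgue (\<lambda>x. (f x)\<^sup>2)) \<le> ennreal (C\<^sup>2)"
    using nn_integral_eq_integral[OF i] le' by simp
  then have "integral\<^sup>L lebesgue (\<lambda>x. (f x)\<^sup>2) \<le> C\<^sup>2"
    using C by (simp add: ennreal_le_iff)
  then show "norm_L2 UNIV f \<le> C"
    using C real_sqrt_le_mono[of "integral\<^sup>L lebesgue (\<lambda>x. (f x)\<^sup>2)" "C\<^sup>2"]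
    by (simp add: norm_L2_eq lebesgue_on_UNIV_eq)
qed

lemma L2_UNIV_nn_integral_eq:
  fixes f :: "'a::euclidean_space \<Rightarrow> real"
  assumes "f \<in> L2 UNIV"
  shows "(\<integral>\<^sup>+x. ennreal ((f x)\<^sup>2) \<partial>lborel) = ennreal ((norm_L2 UNIV f)\<^sup>2)"
proof -
  have i: "integrable lebesgue (\<lambda>x. (f x)\<^sup>2)"
    using assms by (simp add: L2_iff lebesgue_on_UNIV_eq)
  have "(\<integral>\<^sup>+x. ennreal ((f x)\<^sup>2) \<partial>lborel) = (\<integral>\<^sup>+x. ennreal ((f x)\<^sup>2) \<partial>lebesgue)"
    by (simp add: nn_integral_completion)
  also have "\<dots> = ennreal ((norm_L2 UNIV f)\<^sup>2)"
    by (simp add: nn_integral_eq_integral[OF i] norm_L2_sq lebesgue_on_UNIV_eq)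
  finally show ?thesis .
qed

lemma distr_lborel_diff: "distr lborel borel (\<lambda>y::'a::euclidean_space. x - y) = lborel"
  using lborel_affine[of "-1" x] by (simp add: density_1)

lemma nn_integral_lborel_diff:
  fixes f :: "'a::euclidean_space \<Rightarrow> ennreal"
  assumes [measurable]: "f \<in> borel_measurable borel"
  shows "(\<integral>\<^sup>+y. f (x - y) \<partial>lborel) = (\<integral>\<^sup>+y. f y \<partial>lborel)"
proof -
  have "(\<integral>\<^sup>+y. f y \<partial>lborel) = (\<integral>\<^sup>+y. f y \<partial>distr lborel borel (\<lambda>y. x - y))"
    by (simp add: distr_lborel_diff)
  also have "\<dots> = (\<integral>\<^sup>+y. f (x - y) \<partial>lborel)"
    by (subst nn_integral_distr) auto
  finally show ?thesis by simp
qed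

lemma nn_integral_lborel_diff':
  fixes f :: "'a::euclidean_space \<Rightarrow> ennreal"
  assumes [measurable]: "f \<in> borel_measurable borel"
  shows "(\<integral>\<^sup>+x. f (x - y) \<partial>lborel) = (\<integral>\<^sup>+x. f x \<partial>lborel)"
proof -
  have "(\<integral>\<^sup>+x. f x \<partial>lborel) = (\<integral>\<^sup>+x. f x \<partial>distr lborel borel ((+) (- y)))"
    by (simp add: lborel_distr_plus)
  also have "\<dots> = (\<integral>\<^sup>+x. f (x - y) \<partial>lborel)"
    by (subst nn_integral_distr) auto
  finally show ?thesis by simp
qed

lemma mollifier_nn_integral:
  assumes "mollifier A k"
  shows "(\<integral>\<^sup>+z. ennreal (k z) \<partial>lborel) = 1"
proof -
  have i: "integrable lebesgue k"
    using assms not_integrable_integral_eq unfolding mollifier_def by fastforce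
  have "(\<integral>\<^sup>+z. ennreal (k z) \<partial>lebesgue) = ennreal (integral\<^sup>L lebesgue k)"
    using assms by (intro nn_integral_eq_integral i) (auto simp: mollifier_def)
  then show ?thesis
    using assms by (simp add: nn_integral_completion mollifier_def)
qed

text \<open>The inner square is bounded by Cauchy-Schwarz for the probability density
  \<open>k (x - y)\<close> in \<open>y\<close>, after splitting \<open>|F| k\<close> into
  \<open>sqrt k\<close> and \<open>sqrt k |F|\<close>. Tonelli then lets the integral in
  \<open>x\<close> fall on the kernel alone. Working with nonnegative integrals keeps integrability
  questions out.\<close>

lemma nn_Young_L2:
  fixes F k :: "'a::euclidean_space \<Rightarrow> real"
  assumes [measurable]: "F \<in> borel_measurable borel" "k \<in> borel_measurable borel"
    and k: "\<And>z. 0 \<le> k z" "(\<integral>\<^sup>+z. ennreal (k z) \<partial>lborel) = 1"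
  shows "(\<integral>\<^sup>+x. (\<integral>\<^sup>+y. ennreal (\<bar>F y\<bar> * k (x - y)) \<partial>lborel)\<^sup>2 \<partial>lborel) \<le> (\<integral>\<^sup>+y. ennreal ((F y)\<^sup>2) \<partial>lborel)"
proof -
  have "(\<integral>\<^sup>+y. ennreal (\<bar>F y\<bar> * k (x - y)) \<partial>lborel)\<^sup>2 \<le> (\<integral>\<^sup>+y. ennreal (k (x - y)) * ennreal ((F y)\<^sup>2) \<partial>lborel)" for x
  proof -
    have "(\<integral>\<^sup>+y. ennreal (\<bar>F y\<bar> * k (x - y)) \<partial>lborel)
        = (\<integral>\<^sup>+y. ennreal (sqrt (k (x - y))) * ennreal (sqrt (k (x - y)) * \<bar>F y\<bar>) \<partial>lborel)"
    proof (rule nn_integral_cong)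
      fix y
      have "sqrt (k (x - y)) * (sqrt (k (x - y)) * \<bar>F y\<bar>) = \<bar>F y\<bar> * k (x - y)"
        unfolding mult.assoc[symmetric] using k(1)[of "x - y"] by simp
      then show "ennreal (\<bar>F y\<bar> * k (x - y)) = ennreal (sqrt (k (x - y))) * ennreal (sqrt (k (x - y)) * \<bar>F y\<bar>)"
        using k(1)[of "x - y"] by (subst ennreal_mult[symmetric]) auto
    qed
    then have "(\<integral>\<^sup>+y. ennreal (\<bar>F y\<bar> * k (x - y)) \<partial>lborel)\<^sup>2
        \<le> (\<integral>\<^sup>+y. (ennreal (sqrt (k (x - y))))\<^sup>2 \<partial>lborel) * (\<integral>\<^sup>+y. (ennreal (sqrt (k (x - y)) * \<bar>F y\<bar>))\<^sup>2 \<partial>lborel)"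
      using Cauchy_Schwarz_nn_integral[of "\<lambda>y. ennreal (sqrt (k (x - y)))" lborel "\<lambda>y. ennreal (sqrt (k (x - y)) * \<bar>F y\<bar>)"]
      by simp
    also have "(\<integral>\<^sup>+y. (ennreal (sqrt (k (x - y))))\<^sup>2 \<partial>lborel) = (\<integral>\<^sup>+y. ennreal (k (x - y)) \<partial>lborel)"
      using k(1) by (intro nn_integral_cong) (simp add: ennreal_power)
    also have "\<dots> = 1"
      using nn_integral_lborel_diff[of "\<lambda>z. ennreal (k z)" x] k(2) by simp
    also have "(\<integral>\<^sup>+y. (ennreal (sqrt (k (x - y)) * \<bar>F y\<bar>))\<^sup>2 \<partial>lborel) = (\<integral>\<^sup>+y. ennreal (k (x - y)) * ennreal ((F y)\<^sup>2) \<partial>lborel)"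
    proof (rule nn_integral_cong)
      fix y
      have "(sqrt (k (x - y)) * \<bar>F y\<bar>)\<^sup>2 = k (x - y) * (F y)\<^sup>2"
        using k(1)[of "x - y"] by (simp add: power_mult_distrib)
      then show "(ennreal (sqrt (k (x - y)) * \<bar>F y\<bar>))\<^sup>2 = ennreal (k (x - y)) * ennreal ((F y)\<^sup>2)"
        using k(1)[of "x - y"] by (subst ennreal_power) (auto simp: ennreal_mult)
    qed
    finally show ?thesis by simp
  qed
  then have "(\<integral>\<^sup>+x. (\<integral>\<^sup>+y. ennreal (\<bar>F y\<bar> * k (x - y)) \<partial>lborel)\<^sup>2 \<partial>lborel)
      \<le> (\<integral>\<^sup>+x. (\<integral>\<^sup>+y. ennreal (k (x - y)) * ennreal ((F y)\<^sup>2) \<partial>lborel) \<partial>lborel)"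
    by (intro nn_integral_mono)
  also have "\<dots> = (\<integral>\<^sup>+y. (\<integral>\<^sup>+x. ennreal (k (x - y)) * ennreal ((F y)\<^sup>2) \<partial>lborel) \<partial>lborel)"
    by (rule lborel_pair.Fubini') measurable
  also have "\<dots> = (\<integral>\<^sup>+y. (\<integral>\<^sup>+x. ennreal (k (x - y)) \<partial>lborel) * ennreal ((F y)\<^sup>2) \<partial>lborel)"
    by (intro nn_integral_cong nn_integral_multc) measurable
  also have "\<dots> = (\<integral>\<^sup>+y. ennreal ((F y)\<^sup>2) \<partial>lborel)"
    using nn_integral_lborel_diff'[of "\<lambda>z. ennreal (k z)"] k(2) by simp
  finally show ?thesis .
qed

lemma conv_L2:
  fixes F :: "'a::euclidean_space \<Rightarrow> real"
  assumes F: "integrable lebesgue F" "F \<in> L2 UNIV" and k: "mollifier (cball a R) k"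
  shows "conv k F \<in> L2 UNIV" "norm_L2 UNIV (conv k F) \<le> norm_L2 UNIV F"
proof -
  have ks: "smooth k" "\<And>z. 0 \<le> k z" "\<And>z. z \<notin> cball a R \<Longrightarrow> k z = 0" using k by (auto simp: mollifier_def)
  have km[measurable]: "k \<in> borel_measurable borel"
    by (intro borel_measurable_continuous_onI smooth_continuous_on ks(1))
  \<comment> \<open>Tonelli is applied to the product of two copies of \<open>lborel\<close>, so
    \<open>F\<close> is replaced by a Borel function that agrees with it almost everywhere.\<close>
  obtain G where G[measurable]: "G \<in> borel_measurable lborel" and FG: "AE x in lborel. F x = G x"
    using completion_ex_borel_measurable_real[of F lborel] F(1) by auto
  have sm: "smooth (conv k F)" by (rule smooth_conv[OF F(1) ks(1) ks(3)])
  obtain C where C: "\<And>z. norm (k z) \<le> C"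
    using continuous_compact_support_bounded[OF smooth_continuous_on[OF ks(1)] ks(3)] by blast
  have i: "integrable lebesgue (\<lambda>y. F y * k (x - y))" for x
    using conv_integrable[OF F(1) smooth_continuous_on[OF ks(1)] C] by simp
  have "ennreal ((conv k F x)\<^sup>2) \<le> (\<integral>\<^sup>+y. ennreal (\<bar>G y\<bar> * k (x - y)) \<partial>lborel)\<^sup>2" for x
  proof -
    have "ennreal \<bar>conv k F x\<bar> \<le> (\<integral>\<^sup>+y. ennreal (norm (F y * k (x - y))) \<partial>lebesgue)"
      unfolding conv_def real_norm_def[symmetric] by (rule integral_norm_bound_ennreal[OF i])
    also have "\<dots> = (\<integral>\<^sup>+y. ennreal (norm (F y * k (x - y))) \<partial>lborel)"
      by (simp add: nn_integral_completion)
    also have "\<dots> = (\<integral>\<^sup>+y. ennreal (\<bar>G y\<bar> * k (x - y)) \<partial>lborel)"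
      using FG ks(2) by (intro nn_integral_cong_AE) (auto simp: abs_mult)
    finally have "(ennreal \<bar>conv k F x\<bar>)\<^sup>2 \<le> (\<integral>\<^sup>+y. ennreal (\<bar>G y\<bar> * k (x - y)) \<partial>lborel)\<^sup>2"
      by (rule power_mono) simp
    then show ?thesis by (simp add: ennreal_power)
  qed
  then have "(\<integral>\<^sup>+x. ennreal ((conv k F x)\<^sup>2) \<partial>lborel) \<le> (\<integral>\<^sup>+x. (\<integral>\<^sup>+y. ennreal (\<bar>G y\<bar> * k (x - y)) \<partial>lborel)\<^sup>2 \<partial>lborel)"
    by (intro nn_integral_mono)
  also have "\<dots> \<le> (\<integral>\<^sup>+y. ennreal ((G y)\<^sup>2) \<partial>lborel)"
    using G by (intro nn_Young_L2 km ks mollifier_nn_integral[OF k]) auto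
  also have "\<dots> = (\<integral>\<^sup>+y. ennreal ((F y)\<^sup>2) \<partial>lborel)"
    using FG by (intro nn_integral_cong_AE) auto
  also have "\<dots> = ennreal ((norm_L2 UNIV F)\<^sup>2)"
    by (rule L2_UNIV_nn_integral_eq[OF F(2)])
  finally have le: "(\<integral>\<^sup>+x. ennreal ((conv k F x)\<^sup>2) \<partial>lborel) \<le> ennreal ((norm_L2 UNIV F)\<^sup>2)" .
  have m: "conv k F \<in> borel_measurable lebesgue"
    using borel_measurable_lebesgue_on_continuous[of UNIV "conv k F"] smooth_continuous_on[OF sm]
    by (simp add: lebesgue_on_UNIV_eq)
  show "conv k F \<in> L2 UNIV" "norm_L2 UNIV (conv k F) \<le> norm_L2 UNIV F"
    using L2_UNIV_nn_integral[OF m le] by auto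
qed

section \<open>Approximation by continuous functions and by mollification\<close>

lemma norm_L2_tendsto_0:
  fixes f :: "nat \<Rightarrow> 'a::euclidean_space \<Rightarrow> 'b::euclidean_space" and g :: "'a \<Rightarrow> 'c::euclidean_space"
  assumes S: "S \<in> sets lebesgue" and g: "g \<in> L2 S"
    and f: "\<And>n. f n \<in> borel_measurable (lebesgue_on S)"
    and le: "\<And>n. AE x in lebesgue_on S. norm (f n x) \<le> norm (g x)"
    and lim: "AE x in lebesgue_on S. (\<lambda>n. f n x) \<longlonglongrightarrow> 0"
  shows "(\<lambda>n. norm_L2 S (f n)) \<longlonglongrightarrow> 0"
proof -
  have "(\<lambda>n. LINT x|lebesgue_on S. (norm (f n x))\<^sup>2) \<longlonglongrightarrow> (LINT x|lebesgue_on S. 0)"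
  proof (rule integral_dominated_convergence)
    show "integrable (lebesgue_on S) (\<lambda>x. (norm (g x))\<^sup>2)" by (rule L2_integrable_sq[OF S g])
    show "(\<lambda>x. (norm (f n x))\<^sup>2) \<in> borel_measurable (lebesgue_on S)" for n using f by simp
    show "AE x in lebesgue_on S. norm ((norm (f n x))\<^sup>2) \<le> (norm (g x))\<^sup>2" for n
      using le[of n] by eventually_elim (simp add: power_mono)
    show "AE x in lebesgue_on S. (\<lambda>n. (norm (f n x))\<^sup>2) \<longlonglongrightarrow> 0"
      using lim
    proof eventually_elim
      case (elim x)
      then have "(\<lambda>n. (norm (f n x))\<^sup>2) \<longlonglongrightarrow> (norm (0::'b))\<^sup>2"
        by (intro tendsto_intros)
      then show ?case by simp
    qed
  qed auto
  then have "(\<lambda>n. LINT x|lebesgue_on S. (norm (f n x))\<^sup>2) \<longlonglongrightarrow> 0" by simp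
  then have "(\<lambda>n. sqrt (LINT x|lebesgue_on S. (norm (f n x))\<^sup>2)) \<longlonglongrightarrow> sqrt 0"
    by (intro tendsto_intros)
  then show ?thesis by (simp add: norm_L2_eq[OF S])
qed

lemma L2_UNIV_indicator:
  fixes f :: "'a::euclidean_space \<Rightarrow> real"
  assumes "A \<in> sets lebesgue" "f \<in> L2 A"
  shows "(\<lambda>y. indicator A y * f y) \<in> L2 UNIV"
proof -
  have "(norm (indicator A x * f x))\<^sup>2 = indicator A x * (norm (f x))\<^sup>2" for x
    by (simp add: indicator_def)
  then show ?thesis
    using assms(2) by (simp add: L2_def set_borel_measurable_def set_integrable_def)
qed

lemma L2_bounded_support_integrable:
  fixes F :: "'a::euclidean_space \<Rightarrow> real"
  assumes F: "F \<in> L2 UNIV" and 0: "\<And>x. x \<notin> cball a R \<Longrightarrow> F x = 0"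
  shows "integrable lebesgue F"
proof -
  have "(\<lambda>x. 1::real) \<in> L2 (cball a R)"
    by (rule L2_bounded(1)[of _ _ 1]) auto
  then have "(\<lambda>x. indicator (cball a R) x * (1::real)) \<in> L2 UNIV"
    by (intro L2_UNIV_indicator) auto
  then have "integrable lebesgue (\<lambda>x. F x * (indicator (cball a R) x * 1))"
    using L2_mult(1)[OF _ F] by (simp add: lebesgue_on_UNIV_eq)
  moreover have "(\<lambda>x. F x * (indicator (cball a R) x * 1)) = F"
    using 0 by (intro ext) (auto simp: indicator_def)
  ultimately show ?thesis by simp
qed

lemma L2_approx_bounded:
  fixes F :: "'a::euclidean_space \<Rightarrow> real"
  assumes F: "F \<in> L2 UNIV" and e: "0 < e"
  obtains M where "0 \<le> M" "norm_L2 UNIV (\<lambda>x. F x - max (- M) (min M (F x))) < e"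
proof -
  have m: "F \<in> borel_measurable lebesgue" using L2_measurable[OF _ F] by (simp add: lebesgue_on_UNIV_eq)
  have "(\<lambda>n. norm_L2 UNIV (\<lambda>x. F x - max (- real n) (min (real n) (F x)))) \<longlonglongrightarrow> 0"
  proof (rule norm_L2_tendsto_0[OF _ F])
    show "AE x in lebesgue_on UNIV. (\<lambda>n. F x - max (- real n) (min (real n) (F x))) \<longlonglongrightarrow> 0"
    proof (rule AE_I2)
      fix x
      obtain N where N: "\<bar>F x\<bar> \<le> real N" using real_arch_simple by blast
      have "\<forall>\<^sub>F n in sequentially. F x - max (- real n) (min (real n) (F x)) = 0"
        using eventually_ge_at_top[of N] by eventually_elim (use N in auto)
      then show "(\<lambda>n. F x - max (- real n) (min (real n) (F x))) \<longlonglongrightarrow> 0"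
        by (rule tendsto_eventually)
    qed
  qed (use m in \<open>auto simp: lebesgue_on_UNIV_eq intro!: AE_I2\<close>)
  then have "\<forall>\<^sub>F n in sequentially. norm_L2 UNIV (\<lambda>x. F x - max (- real n) (min (real n) (F x))) < e"
    using e by (auto dest: order_tendstoD)
  then obtain n where "norm_L2 UNIV (\<lambda>x. F x - max (- real n) (min (real n) (F x))) < e"
    by (auto dest: eventually_happens)
  then show ?thesis by (intro that[of "real n"]) auto
qed

text \<open>A Lebesgue measurable function is almost everywhere a limit of continuous functions.
  Truncating \<open>F\<close> and these functions at the same height \<open>M\<close>, and damping
  the latter by a cutoff, provides a common dominating function, so that convergence holds in
  \<open>L2\<close>. The cutoff enlarges the radius of the support by 1.\<close>

lemma L2_approx_continuous:
  fixes F :: "'a::euclidean_space \<Rightarrow> real"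
  assumes F: "F \<in> L2 UNIV" "\<And>x. x \<notin> cball 0 R \<Longrightarrow> F x = 0" and R: "0 < R" and e: "0 < e"
  obtains G where "continuous_on UNIV G" "\<And>x. x \<notin> cball 0 (R + 1) \<Longrightarrow> G x = 0" "G \<in> L2 UNIV"
    "norm_L2 UNIV (\<lambda>x. F x - G x) < e"
proof -
  have U: "(UNIV::'a set) \<in> sets lebesgue" by simp
  obtain M where M: "0 \<le> M" "norm_L2 UNIV (\<lambda>x. F x - max (- M) (min M (F x))) < e / 2"
    using L2_approx_bounded[OF F(1), of "e / 2"] e by auto
  define H where "H x = max (- M) (min M (F x))" for x
  have m: "F \<in> borel_measurable (lebesgue_on UNIV)" using L2_measurable[OF _ F(1)] by simp
  then have Hm: "H \<in> borel_measurable (lebesgue_on UNIV)"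
    unfolding H_def by measurable
  have H2: "H \<in> L2 UNIV"
    using M(1) by (intro L2_mono(1)[OF U F(1) Hm]) (auto simp: H_def intro!: AE_I2)
  have H0: "H x = 0" if "x \<notin> cball 0 R" for x using F(2)[OF that] M(1) by (simp add: H_def)
  obtain N g where N: "negligible N" and g: "\<And>n. continuous_on UNIV (g n)"
    and lim: "\<And>x. x \<notin> N \<Longrightarrow> (\<lambda>n::nat. g n x) \<longlonglongrightarrow> H x"
    using measurable_on_iff_borel_measurable[OF U, of H] Hm unfolding measurable_on_def by auto
  obtain \<psi> :: "'a \<Rightarrow> real" where \<psi>: "smooth \<psi>" "\<And>x. 0 \<le> \<psi> x" "\<And>x. \<psi> x \<le> 1"
    "\<And>x. dist 0 x \<le> R \<Longrightarrow> \<psi> x = 1" "\<And>x. R + 1 \<le> dist 0 x \<Longrightarrow> \<psi> x = 0"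
    using bump_exists[of R "R + 1" 0] R by auto
  define G where "G n x = \<psi> x * max (- M) (min M (g n x))" for n x
  have Gc: "continuous_on UNIV (G n)" for n
    unfolding G_def by (intro continuous_intros smooth_continuous_on \<psi> g)
  have G0: "G n x = 0" if "x \<notin> cball 0 (R + 1)" for n x
    using \<psi>(5)[of x] that by (simp add: G_def)
  have GL: "G n \<in> L2 UNIV" for n
    by (rule L2_extend(1)[OF U _ _ L2_continuous_bounded_set[OF _ _ Gc, of "cball 0 (R + 1)"]]) (use G0 in auto)
  have cb: "\<bar>max (- M) (min M t)\<bar> \<le> M" for t using M(1) by auto
  have "(\<lambda>n. norm_L2 UNIV (\<lambda>x. H x - G n x)) \<longlonglongrightarrow> 0"
  proof (rule norm_L2_tendsto_0[OF U])
    show "(\<lambda>x. indicator (cball 0 (R + 1)) x * (2 * M)) \<in> L2 UNIV"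
      using M(1) by (intro L2_UNIV_indicator L2_bounded(1)[of _ _ "2 * M"]) auto
    show "(\<lambda>x. H x - G n x) \<in> borel_measurable (lebesgue_on UNIV)" for n
      using Hm borel_measurable_lebesgue_on_continuous[OF U Gc] by (intro borel_measurable_diff)
    show "AE x in lebesgue_on UNIV. norm (H x - G n x) \<le> norm (indicator (cball 0 (R + 1)) x * (2 * M))" for n
    proof (rule AE_I2)
      fix x :: 'a
      have h: "\<bar>H x\<bar> \<le> M" unfolding H_def by (rule cb)
      have "\<bar>G n x\<bar> \<le> 1 * M"
        unfolding G_def abs_mult using \<psi>(2,3)[of x] cb[of "g n x"] by (intro mult_mono) auto
      with h show "norm (H x - G n x) \<le> norm (indicator (cball 0 (R + 1)) x * (2 * M))"
        using H0[of x] G0[of x n] M(1) by (auto simp: indicator_def)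
    qed
    have "AE x in lebesgue. x \<notin> N" using N by (simp add: AE_not_in negligible_iff_null_sets)
    then have "AE x in lebesgue. (\<lambda>n. H x - G n x) \<longlonglongrightarrow> 0"
    proof eventually_elim
      case (elim x)
      have "(\<lambda>n. G n x) \<longlonglongrightarrow> \<psi> x * max (- M) (min M (H x))"
        unfolding G_def by (intro tendsto_intros lim elim)
      moreover have "\<psi> x * max (- M) (min M (H x)) = H x"
        using \<psi>(4)[of x] H0[of x] M(1) by (cases "x \<in> cball 0 R") (auto simp: H_def)
      ultimately have "(\<lambda>n. H x - G n x) \<longlonglongrightarrow> H x - H x" by (intro tendsto_intros) simp
      then show ?case by simp
    qed
    then show "AE x in lebesgue_on UNIV. (\<lambda>n. H x - G n x) \<longlonglongrightarrow> 0" unfolding lebesgue_on_UNIV_eq .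
  qed
  then have "\<forall>\<^sub>F n in sequentially. norm_L2 UNIV (\<lambda>x. H x - G n x) < e / 2"
    by (rule order_tendstoD(2)) (use e in simp)
  then obtain n where n: "norm_L2 UNIV (\<lambda>x. H x - G n x) < e / 2"
    by (auto dest: eventually_happens)
  have "norm_L2 UNIV (\<lambda>x. F x - G n x) < e"
    using norm_L2_triangle[OF U F(1) H2 GL[of n]] n M(2) by (simp add: H_def)
  with Gc G0 GL show ?thesis by (intro that[of "G n"]) auto
qed

lemma mollifier_integral_diff:
  fixes k :: "'a::euclidean_space \<Rightarrow> real"
  assumes "mollifier A k"
  shows "(LINT y|lebesgue. k (x - y)) = 1"
proof -
  have k: "continuous_on UNIV k" "\<And>z. 0 \<le> k z" using assms by (auto simp: mollifier_def smooth_continuous_on)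
  have km[measurable]: "k \<in> borel_measurable borel"
    by (intro borel_measurable_continuous_onI k)
  have "(LINT y|lebesgue. k (x - y)) = (LINT y|lborel. k (x - y))"
    by (rule integral_completion) simp
  also have "\<dots> = enn2real (\<integral>\<^sup>+y. ennreal (k (x - y)) \<partial>lborel)"
    using k by (intro integral_eq_nn_integral) auto
  also have "(\<integral>\<^sup>+y. ennreal (k (x - y)) \<partial>lborel) = 1"
    using nn_integral_lborel_diff[of "\<lambda>z. ennreal (k z)" x] mollifier_nn_integral[OF assms] by simp
  finally show ?thesis by simp
qed

text \<open>Uniform continuity makes the difference small pointwise, and it vanishes outside a fixed
  ball. One radius \<rho> serves all mollifiers supported in \<open>cball 0 \<rho>\<close>, centred
  or not; the approximation up to the boundary relies on this uniformity.\<close>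

lemma mollify_continuous:
  fixes G :: "'a::euclidean_space \<Rightarrow> real"
  assumes G: "continuous_on UNIV G" "\<And>x. x \<notin> cball 0 R \<Longrightarrow> G x = 0" and e: "0 < e"
  obtains \<rho> where "0 < \<rho>" "\<And>k. mollifier (cball 0 \<rho>) k \<Longrightarrow> norm_L2 UNIV (\<lambda>x. conv k G x - G x) \<le> e"
proof -
  define m where "m = sqrt (measure lebesgue (cball (0::'a) (R + 1)))"
  define e' where "e' = e / (m + 1)"
  have m: "0 \<le> m" by (simp add: m_def)
  have e': "0 < e'" "e' * m \<le> e" using e m by (auto simp: e'_def field_simps)
  have GL: "G \<in> L2 UNIV"
    by (rule L2_extend(1)[OF _ _ _ L2_continuous_bounded_set[OF _ _ G(1), of "cball 0 R"]]) (use G(2) in auto)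
  have Gi: "integrable lebesgue G" by (rule L2_bounded_support_integrable[OF GL G(2)])
  have "uniformly_continuous_on (cball 0 (R + 2)) G"
    using G(1) by (intro compact_uniformly_continuous) (auto intro: continuous_on_subset)
  then obtain d where d: "0 < d" "\<And>x y. x \<in> cball 0 (R + 2) \<Longrightarrow> y \<in> cball 0 (R + 2) \<Longrightarrow> dist y x < d
      \<Longrightarrow> dist (G y) (G x) < e'"
    using e' unfolding uniformly_continuous_on_def by metis
  define \<rho> where "\<rho> = min 1 (d / 2)"
  have \<rho>: "0 < \<rho>" "\<rho> \<le> 1" "\<rho> < d" using d(1) by (auto simp: \<rho>_def)
  show ?thesis
  proof (rule that[OF \<rho>(1)])
    fix k :: "'a \<Rightarrow> real" assume k: "mollifier (cball 0 \<rho>) k"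
    then have ks: "smooth k" "\<And>z. 0 \<le> k z" "\<And>z. z \<notin> cball 0 \<rho> \<Longrightarrow> k z = 0" by (auto simp: mollifier_def)
    obtain C where C: "\<And>z. norm (k z) \<le> C"
      using continuous_compact_support_bounded[OF smooth_continuous_on[OF ks(1)] ks(3)] by blast
    have close: "\<bar>G y - G x\<bar> \<le> e'" if "x - y \<in> cball 0 \<rho>" for x y
    proof (cases "x \<in> cball 0 (R + 1)")
      case True
      have "norm y \<le> norm x + norm (x - y)" by (metis norm_minus_commute norm_triangle_sub)
      with True that \<rho> have "x \<in> cball 0 (R + 2)" "y \<in> cball 0 (R + 2)" "dist y x < d"
        by (auto simp: dist_norm norm_minus_commute)
      then show ?thesis using d(2)[of x y] by (simp add: dist_real_def)
    next
      case False
      have "norm x \<le> norm y + norm (x - y)" by (metis norm_triangle_sub)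
      with False that \<rho> have "x \<notin> cball 0 R" "y \<notin> cball 0 R" by auto
      then show ?thesis using G(2) e' by simp
    qed
    have i1: "integrable lebesgue (\<lambda>y. G y * k (x - y))" for x
      using conv_integrable[OF Gi smooth_continuous_on[OF ks(1)] C] by simp
    have i2: "integrable lebesgue (\<lambda>y. k (x - y))" for x
      using mollifier_integral_diff[OF k, of x] not_integrable_integral_eq by fastforce
    have pt: "\<bar>conv k G x - G x\<bar> \<le> e'" for x
    proof -
      have "conv k G x - G x = (LINT y|lebesgue. (G y - G x) * k (x - y))"
        using i1[of x] i2[of x] mollifier_integral_diff[OF k, of x] by (simp add: conv_def left_diff_distrib)
      also have "norm \<dots> \<le> (LINT y|lebesgue. e' * k (x - y))"
      proof (rule Bochner_Integration.integral_norm_bound_integral)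
        show "integrable lebesgue (\<lambda>y. (G y - G x) * k (x - y))"
          using i1[of x] i2[of x] by (simp add: left_diff_distrib)
        show "integrable lebesgue (\<lambda>y. e' * k (x - y))" using i2 by simp
        show "norm ((G y - G x) * k (x - y)) \<le> e' * k (x - y)" for y
          using close[of x y] ks(2)[of "x - y"] ks(3)[of "x - y"]
          by (cases "x - y \<in> cball 0 \<rho>") (auto simp: abs_mult intro: mult_right_mono)
      qed
      finally show ?thesis using mollifier_integral_diff[OF k, of x] by simp
    qed
    have z: "conv k G x - G x = 0" if "x \<notin> cball 0 (R + 1)" for x
    proof -
      have "G y * k (x - y) = 0" for y
      proof (cases "x - y \<in> cball 0 \<rho>")
        case True
        have "norm x \<le> norm y + norm (x - y)" by (metis norm_triangle_sub)
        with True that \<rho> have "y \<notin> cball 0 R" by auto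
        then show ?thesis using G(2) by simp
      qed (use ks(3) in simp)
      then have "(\<lambda>y. G y * k (x - y)) = (\<lambda>y. 0)" by (rule ext)
      then have "conv k G x = 0" by (simp only: conv_def) simp
      moreover have "G x = 0" using that by (intro G(2)) auto
      ultimately show ?thesis by simp
    qed
    have m1: "(\<lambda>x. conv k G x - G x) \<in> borel_measurable (lebesgue_on (cball 0 (R + 1)))"
      using smooth_continuous_on[OF smooth_conv[OF Gi ks(1), of 0 \<rho>]] ks(3) G(1)
      by (intro borel_measurable_lebesgue_on_continuous continuous_on_diff) auto
    note b = L2_bounded[OF _ m1, of e', folded m_def]
    have "norm_L2 UNIV (\<lambda>x. conv k G x - G x) = norm_L2 (cball 0 (R + 1)) (\<lambda>x. conv k G x - G x)"
      using pt e' by (intro L2_extend(2) z b(1)) auto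
    also have "\<dots> \<le> e' * m" using pt e' by (intro b(2)) auto
    also have "\<dots> \<le> e" by (rule e'(2))
    finally show "norm_L2 UNIV (\<lambda>x. conv k G x - G x) \<le> e" .
  qed
qed

text \<open>By contractivity, replacing \<open>F\<close> by a nearby continuous \<open>G\<close>
  changes every mollification by no more than it changes the function. Hence \<rho> can be taken
  from \<open>G\<close>.\<close>

lemma mollify_L2:
  fixes F :: "'a::euclidean_space \<Rightarrow> real"
  assumes F: "F \<in> L2 UNIV" "\<And>x. x \<notin> cball 0 R \<Longrightarrow> F x = 0" and R: "0 < R" and e: "0 < e"
  obtains \<rho> where "0 < \<rho>" "\<And>k. mollifier (cball 0 \<rho>) k \<Longrightarrow> norm_L2 UNIV (\<lambda>x. conv k F x - F x) \<le> e"
proof -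
  have U: "(UNIV::'a set) \<in> sets lebesgue" by simp
  obtain G where G: "continuous_on UNIV G" "\<And>x. x \<notin> cball 0 (R + 1) \<Longrightarrow> G x = 0" "G \<in> L2 UNIV"
    "norm_L2 UNIV (\<lambda>x. F x - G x) < e / 3"
    using L2_approx_continuous[OF F R, of "e / 3"] e by auto
  obtain \<rho> where \<rho>: "0 < \<rho>" "\<And>k. mollifier (cball 0 \<rho>) k \<Longrightarrow> norm_L2 UNIV (\<lambda>x. conv k G x - G x) \<le> e / 3"
    using mollify_continuous[of G "R + 1" "e / 3"] G(1,2) e by auto
  have Fi: "integrable lebesgue F" by (rule L2_bounded_support_integrable[OF F])
  have Gi: "integrable lebesgue G" by (rule L2_bounded_support_integrable[OF G(3) G(2)])
  show ?thesis
  proof (rule that[OF \<rho>(1)])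
    fix k :: "'a \<Rightarrow> real" assume k: "mollifier (cball 0 \<rho>) k"
    then have ks: "smooth k" "\<And>z. 0 \<le> k z" "\<And>z. z \<notin> cball 0 \<rho> \<Longrightarrow> k z = 0" by (auto simp: mollifier_def)
    obtain C where C: "\<And>z. norm (k z) \<le> C"
      using continuous_compact_support_bounded[OF smooth_continuous_on[OF ks(1)] ks(3)] by blast
    have i: "integrable lebesgue H \<Longrightarrow> integrable lebesgue (\<lambda>y. H y * k (x - y))" for H x
      using conv_integrable[OF _ smooth_continuous_on[OF ks(1)] C] by simp
    have eq: "conv k (\<lambda>x. F x - G x) = (\<lambda>x. conv k F x - conv k G x)"
      unfolding conv_def using i[OF Fi] i[OF Gi] by (simp add: left_diff_distrib)
    have FG: "(\<lambda>x. F x - G x) \<in> L2 UNIV" "integrable lebesgue (\<lambda>x. F x - G x)"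
      using L2_diff(1)[OF U F(1) G(3)] Fi Gi by auto
    note cF = conv_L2(1)[OF Fi F(1) k]
    note cG = conv_L2(1)[OF Gi G(3) k]
    have "norm_L2 UNIV (\<lambda>x. conv k F x - conv k G x) \<le> norm_L2 UNIV (\<lambda>x. F x - G x)"
      using conv_L2(2)[OF FG(2,1) k] eq by simp
    moreover have "norm_L2 UNIV (\<lambda>x. conv k F x - F x)
        \<le> norm_L2 UNIV (\<lambda>x. conv k F x - conv k G x) + norm_L2 UNIV (\<lambda>x. conv k G x - F x)"
      by (rule norm_L2_triangle[OF U cF cG F(1)])
    moreover have "norm_L2 UNIV (\<lambda>x. conv k G x - F x)
        \<le> norm_L2 UNIV (\<lambda>x. conv k G x - G x) + norm_L2 UNIV (\<lambda>x. G x - F x)"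
      by (rule norm_L2_triangle[OF U cG G(3) F(1)])
    ultimately show "norm_L2 UNIV (\<lambda>x. conv k F x - F x) \<le> e"
      using \<rho>(2)[OF k] G(4) norm_L2_minus_commute[of UNIV F G] by simp
  qed
qed

section \<open>Localisation and the fundamental lemma of the calculus of variations\<close>

lemma AE_on_open_local:
  fixes D :: "'a::euclidean_space set"
  assumes D: "open D" and loc: "\<And>x. x \<in> D \<Longrightarrow> \<exists>r>0. AE y in lebesgue. y \<in> ball x r \<longrightarrow> P y"
  shows "AE y in lebesgue. y \<in> D \<longrightarrow> P y"
proof -
  obtain r where r: "\<And>x. x \<in> D \<Longrightarrow> 0 < r x" "\<And>x. x \<in> D \<Longrightarrow> AE y in lebesgue. y \<in> ball x (r x) \<longrightarrow> P y"
    using loc by metis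
  obtain \<F> where \<F>: "\<F> \<subseteq> (\<lambda>x. ball x (r x)) ` D" "countable \<F>" "\<Union>\<F> = \<Union>((\<lambda>x. ball x (r x)) ` D)"
    using Lindelof[of "(\<lambda>x. ball x (r x)) ` D"] by auto
  have "AE y in lebesgue. \<forall>B\<in>\<F>. y \<in> B \<longrightarrow> P y"
    using \<F>(1) r(2) by (subst AE_ball_countable[OF \<F>(2)]) auto
  then show ?thesis
  proof eventually_elim
    case (elim y)
    show ?case
    proof
      assume "y \<in> D"
      then have "y \<in> \<Union>\<F>" unfolding \<F>(3) using r(1) by (auto intro!: bexI[of _ y])
      with elim show "P y" by auto
    qed
  qed
qed

text \<open>In a small ball the indicator of the set where \<open>h\<close> is positive would be the
  right test function. Its mollifications are admissible and converge to it in \<open>L2\<close>, so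
  the integral of the positive part of \<open>h\<close> over that ball is at most zero.\<close>

lemma AE_nonpos_if_test_nonpos:
  fixes D :: "'a::euclidean_space set" and h :: "'a \<Rightarrow> real"
  assumes D: "open D" and h: "\<And>R. h \<in> L2 (D \<inter> ball 0 R)"
    and test: "\<And>\<zeta>. test_function D \<zeta> \<Longrightarrow> (\<And>x. 0 \<le> \<zeta> x) \<Longrightarrow> (LINT x|lebesgue_on D. h x * \<zeta> x) \<le> 0"
  shows "AE y in lebesgue. y \<in> D \<longrightarrow> h y \<le> 0"
proof (rule AE_on_open_local[OF D])
  fix x0 assume "x0 \<in> D"
  then obtain r' where r': "0 < r'" "cball x0 r' \<subseteq> D"
    using D open_contains_cball by blast
  define r where "r = r' / 2"
  have r: "0 < r" "cball x0 (2 * r) \<subseteq> D" using r' by (auto simp: r_def)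
  have DS: "D \<in> sets lebesgue" using D by auto
  \<comment> \<open>The indicator lives in the ball of radius \<open>r\<close>, and a kernel of
    radius at most \<open>r\<close> spreads it at most to radius \<open>2 * r\<close>, which is
    still inside \<open>D\<close>.\<close>
  define B where "B = cball x0 (2 * r)"
  have B: "B \<in> sets lebesgue" "B \<subseteq> D" using r by (auto simp: B_def)
  have hB: "h \<in> L2 B"
  proof -
    obtain R where "B \<subseteq> ball 0 R"
      using bounded_subset_ballD[of B 0] by (auto simp: B_def)
    then show ?thesis using B D by (intro L2_subset(1)[OF _ B(1) _ h[of R]]) auto
  qed
  define P where "P = {x \<in> ball x0 r. 0 < h x}"
  have hP: "h \<in> borel_measurable (lebesgue_on B)" by (rule L2_measurable[OF B(1) hB])
  have Pm: "P \<in> sets lebesgue"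
  proof -
    have "{x \<in> space (lebesgue_on B). 0 < h x} \<in> sets (lebesgue_on B)" using hP by measurable
    then have "{x \<in> B. 0 < h x} \<in> sets lebesgue"
      using B(1) by (simp add: sets_restrict_space_iff)
    moreover have "P = {x \<in> B. 0 < h x} \<inter> ball x0 r"
      using r by (auto simp: P_def B_def)
    ultimately show ?thesis by auto
  qed
  have PB: "P \<subseteq> B" using r by (auto simp: P_def B_def)
  have Pl: "P \<in> lmeasurable"
    using Pm PB by (intro bounded_set_imp_lmeasurable) (auto simp: B_def intro: bounded_subset)
  define F where "F x = (indicator P x * 1 :: real)" for x
  have FL: "F \<in> L2 UNIV"
    unfolding F_def using Pl by (intro L2_UNIV_indicator[OF Pm] L2_bounded(1)[of _ _ 1]) auto
  obtain R where R: "0 < R" "B \<subseteq> cball 0 R"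
  proof -
    obtain R where "B \<subseteq> ball 0 R" "0 < R"
      using bounded_subset_ballD[of B 0] by (auto simp: B_def)
    then show ?thesis using that[of R] ball_subset_cball by blast
  qed
  have F0: "F x = 0" if "x \<notin> cball 0 R" for x using that R PB by (auto simp: F_def indicator_def)
  have Fi: "integrable lebesgue F" by (rule L2_bounded_support_integrable[OF FL F0])
  have le: "(LINT x|lebesgue_on B. h x * F x) \<le> norm_L2 B h * e" if e: "0 < e" for e
  proof -
    obtain \<rho> where \<rho>: "0 < \<rho>" "\<And>k. mollifier (cball 0 \<rho>) k \<Longrightarrow> norm_L2 UNIV (\<lambda>x. conv k F x - F x) \<le> e"
      using mollify_L2[OF FL F0 R(1) e] by blast
    obtain k :: "'a \<Rightarrow> real" where k0: "mollifier (cball 0 (min \<rho> r)) k"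
      using mollifier_exists[of "min \<rho> r" 0] \<rho>(1) r(1) by auto
    have k: "mollifier (cball 0 \<rho>) k" by (rule mollifier_mono[OF k0]) auto
    have ks: "smooth k" "\<And>z. 0 \<le> k z" "\<And>z. z \<notin> cball 0 (min \<rho> r) \<Longrightarrow> k z = 0"
      using k0 by (auto simp: mollifier_def)
    have sm: "smooth (conv k F)" by (rule smooth_conv[OF Fi ks(1) ks(3)])
    have z: "conv k F x = 0" if "x \<notin> B" for x
    proof -
      have "F y * k (x - y) = 0" for y
      proof (cases "y \<in> P")
        case True
        then have "dist x0 y < r" by (simp add: P_def)
        moreover have "dist x0 x \<le> dist x0 y + norm (x - y)"
          by (metis dist_commute dist_norm dist_triangle)
        ultimately have "x - y \<notin> cball 0 (min \<rho> r)"
          using that by (auto simp: B_def)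
        then show ?thesis using ks(3) by simp
      qed (simp add: F_def)
      then have "(\<lambda>y. F y * k (x - y)) = (\<lambda>y. 0)" by (rule ext)
      then show ?thesis by (simp only: conv_def) simp
    qed
    have tf: "test_function D (conv k F)"
      by (rule test_functionI[OF sm _ B(2) z]) (auto simp: B_def)
    have nn: "0 \<le> conv k F x" for x
      unfolding conv_def by (intro integral_nonneg_AE AE_I2) (use ks in \<open>auto simp: F_def\<close>)
    have "(LINT x|lebesgue_on D. h x * conv k F x) = (LINT x|lebesgue_on B. h x * conv k F x)"
      using DS B z unfolding integral_restrict_space[of D lebesgue, simplified, OF DS]
        integral_restrict_space[of B lebesgue, simplified, OF B(1)]
      by (intro Bochner_Integration.integral_cong) (auto simp: indicator_def)
    then have neg: "(LINT x|lebesgue_on B. h x * conv k F x) \<le> 0"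
      using test[OF tf nn] by simp
    have cB: "conv k F \<in> L2 B" "F \<in> L2 B"
      using L2_subset(1)[OF _ B(1) _ conv_L2(1)[OF Fi FL k]] L2_subset(1)[OF _ B(1) _ FL] by auto
    note diffB = L2_diff(1)[OF B(1) cB]
    have "(LINT x|lebesgue_on B. h x * F x)
        = (LINT x|lebesgue_on B. h x * conv k F x) - (LINT x|lebesgue_on B. h x * (conv k F x - F x))"
      using L2_mult(1)[OF B(1) hB cB(1)] L2_mult(1)[OF B(1) hB cB(2)] by (simp add: right_diff_distrib)
    also have "\<dots> \<le> \<bar>LINT x|lebesgue_on B. h x * (conv k F x - F x)\<bar>" using neg by simp
    also have "\<dots> \<le> norm_L2 B h * norm_L2 B (\<lambda>x. conv k F x - F x)"
      by (rule L2_mult(2)[OF B(1) hB diffB])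
    also have "norm_L2 B (\<lambda>x. conv k F x - F x) \<le> e"
      using L2_subset(2)[OF _ B(1) _ L2_diff(1)[OF _ conv_L2(1)[OF Fi FL k] FL]] \<rho>(2)[OF k] by simp
    finally show ?thesis by (simp add: mult_left_mono)
  qed
  have le0: "(LINT x|lebesgue_on B. h x * F x) \<le> 0"
  proof (rule field_le_epsilon)
    fix e :: real assume "0 < e"
    define c where "c = norm_L2 B h"
    define e' where "e' = e / (c + 1)"
    have n: "0 \<le> c" by (simp add: c_def)
    have "0 < e'" using \<open>0 < e\<close> n unfolding e'_def by (intro divide_pos_pos) linarith+
    moreover have "c * e' \<le> e"
      using \<open>0 < e\<close> n by (simp add: e'_def field_simps)
    ultimately show "(LINT x|lebesgue_on B. h x * F x) \<le> 0 + e" using le[of e'] by (simp add: c_def)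
  qed
  have i: "integrable (lebesgue_on B) (\<lambda>x. h x * F x)"
    using L2_mult(1)[OF B(1) hB L2_subset(1)[OF _ B(1) _ FL]] by auto
  have nn: "0 \<le> h x * F x" for x by (auto simp: F_def P_def indicator_def)
  have "(LINT x|lebesgue_on B. h x * F x) = 0"
    using le0 nn by (intro antisym integral_nonneg_AE AE_I2)
  then have "AE x in lebesgue_on B. h x * F x = 0"
    using integral_nonneg_eq_0_iff_AE[OF i] nn by simp
  then have "AE x in lebesgue. x \<in> B \<longrightarrow> h x * F x = 0"
    using B(1) by (simp add: AE_restrict_space_iff)
  then have "AE y in lebesgue. y \<in> ball x0 r \<longrightarrow> h y \<le> 0"
  proof eventually_elim
    case (elim y)
    show ?case
    proof
      assume "y \<in> ball x0 r"
      then have "y \<in> B" using r by (auto simp: B_def)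
      with elim have "h y * F y = 0" by simp
      with \<open>y \<in> ball x0 r\<close> show "h y \<le> 0"
        by (cases "0 < h y") (auto simp: F_def P_def)
    qed
  qed
  then show "\<exists>r>0. AE y in lebesgue. y \<in> ball x0 r \<longrightarrow> h y \<le> 0" using r(1) by blast
qed

section \<open>Weak gradients\<close>

lemma L2_scaleR_integrable:
  fixes f :: "'a::euclidean_space \<Rightarrow> real" and g :: "'a \<Rightarrow> 'b::euclidean_space"
  assumes S: "S \<in> sets lebesgue" and f: "f \<in> L2 S" and g: "g \<in> L2 S"
  shows "integrable (lebesgue_on S) (\<lambda>x. f x *\<^sub>R g x)"
proof (rule Bochner_Integration.integrable_bound[OF L2_mult_integrable[OF assms]])
  show "(\<lambda>x. f x *\<^sub>R g x) \<in> borel_measurable (lebesgue_on S)"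
    using L2_measurable[OF S f] L2_measurable[OF S g] by measurable
qed auto

lemma L2_inner_left:
  fixes g :: "'a::euclidean_space \<Rightarrow> 'b::euclidean_space"
  assumes S: "S \<in> sets lebesgue" and g: "g \<in> L2 S" and b: "b \<in> Basis"
  shows "(\<lambda>x. g x \<bullet> b) \<in> L2 S"
  using L2_measurable[OF S g] b
  by (intro L2_mono(1)[OF S g]) (auto intro!: AE_I2 Basis_le_norm)

lemma weak_gradient_inner:
  fixes f :: "'a::euclidean_space \<Rightarrow> real"
  assumes D: "open D" and f: "f \<in> L2 D" and g: "g \<in> L2 D" and wg: "weak_gradient D f g"
    and \<phi>: "test_function D \<phi>"
  shows "(LINT x|lebesgue_on D. f x * (gradient \<phi> x \<bullet> b)) = - (LINT x|lebesgue_on D. \<phi> x * (g x \<bullet> b))"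
proof -
  have S: "D \<in> sets lebesgue" using D by auto
  note t = test_function_L2[OF S \<phi>]
  have "(LINT x|lebesgue_on D. f x *\<^sub>R gradient \<phi> x) = - (LINT x|lebesgue_on D. \<phi> x *\<^sub>R g x)"
    using wg \<phi> by (simp add: weak_gradient_def set_lebesgue_integral_eq_restrict[OF S])
  then have "(LINT x|lebesgue_on D. f x *\<^sub>R gradient \<phi> x) \<bullet> b = - ((LINT x|lebesgue_on D. \<phi> x *\<^sub>R g x) \<bullet> b)"
    by simp
  moreover have "(LINT x|lebesgue_on D. f x *\<^sub>R gradient \<phi> x) \<bullet> b = (LINT x|lebesgue_on D. (f x *\<^sub>R gradient \<phi> x) \<bullet> b)"
    by (rule integral_inner_left[symmetric]) (rule L2_scaleR_integrable[OF S f t(2)])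
  moreover have "(LINT x|lebesgue_on D. \<phi> x *\<^sub>R g x) \<bullet> b = (LINT x|lebesgue_on D. (\<phi> x *\<^sub>R g x) \<bullet> b)"
    by (rule integral_inner_left[symmetric]) (rule L2_scaleR_integrable[OF S t(1) g])
  ultimately show ?thesis by simp
qed

lemma weak_gradient_diff:
  fixes f1 f2 :: "'a::euclidean_space \<Rightarrow> real"
  assumes D: "open D" and f: "f1 \<in> L2 D" "f2 \<in> L2 D" and g: "g1 \<in> L2 D" "g2 \<in> L2 D"
    and wg: "weak_gradient D f1 g1" "weak_gradient D f2 g2"
  shows "weak_gradient D (\<lambda>x. f1 x - f2 x) (\<lambda>x. g1 x - g2 x)"
  unfolding weak_gradient_def
proof (intro allI impI)
  fix \<phi> assume \<phi>: "test_function D \<phi>"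
  have S: "D \<in> sets lebesgue" using D by auto
  note t = test_function_L2[OF S \<phi>]
  have "(LINT x|lebesgue_on D. f1 x *\<^sub>R gradient \<phi> x) = - (LINT x|lebesgue_on D. \<phi> x *\<^sub>R g1 x)"
    "(LINT x|lebesgue_on D. f2 x *\<^sub>R gradient \<phi> x) = - (LINT x|lebesgue_on D. \<phi> x *\<^sub>R g2 x)"
    using wg \<phi> by (simp_all add: weak_gradient_def set_lebesgue_integral_eq_restrict[OF S])
  then show "(LINT x:D|lebesgue. (f1 x - f2 x) *\<^sub>R gradient \<phi> x) = - (LINT x:D|lebesgue. \<phi> x *\<^sub>R (g1 x - g2 x))"
    using L2_scaleR_integrable[OF S f(1) t(2)] L2_scaleR_integrable[OF S f(2) t(2)]
      L2_scaleR_integrable[OF S t(1) g(1)] L2_scaleR_integrable[OF S t(1) g(2)]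
    by (simp add: set_lebesgue_integral_eq_restrict[OF S] scaleR_diff_left scaleR_diff_right)
qed

text \<open>Each component of the difference of two weak gradients integrates to zero against every
  test function, so \<open>AE_nonpos_if_test_nonpos\<close> applies to it with either sign.\<close>

lemma weak_gradient_unique:
  fixes f :: "'a::euclidean_space \<Rightarrow> real"
  assumes D: "open D" and f: "f \<in> L2 D" and g: "g1 \<in> L2 D" "g2 \<in> L2 D"
    and wg: "weak_gradient D f g1" "weak_gradient D f g2"
  shows "AE x in lebesgue_on D. g1 x = g2 x"
proof -
  have S: "D \<in> sets lebesgue" using D by auto
  have le: "AE x in lebesgue. x \<in> D \<longrightarrow> h1 x \<bullet> b - h2 x \<bullet> b \<le> 0"
    if h: "h1 \<in> L2 D" "h2 \<in> L2 D" "weak_gradient D f h1" "weak_gradient D f h2" and b: "b \<in> Basis" for h1 h2 b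
  proof (rule AE_nonpos_if_test_nonpos[OF D])
    note hb = L2_inner_left[OF S h(1) b] L2_inner_left[OF S h(2) b]
    show "(\<lambda>x. h1 x \<bullet> b - h2 x \<bullet> b) \<in> L2 (D \<inter> ball 0 R)" for R
      by (rule L2_subset(1)[OF S _ _ L2_diff(1)[OF S hb]]) (use S in auto)
    fix \<zeta> assume \<zeta>: "test_function D \<zeta>"
    note t = test_function_L2[OF S \<zeta>]
    have "(LINT x|lebesgue_on D. \<zeta> x * (h1 x \<bullet> b)) = (LINT x|lebesgue_on D. \<zeta> x * (h2 x \<bullet> b))"
      using weak_gradient_inner[OF D f h(1) h(3) \<zeta>, of b] weak_gradient_inner[OF D f h(2) h(4) \<zeta>, of b] by simp
    then show "(LINT x|lebesgue_on D. (h1 x \<bullet> b - h2 x \<bullet> b) * \<zeta> x) \<le> 0"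
      using L2_mult(1)[OF S hb(1) t(1)] L2_mult(1)[OF S hb(2) t(1)]
      by (simp add: left_diff_distrib mult.commute[of "\<zeta> _"])
  qed
  have "AE x in lebesgue. \<forall>b\<in>Basis. x \<in> D \<longrightarrow> g1 x \<bullet> b = g2 x \<bullet> b"
  proof (subst AE_ball_countable)
    show "countable (Basis::'a set)" by (simp add: countable_finite)
    show "\<forall>b\<in>Basis. AE x in lebesgue. x \<in> D \<longrightarrow> g1 x \<bullet> b = g2 x \<bullet> b"
    proof
      fix b :: 'a assume b: "b \<in> Basis"
      from le[OF g wg b] le[OF g(2,1) wg(2,1) b]
      show "AE x in lebesgue. x \<in> D \<longrightarrow> g1 x \<bullet> b = g2 x \<bullet> b"
        by eventually_elim auto
    qed
  qed
  then have "AE x in lebesgue. x \<in> D \<longrightarrow> g1 x = g2 x"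
    by eventually_elim (auto intro: euclidean_eqI)
  then show ?thesis using S by (simp add: AE_restrict_space_iff)
qed

lemma wgrad:
  assumes "f \<in> H1 D"
  shows "f \<in> L2 D" "wgrad D f \<in> L2 D" "weak_gradient D f (wgrad D f)"
proof -
  have "\<exists>g. g \<in> L2 D \<and> weak_gradient D f g" using assms by (auto simp: H1_def)
  from someI_ex[OF this] show "wgrad D f \<in> L2 D" "weak_gradient D f (wgrad D f)"
    by (auto simp: wgrad_def)
  show "f \<in> L2 D" using assms by (simp add: H1_def)
qed

lemma H1_zero: "(\<lambda>x. 0) \<in> H1 D"
  unfolding H1_def weak_gradient_def mem_Collect_eq
  by (intro conjI bexI[of _ "\<lambda>x. 0"]) (auto simp: set_lebesgue_integral_def)

text \<open>\<open>wgrad\<close> is an arbitrary choice among the weak gradients, so it is additive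
  only almost everywhere, through uniqueness. For the same reason the seminorm laws of
  \<open>norm_H1\<close> below are stated for members of \<open>H1 D\<close>.\<close>

lemma H1_diff:
  assumes D: "open D" and f: "f1 \<in> H1 D" "f2 \<in> H1 D"
  shows "(\<lambda>x. f1 x - f2 x) \<in> H1 D"
    and "AE x in lebesgue_on D. wgrad D (\<lambda>x. f1 x - f2 x) x = wgrad D f1 x - wgrad D f2 x"
proof -
  have S: "D \<in> sets lebesgue" using D by auto
  note f1 = wgrad[OF f(1)] and f2 = wgrad[OF f(2)]
  note w = weak_gradient_diff[OF D f1(1) f2(1) f1(2) f2(2) f1(3) f2(3)]
  note d = L2_diff(1)[OF S f1(1) f2(1)] and d' = L2_diff(1)[OF S f1(2) f2(2)]
  show h: "(\<lambda>x. f1 x - f2 x) \<in> H1 D"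
    using d d' w by (auto simp: H1_def)
  show "AE x in lebesgue_on D. wgrad D (\<lambda>x. f1 x - f2 x) x = wgrad D f1 x - wgrad D f2 x"
    by (rule weak_gradient_unique[OF D d wgrad(2)[OF h] d' wgrad(3)[OF h] w])
qed

lemma norm_L2_wgrad_diff:
  assumes D: "open D" and f: "f1 \<in> H1 D" "f2 \<in> H1 D"
  shows "norm_L2 D (wgrad D (\<lambda>x. f1 x - f2 x)) = norm_L2 D (\<lambda>x. wgrad D f1 x - wgrad D f2 x)"
proof -
  have S: "D \<in> sets lebesgue" using D by auto
  show ?thesis
    using H1_diff[OF assms] wgrad(2)[OF f(1)] wgrad(2)[OF f(2)] wgrad(2)[OF H1_diff(1)[OF assms]]
    by (intro norm_L2_cong_AE S L2_measurable[OF S] L2_diff(1)[OF S]) auto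
qed

lemma norm_H1_nonneg [simp]: "0 \<le> norm_H1 D f"
  by (simp add: norm_H1_def)

lemma norm_L2_le_norm_H1: "norm_L2 D f \<le> norm_H1 D f" "norm_L2 D (wgrad D f) \<le> norm_H1 D f"
  unfolding norm_H1_def by (auto intro!: real_le_rsqrt)

lemma norm_H1_diff_eq:
  assumes D: "open D" and f: "f1 \<in> H1 D" "f2 \<in> H1 D"
  shows "norm_H1 D (\<lambda>x. f1 x - f2 x)
    = sqrt ((norm_L2 D (\<lambda>x. f1 x - f2 x))\<^sup>2 + (norm_L2 D (\<lambda>x. wgrad D f1 x - wgrad D f2 x))\<^sup>2)"
  unfolding norm_H1_def norm_L2_wgrad_diff[OF assms] ..

lemma norm_H1_commute:
  assumes D: "open D" and f: "f1 \<in> H1 D" "f2 \<in> H1 D"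
  shows "norm_H1 D (\<lambda>x. f1 x - f2 x) = norm_H1 D (\<lambda>x. f2 x - f1 x)"
  unfolding norm_H1_diff_eq[OF assms] norm_H1_diff_eq[OF D f(2,1)]
  by (simp add: norm_L2_minus_commute[of D f1] norm_L2_minus_commute[of D "wgrad D f1"])

lemma norm_H1_triangle:
  assumes D: "open D" and f: "f1 \<in> H1 D" "f2 \<in> H1 D" "f3 \<in> H1 D"
  shows "norm_H1 D (\<lambda>x. f1 x - f3 x) \<le> norm_H1 D (\<lambda>x. f1 x - f2 x) + norm_H1 D (\<lambda>x. f2 x - f3 x)"
proof -
  have S: "D \<in> sets lebesgue" using D by auto
  define a b a' b' where "a = norm_L2 D (\<lambda>x. f1 x - f2 x)" and "b = norm_L2 D (\<lambda>x. f2 x - f3 x)"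
    and "a' = norm_L2 D (\<lambda>x. wgrad D f1 x - wgrad D f2 x)"
    and "b' = norm_L2 D (\<lambda>x. wgrad D f2 x - wgrad D f3 x)"
  have "norm_L2 D (\<lambda>x. f1 x - f3 x) \<le> a + b"
    unfolding a_def b_def by (intro norm_L2_triangle S wgrad f)
  moreover have "norm_L2 D (\<lambda>x. wgrad D f1 x - wgrad D f3 x) \<le> a' + b'"
    unfolding a'_def b'_def by (intro norm_L2_triangle S wgrad f)
  ultimately have "norm_H1 D (\<lambda>x. f1 x - f3 x) \<le> sqrt ((a + b)\<^sup>2 + (a' + b')\<^sup>2)"
    unfolding norm_H1_diff_eq[OF D f(1,3)] by (intro real_sqrt_le_mono add_mono power_mono) auto
  also have "\<dots> \<le> sqrt (a\<^sup>2 + a'\<^sup>2) + sqrt (b\<^sup>2 + b'\<^sup>2)"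
    by (rule real_sqrt_sum_squares_triangle_ineq)
  finally show ?thesis
    unfolding norm_H1_diff_eq[OF D f(1,2)] norm_H1_diff_eq[OF D f(2,3)] a_def b_def a'_def b'_def .
qed

lemma norm_H1_triangle':
  assumes D: "open D" and f: "f1 \<in> H1 D" "f2 \<in> H1 D"
  shows "norm_H1 D f1 \<le> norm_H1 D (\<lambda>x. f1 x - f2 x) + norm_H1 D f2"
  using norm_H1_triangle[OF D f H1_zero] by simp

section \<open>Smooth functions are dense up to the boundary\<close>

text \<open>If the translated supports \<open>x - supp k\<close> stay in \<open>D\<close>, then \<open>y \<mapsto> k (x - y)\<close> is admissible in the
  definition of the weak gradient, even for points \<open>x\<close> close to the boundary.\<close>

lemma gradient_conv_weak:
  fixes f :: "'a::euclidean_space \<Rightarrow> real"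
  assumes D: "open D" and f: "f \<in> L2 D" and g: "g \<in> L2 D" and wg: "weak_gradient D f g"
    and A: "A \<subseteq> D" and k: "smooth k" "\<And>z. z \<notin> cball a r \<Longrightarrow> k z = 0"
    and F: "integrable lebesgue (\<lambda>y. indicator A y * f y)"
    and x: "cball (x - a) r \<subseteq> A"
  shows "gradient (conv k (\<lambda>y. indicator A y * f y)) x \<bullet> b = conv k (\<lambda>y. indicator A y * (g y \<bullet> b)) x"
proof -
  have S: "D \<in> sets lebesgue" using D by auto
  define \<phi> where "\<phi> y = k (x - y)" for y
  have \<phi>s: "smooth \<phi>"
    unfolding \<phi>_def using smooth_compose_affine[OF bounded_linear_minus[OF bounded_linear_ident] k(1), of x] by simp
  have iff: "y \<in> cball (x - a) r \<longleftrightarrow> x - y \<in> cball a r" for y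
    by (simp add: dist_norm algebra_simps norm_minus_commute)
  have \<phi>0: "\<phi> y = 0" if "y \<notin> cball (x - a) r" for y
    using that k(2) iff[of y] by (simp add: \<phi>_def)
  have \<phi>t: "test_function D \<phi>"
    by (rule test_functionI[OF \<phi>s compact_cball _ \<phi>0]) (use x A in auto)
  have grad: "gradient \<phi> y = - gradient k (x - y)" for y
  proof (rule gradient_eqI)
    have "((\<lambda>y. x - y) has_derivative (\<lambda>h. - h)) (at y)"
      by (auto intro!: derivative_eq_intros)
    from has_derivative_compose[OF this smooth_GDERIV[OF k(1), unfolded gderiv_def]]
    show "GDERIV \<phi> y :> - gradient k (x - y)"
      unfolding gderiv_def \<phi>_def by simp
  qed
  obtain C where C: "\<And>z. norm (gradient k z) \<le> C"
  proof -
    have "gradient k z = 0" if "z \<notin> cball a r" for z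
      using that by (rule gradient_eq_0[of a r k, rotated]) (rule k(2))
    then show ?thesis
      using continuous_compact_support_bounded[OF continuous_on_gradient[OF k(1)], of a r] that by blast
  qed
  have "gradient (conv k (\<lambda>y. indicator A y * f y)) x \<bullet> b
      = (LINT y|lebesgue. ((indicator A y * f y) *\<^sub>R gradient k (x - y)) \<bullet> b)"
    using integral_inner_left[OF conv_integrable[OF F continuous_on_gradient[OF k(1)] C], of x b]
      gradient_conv[OF F k(1), of a r x] k(2) by simp
  \<comment> \<open>Cutting \<open>f\<close> off outside \<open>A\<close> is harmless: the support
    of \<phi> lies in \<open>A\<close>, so the gradient of \<phi> vanishes on the rest of
    \<open>D\<close>.\<close>
  also have "\<dots> = (LINT y|lebesgue. indicator D y *\<^sub>R (- (f y * (gradient \<phi> y \<bullet> b))))"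
  proof (rule Bochner_Integration.integral_cong[OF refl])
    fix y
    show "((indicator A y * f y) *\<^sub>R gradient k (x - y)) \<bullet> b = indicator D y *\<^sub>R (- (f y * (gradient \<phi> y \<bullet> b)))"
    proof (cases "y \<in> A")
      case False
      then have "gradient \<phi> y = 0"
        using x by (intro gradient_eq_0[OF \<phi>0]) auto
      with False show ?thesis by simp
    qed (use A in \<open>auto simp: grad indicator_def\<close>)
  qed
  also have "\<dots> = - (LINT y|lebesgue_on D. f y * (gradient \<phi> y \<bullet> b))"
    using S by (simp add: integral_restrict_space)
  also have "\<dots> = (LINT y|lebesgue_on D. \<phi> y * (g y \<bullet> b))"
    using weak_gradient_inner[OF D f g wg \<phi>t] by simp
  also have "\<dots> = (LINT y|lebesgue. indicator D y *\<^sub>R (\<phi> y * (g y \<bullet> b)))"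
    using S by (simp add: integral_restrict_space)
  also have "\<dots> = conv k (\<lambda>y. indicator A y * (g y \<bullet> b)) x"
    unfolding conv_def
  proof (rule Bochner_Integration.integral_cong[OF refl])
    fix y
    show "indicator D y *\<^sub>R (\<phi> y * (g y \<bullet> b)) = indicator A y * (g y \<bullet> b) * k (x - y)"
    proof (cases "y \<in> A")
      case False
      then have "\<phi> y = 0" using x by (intro \<phi>0) auto
      with False show ?thesis by simp
    qed (use A in \<open>auto simp: \<phi>_def indicator_def\<close>)
  qed
  finally show ?thesis .
qed

lemma norm_L2_le_sum_Basis:
  fixes v :: "'a::euclidean_space \<Rightarrow> 'b::euclidean_space"
  assumes S: "S \<in> sets lebesgue" and v: "v \<in> L2 S"
  shows "norm_L2 S v \<le> (\<Sum>b\<in>Basis. norm_L2 S (\<lambda>x. v x \<bullet> b))"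
proof -
  have vb: "(\<lambda>x. \<bar>v x \<bullet> b\<bar>) \<in> L2 S" if "b \<in> Basis" for b
    using L2_measurable[OF S v] that
    by (intro L2_mono(1)[OF S v]) (auto intro!: AE_I2 Basis_le_norm)
  have eq: "norm_L2 S (\<lambda>x. \<bar>v x \<bullet> b\<bar>) = norm_L2 S (\<lambda>x. v x \<bullet> b)" for b
    by (simp add: norm_L2_def)
  have "norm_L2 S v \<le> norm_L2 S (\<lambda>x. \<Sum>b\<in>Basis. \<bar>v x \<bullet> b\<bar>)"
    using norm_le_l1 by (intro L2_mono(2)[OF S L2_sum(1)[OF S vb] L2_measurable[OF S v]])
      (auto intro!: AE_I2 order_trans[OF _ abs_ge_self])
  also have "\<dots> \<le> (\<Sum>b\<in>Basis. norm_L2 S (\<lambda>x. \<bar>v x \<bullet> b\<bar>))"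
    by (rule L2_sum(2)[OF S vb])
  finally show ?thesis by (simp add: eq)
qed

text \<open>The cone condition provides balls of arbitrarily small shifts that lead from every point
  of \<open>D \<inter> U\<close> into \<open>D\<close>. Convolution with a kernel supported in such
  a ball commutes with the weak gradient on all of \<open>D \<inter> U\<close>, right up to the
  boundary of \<open>D\<close>, and it converges in \<open>L2\<close> as the shifts shrink.\<close>

lemma local_approximation:
  fixes f :: "'a::euclidean_space \<Rightarrow> real"
  assumes D: "open D" and f: "f \<in> L2 D" and g: "g \<in> L2 D" and wg: "weak_gradient D f g"
    and U: "open U" "bounded U"
    and cone: "\<And>\<delta>. 0 < \<delta> \<Longrightarrow> \<exists>a r. 0 < r \<and> cball a r \<subseteq> cball 0 \<delta> \<and> (\<forall>x\<in>D \<inter> U. cball (x - a) r \<subseteq> D)"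
    and e: "0 < e"
  shows "\<exists>\<Phi>. smooth \<Phi> \<and> norm_L2 (D \<inter> U) (\<lambda>x. \<Phi> x - f x) \<le> e \<and> norm_L2 (D \<inter> U) (\<lambda>x. gradient \<Phi> x - g x) \<le> e"
proof -
  have S: "D \<in> sets lebesgue" and T: "D \<inter> U \<in> sets lebesgue" "open (D \<inter> U)" using D U by auto
  obtain R where R: "0 < R" "U \<subseteq> ball 0 R"
    using bounded_subset_ballD[OF U(2), of 0] by auto
  define A where "A = D \<inter> ball 0 (R + 1)"
  have A: "A \<in> sets lebesgue" "A \<subseteq> D" "D \<inter> U \<subseteq> A" using S R by (auto simp: A_def)
  have A0: "A \<subseteq> cball 0 (R + 1)" by (auto simp: A_def)
  define n where "n = real DIM('a)"
  have n: "1 \<le> n" by (simp add: n_def)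
  define e' where "e' = e / n"
  have e': "0 < e'" "e' \<le> e" "n * e' = e" using e n by (auto simp: e'_def field_simps)
  define F where "F y = indicator A y * f y" for y
  define G where "G b y = indicator A y * (g y \<bullet> b)" for b y
  have FL: "F \<in> L2 UNIV"
    unfolding F_def by (intro L2_UNIV_indicator L2_subset(1)[OF S A(1,2) f] A)
  have GL: "G b \<in> L2 UNIV" if "b \<in> Basis" for b
    unfolding G_def by (intro L2_UNIV_indicator L2_subset(1)[OF S A(1,2)] L2_inner_left[OF S g that] A)
  have F0: "F x = 0" and G0: "G b x = 0" if "x \<notin> cball 0 (R + 1)" for x b
    using that A0 by (auto simp: F_def G_def indicator_def)
  have R1: "0 < R + 1" using R by simp
  have Fi: "integrable lebesgue F" by (rule L2_bounded_support_integrable[OF FL F0])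
  obtain \<rho>0 where \<rho>0: "0 < \<rho>0" "\<And>k. mollifier (cball 0 \<rho>0) k \<Longrightarrow> norm_L2 UNIV (\<lambda>x. conv k F x - F x) \<le> e'"
    using mollify_L2[OF FL F0 R1 e'(1)] by blast
  have "\<forall>b\<in>Basis. \<exists>\<rho>>0. \<forall>k. mollifier (cball 0 \<rho>) k \<longrightarrow> norm_L2 UNIV (\<lambda>x. conv k (G b) x - G b x) \<le> e'"
  proof
    fix b :: 'a assume b: "b \<in> Basis"
    show "\<exists>\<rho>>0. \<forall>k. mollifier (cball 0 \<rho>) k \<longrightarrow> norm_L2 UNIV (\<lambda>x. conv k (G b) x - G b x) \<le> e'"
      using mollify_L2[OF GL[OF b] G0 R1 e'(1)] by blast
  qed
  then obtain \<rho> where \<rho>: "\<And>b. b \<in> Basis \<Longrightarrow> 0 < \<rho> b"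
    "\<And>b k. b \<in> Basis \<Longrightarrow> mollifier (cball 0 (\<rho> b)) k \<Longrightarrow> norm_L2 UNIV (\<lambda>x. conv k (G b) x - G b x) \<le> e'"
    by metis
  \<comment> \<open>One kernel has to serve \<open>F\<close> and every component \<open>G b\<close>.
    The bound \<open>1/2\<close> keeps the sampled points within radius \<open>R + 1\<close>, hence
    in \<open>A\<close>.\<close>
  define \<delta> where "\<delta> = Min (insert (1/2) (insert \<rho>0 (\<rho> ` Basis)))"
  have \<delta>: "\<delta> \<le> 1/2" "\<delta> \<le> \<rho>0" "\<And>b. b \<in> Basis \<Longrightarrow> \<delta> \<le> \<rho> b"
    unfolding \<delta>_def by (intro Min_le; simp)+
  have \<delta>0: "0 < \<delta>"
    unfolding \<delta>_def using \<rho>0(1) \<rho>(1) by (subst Min_gr_iff) auto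
  obtain a r where ar: "0 < r" "cball a r \<subseteq> cball 0 \<delta>" "\<forall>x\<in>D \<inter> U. cball (x - a) r \<subseteq> D"
    using cone[OF \<delta>0] by blast
  obtain k where k: "mollifier (cball a r) k" using mollifier_exists[OF ar(1)] by blast
  then have ks: "smooth k" "\<And>z. z \<notin> cball a r \<Longrightarrow> k z = 0" by (auto simp: mollifier_def)
  have sm: "smooth (conv k F)" by (rule smooth_conv[OF Fi ks])
  have "norm_L2 (D \<inter> U) (\<lambda>x. conv k F x - f x) \<le> e"
  proof -
    have k0: "mollifier (cball 0 \<rho>0) k"
      by (rule mollifier_mono[OF k]) (use ar(2) \<delta>(2) in auto)
    have "norm_L2 (D \<inter> U) (\<lambda>x. conv k F x - f x) = norm_L2 (D \<inter> U) (\<lambda>x. conv k F x - F x)"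
      using A(3) by (intro norm_L2_cong T) (auto simp: F_def)
    also have "\<dots> \<le> norm_L2 UNIV (\<lambda>x. conv k F x - F x)"
      by (intro L2_subset(2) T L2_diff(1) conv_L2(1)[OF Fi FL k] FL) auto
    also note \<rho>0(2)[OF k0]
    finally show ?thesis using e' by simp
  qed
  moreover have "norm_L2 (D \<inter> U) (\<lambda>x. gradient (conv k F) x - g x) \<le> e"
  proof -
    have gL: "(\<lambda>x. gradient (conv k F) x - g x) \<in> L2 (D \<inter> U)"
      by (intro L2_diff(1) T L2_continuous_bounded_set continuous_on_gradient sm L2_subset(1)[OF S _ _ g])
        (use U in auto)
    have b: "norm_L2 (D \<inter> U) (\<lambda>x. (gradient (conv k F) x - g x) \<bullet> b) \<le> e'" if b: "b \<in> Basis" for b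
    proof -
      have kb: "mollifier (cball 0 (\<rho> b)) k"
        by (rule mollifier_mono[OF k]) (use ar(2) \<delta>(3)[OF b] in auto)
      have Gi: "integrable lebesgue (G b)" by (rule L2_bounded_support_integrable[OF GL[OF b] G0])
      have "norm_L2 (D \<inter> U) (\<lambda>x. (gradient (conv k F) x - g x) \<bullet> b)
          = norm_L2 (D \<inter> U) (\<lambda>x. conv k (G b) x - G b x)"
      proof (intro norm_L2_cong T)
        fix x assume x: "x \<in> D \<inter> U"
        have "cball (x - a) r \<subseteq> A"
        proof
          fix z assume z: "z \<in> cball (x - a) r"
          then have "x - z \<in> cball a r" by (simp add: dist_norm algebra_simps norm_minus_commute)
          with ar(2) have "norm (x - z) \<le> \<delta>" by auto
          moreover have "norm x < R" using x R by auto
          moreover have "norm z \<le> norm x + norm (x - z)" by (metis norm_minus_commute norm_triangle_sub)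
          moreover have "z \<in> D" using ar(3) x z by blast
          ultimately show "z \<in> A" using z x ar(3) \<delta>(1) by (auto simp: A_def)
        qed
        from gradient_conv_weak[OF D f g wg A(2) ks Fi[unfolded F_def] this, of b]
        show "(gradient (conv k F) x - g x) \<bullet> b = conv k (G b) x - G b x"
          using x A(3) by (auto simp: F_def[abs_def] G_def[abs_def] inner_diff_left)
      qed
      also have "\<dots> \<le> norm_L2 UNIV (\<lambda>x. conv k (G b) x - G b x)"
        by (intro L2_subset(2) T L2_diff(1) conv_L2(1)[OF Gi GL[OF b] k] GL b) auto
      also note \<rho>(2)[OF b kb]
      finally show ?thesis .
    qed
    have "norm_L2 (D \<inter> U) (\<lambda>x. gradient (conv k F) x - g x) \<le> (\<Sum>b\<in>(Basis::'a set). e')"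
      by (rule order_trans[OF norm_L2_le_sum_Basis[OF T(1) gL] sum_mono[OF b]])
    then show ?thesis using e'(3) by (simp add: n_def)
  qed
  ultimately show ?thesis using sm by blast
qed

text \<open>A Lipschitz gradient grows at most linearly, so on the ball it is bounded by its norm at
  the centre plus \<open>L\<close> times the radius; the mean value inequality turns this into a
  Lipschitz bound for \<gamma>.\<close>

lemma C11_lipschitz_bounded:
  fixes \<gamma> :: "'a::euclidean_space \<Rightarrow> real"
  assumes "C11 \<gamma>"
  obtains M where "0 \<le> M" "\<And>x y. x \<in> cball p r \<Longrightarrow> y \<in> cball p r \<Longrightarrow> \<bar>\<gamma> x - \<gamma> y\<bar> \<le> M * norm (x - y)"
proof -
  obtain g L where g: "\<And>x. GDERIV \<gamma> x :> g x" and L: "L-lipschitz_on UNIV g"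
    using assms unfolding C11_def by blast
  define M where "M = norm (g p) + L * \<bar>r\<bar>"
  have L0: "0 \<le> L" using L by (rule lipschitz_on_nonneg)
  have M: "norm (g x) \<le> M" if "x \<in> cball p r" for x
  proof -
    have "dist (g p) (g x) \<le> L * dist p x" using lipschitz_onD[OF L] by simp
    also have "\<dots> \<le> L * \<bar>r\<bar>" using that L0 by (intro mult_left_mono) auto
    finally show ?thesis
      unfolding M_def using norm_triangle_sub[of "g x" "g p"] by (simp add: dist_norm norm_minus_commute)
  qed
  show ?thesis
  proof (rule that[of M])
    show "0 \<le> M" using L0 by (simp add: M_def)
    fix x y assume xy: "x \<in> cball p r" "y \<in> cball p r"
    have "norm (\<gamma> x - \<gamma> y) \<le> M * norm (x - y)"
    proof (rule differentiable_bound[of "cball p r" \<gamma> "\<lambda>z h. h \<bullet> g z"])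
      show "(\<gamma> has_derivative (\<lambda>h. h \<bullet> g z)) (at z within cball p r)" if "z \<in> cball p r" for z
        using g[of z] unfolding gderiv_def by (rule has_derivative_at_withinI)
      show "onorm (\<lambda>h. h \<bullet> g z) \<le> M" if "z \<in> cball p r" for z
      proof (rule onorm_le)
        fix h
        have "norm (h \<bullet> g z) \<le> norm h * norm (g z)" by (simp add: Cauchy_Schwarz_ineq2)
        also have "\<dots> \<le> norm h * M" using M[OF that] by (intro mult_left_mono) auto
        finally show "norm (h \<bullet> g z) \<le> M * norm h" by (simp add: mult.commute)
      qed
    qed (use xy in auto)
    then show "\<bar>\<gamma> x - \<gamma> y\<bar> \<le> M * norm (x - y)" by simp
  qed
qed

text \<open>Near a boundary point the shift goes in the graph direction \<open>e\<close>: its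
  vertical gain has to exceed what a Lipschitz graph can rise under the horizontal displacement. At
  an interior point small balls stay in \<open>D\<close> anyway, and away from the closure there is
  no point to shift. The radius \<open>r\<close> is fixed before \<delta>; only the shifts
  shrink.\<close>

lemma interior_cone:
  fixes D :: "'a::euclidean_space set"
  assumes D: "open D" and bd: "locally_C11_boundary D"
  obtains r where "0 < r" "\<And>\<delta>. 0 < \<delta> \<Longrightarrow>
    \<exists>a s. 0 < s \<and> cball a s \<subseteq> cball 0 \<delta> \<and> (\<forall>x\<in>D \<inter> ball x0 r. cball (x - a) s \<subseteq> D)"
proof -
  consider "x0 \<in> D" | "x0 \<notin> closure D" | "x0 \<in> frontier D"
    using D by (auto simp: frontier_def interior_open)
  then show ?thesis
  proof cases
    case 1
    then obtain r' where r': "0 < r'" "ball x0 r' \<subseteq> D"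
      using D open_contains_ball by blast
    show ?thesis
    proof (rule that[of "r' / 2"])
      fix \<delta> :: real assume "0 < \<delta>"
      have "cball (x - 0) (min \<delta> (r' / 3)) \<subseteq> D" if x: "x \<in> D \<inter> ball x0 (r' / 2)" for x
      proof
        fix z assume "z \<in> cball (x - 0) (min \<delta> (r' / 3))"
        then have "dist x0 z < r'"
          using x dist_triangle[of x0 z x] r'(1) by auto
        then show "z \<in> D" using r'(2) by auto
      qed
      then show "\<exists>a s. 0 < s \<and> cball a s \<subseteq> cball 0 \<delta> \<and> (\<forall>x\<in>D \<inter> ball x0 (r' / 2). cball (x - a) s \<subseteq> D)"
        using \<open>0 < \<delta>\<close> r'(1) by (intro exI[of _ 0] exI[of _ "min \<delta> (r' / 3)"]) auto
    qed (use r' in auto)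
  next
    case 2
    then obtain r where r: "0 < r" "ball x0 r \<subseteq> - closure D"
      using open_contains_ball[of "- closure D"] by auto
    then have "D \<inter> ball x0 r = {}" using closure_subset by fastforce
    show ?thesis
    proof (rule that[OF r(1)])
      fix \<delta> :: real assume "0 < \<delta>"
      then show "\<exists>a s. 0 < s \<and> cball a s \<subseteq> cball 0 \<delta> \<and> (\<forall>x\<in>D \<inter> ball x0 r. cball (x - a) s \<subseteq> D)"
        using \<open>D \<inter> ball x0 r = {}\<close> by (intro exI[of _ 0] exI[of _ \<delta>]) auto
    qed
  next
    case 3
    then obtain r e \<gamma> where r: "0 < r" and e: "norm e = 1" and \<gamma>: "C11 \<gamma>"
      and Deq: "D \<inter> ball x0 r = {x \<in> ball x0 r. \<gamma> (x - (x \<bullet> e) *\<^sub>R e) < x \<bullet> e}"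
      using bd unfolding locally_C11_boundary_def by blast
    define P where "P x = x - (x \<bullet> e) *\<^sub>R e" for x
    have Pd: "P x - P y = P (x - y)" for x y by (simp add: P_def inner_diff_left scaleR_diff_left)
    have ee: "e \<bullet> e = 1" using e by (simp add: dot_square_norm)
    have Pn: "norm (P x) \<le> norm x" for x
    proof -
      have "(norm (P x))\<^sup>2 = (norm x)\<^sup>2 - (x \<bullet> e)\<^sup>2"
        unfolding power2_norm_eq_inner P_def
        by (simp add: inner_diff_left inner_diff_right ee inner_commute power2_eq_square)
      also have "\<dots> \<le> (norm x)\<^sup>2" by simp
      finally show ?thesis by (rule power2_le_imp_le) simp
    qed
    have Pe: "P (t *\<^sub>R e + v) = P v" for t v
      by (simp add: P_def inner_add_left ee algebra_simps)
    obtain M where M: "0 \<le> M" "\<And>x y. x \<in> cball (P x0) r \<Longrightarrow> y \<in> cball (P x0) r \<Longrightarrow> \<bar>\<gamma> x - \<gamma> y\<bar> \<le> M * norm (x - y)"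
      using C11_lipschitz_bounded[OF \<gamma>] by blast
    \<comment> \<open>A shift upwards by \<tau> with an error of at most \<open>c * \<tau>\<close>
      gains at least \<open>\<tau> - c * \<tau>\<close> in height, while the graph rises by at most
      \<open>M * (c * \<tau>)\<close>. For this \<open>c\<close> the two coincide, and the strict
      inequality is inherited from the point \<open>x\<close> of \<open>D\<close>.\<close>
    define c where "c = 1 / (1 + M)"
    have c: "0 < c" "c \<le> 1" "M * c = 1 - c" using M(1) by (auto simp: c_def field_simps)
    show ?thesis
    proof (rule that[of "r / 2"])
      fix \<delta> :: real assume \<delta>: "0 < \<delta>"
      \<comment> \<open>\<open>2 * \<tau> \<le> \<delta>\<close> limits the size of the shifts;
        \<open>2 * \<tau> < r / 2\<close> keeps points that start in the half ball inside the ball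
        where the graph describes \<open>D\<close>.\<close>
      define \<tau> where "\<tau> = min \<delta> (r / 3) / 2"
      have \<tau>: "0 < \<tau>" "2 * \<tau> \<le> \<delta>" "2 * \<tau> < r / 2" using \<delta> r by (auto simp: \<tau>_def)
      have c\<tau>: "0 < c * \<tau>" "c * \<tau> \<le> \<tau>" using c \<tau>(1) by auto
      \<comment> \<open>The centre carries a minus sign because a kernel supported around
        \<open>a\<close> samples around \<open>x - a\<close>, which has to be the point
        \<open>x\<close> moved upwards.\<close>
      have "cball (- (\<tau> *\<^sub>R e)) (c * \<tau>) \<subseteq> cball 0 \<delta>"
      proof
        fix z assume "z \<in> cball (- (\<tau> *\<^sub>R e)) (c * \<tau>)"
        then have "norm (z + \<tau> *\<^sub>R e) \<le> \<tau>" using c\<tau> by (simp add: dist_norm norm_minus_commute add.commute)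
        moreover have "norm z \<le> norm (z + \<tau> *\<^sub>R e) + norm (\<tau> *\<^sub>R e)"
          by (metis add_diff_cancel_right' norm_triangle_ineq4)
        ultimately show "z \<in> cball 0 \<delta>" using \<tau> e by simp
      qed
      moreover have "cball (x - (- (\<tau> *\<^sub>R e))) (c * \<tau>) \<subseteq> D" if x: "x \<in> D \<inter> ball x0 (r / 2)" for x
      proof
        fix z assume z: "z \<in> cball (x - (- (\<tau> *\<^sub>R e))) (c * \<tau>)"
        define v where "v = z - x - \<tau> *\<^sub>R e"
        have v: "norm v \<le> c * \<tau>" using z by (simp add: v_def dist_norm norm_minus_commute algebra_simps)
        have zx: "z - x = \<tau> *\<^sub>R e + v" by (simp add: v_def)
        have "norm (z - x) \<le> 2 * \<tau>"
        proof -
          have "norm (\<tau> *\<^sub>R e) = \<tau>" using e \<tau>(1) by simp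
          then show ?thesis
            unfolding zx using norm_triangle_ineq[of "\<tau> *\<^sub>R e" v] v c\<tau>(2) by linarith
        qed
        then have zr: "z \<in> ball x0 r"
          using x \<tau>(3) dist_triangle[of x0 z x] by (auto simp: dist_norm norm_minus_commute)
        have xr: "x \<in> ball x0 r" using x r by auto
        have Pball: "P y \<in> cball (P x0) r" if "y \<in> ball x0 r" for y
          using that Pn[of "x0 - y"] by (simp add: dist_norm Pd)
        have "\<gamma> (P z) \<le> \<gamma> (P x) + M * norm (P z - P x)"
          using M(2)[OF Pball[OF zr] Pball[OF xr]] by simp
        also have "norm (P z - P x) \<le> c * \<tau>"
          unfolding Pd zx Pe using Pn[of v] v by simp
        finally have "\<gamma> (P z) \<le> \<gamma> (P x) + M * (c * \<tau>)"
          using M(1) by (simp add: mult_left_mono)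
        moreover have "\<gamma> (P x) < x \<bullet> e"
        proof -
          have "x \<in> D \<inter> ball x0 r" using x xr by blast
          then show ?thesis unfolding Deq P_def by blast
        qed
        moreover have "M * (c * \<tau>) = \<tau> - c * \<tau>"
        proof -
          have "M * (c * \<tau>) = (M * c) * \<tau>" by (rule mult.assoc[symmetric])
          then show ?thesis unfolding c(3) by (simp add: left_diff_distrib)
        qed
        moreover have "z \<bullet> e = x \<bullet> e + \<tau> + v \<bullet> e"
          by (simp add: v_def inner_diff_left ee)
        moreover have "\<bar>v \<bullet> e\<bar> \<le> c * \<tau>"
          using Cauchy_Schwarz_ineq2[of v e] v e by simp
        ultimately have "\<gamma> (P z) < z \<bullet> e" by linarith
        with zr have "z \<in> D \<inter> ball x0 r" unfolding Deq P_def by blast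
        then show "z \<in> D" by blast
      qed
      ultimately show "\<exists>a s. 0 < s \<and> cball a s \<subseteq> cball 0 \<delta> \<and> (\<forall>x\<in>D \<inter> ball x0 (r / 2). cball (x - a) s \<subseteq> D)"
        using c\<tau> by (intro exI[of _ "- (\<tau> *\<^sub>R e)"] exI[of _ "c * \<tau>"]) auto
    qed (use r in auto)
  qed
qed

section \<open>Gluing local approximations\<close>

lemma L2_smooth_minus:
  fixes f :: "'a::euclidean_space \<Rightarrow> real"
  assumes D: "D \<in> sets lebesgue" and S: "S \<in> sets lebesgue" "S \<subseteq> D" "bounded S" and \<Phi>: "smooth \<Phi>" and f: "f \<in> L2 D"
  shows "(\<lambda>x. \<Phi> x - f x) \<in> L2 S"
  by (rule L2_diff(1)[OF S(1) L2_continuous_bounded_set[OF S(1,3) smooth_continuous_on[OF \<Phi>]] L2_subset(1)[OF D S(1,2) f]])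

lemma L2_gradient_minus:
  fixes g :: "'a::euclidean_space \<Rightarrow> 'a"
  assumes D: "D \<in> sets lebesgue" and S: "S \<in> sets lebesgue" "S \<subseteq> D" "bounded S" and \<Phi>: "smooth \<Phi>" and g: "g \<in> L2 D"
  shows "(\<lambda>x. gradient \<Phi> x - g x) \<in> L2 S"
  by (rule L2_diff(1)[OF S(1) L2_continuous_bounded_set[OF S(1,3) continuous_on_gradient[OF \<Phi>]] L2_subset(1)[OF D S(1,2) g]])

text \<open>The same \<Phi> has to serve both conditions. The field \<open>g\<close> is a separate
  argument, so that approximations can be glued without any reference to weak gradients.\<close>

definition smoothly_approximable ::
    "'a::euclidean_space set \<Rightarrow> ('a \<Rightarrow> real) \<Rightarrow> ('a \<Rightarrow> 'a) \<Rightarrow> bool" where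
  "smoothly_approximable S f g \<longleftrightarrow>
     (\<forall>e>0. \<exists>\<Phi>. smooth \<Phi> \<and> norm_L2 S (\<lambda>x. \<Phi> x - f x) \<le> e \<and> norm_L2 S (\<lambda>x. gradient \<Phi> x - g x) \<le> e)"

text \<open>In the gradient of \<open>\<psi> \<Phi>1 + (1 - \<psi>) \<Phi>2\<close> the derivative
  of \<psi> multiplies \<open>\<Phi>1 - \<Phi>2 = (\<Phi>1 - f) - (\<Phi>2 - f)\<close>, which is
  small where both approximations are good. The ball loses half of its radius because \<psi> has to
  equal 1 on whatever lies outside \<open>U\<close>.\<close>

lemma smoothly_approximable_union:
  fixes f :: "'a::euclidean_space \<Rightarrow> real"
  assumes D: "open D" and f: "f \<in> L2 D" and g: "g \<in> L2 D" and U: "open U" "bounded U" and r: "0 < r"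
    and aU: "smoothly_approximable (D \<inter> U) f g" and aB: "smoothly_approximable (D \<inter> ball x r) f g"
  shows "smoothly_approximable (D \<inter> (U \<union> ball x (r / 2))) f g"
  unfolding smoothly_approximable_def
proof (intro allI impI)
  fix e :: real assume e: "0 < e"
  define S where "S = D \<inter> (U \<union> ball x (r / 2))"
  have DL: "D \<in> sets lebesgue" using D by auto
  have SL: "S \<in> sets lebesgue" "bounded S" "S \<subseteq> D" using D U by (auto simp: S_def)
  obtain \<psi> :: "'a \<Rightarrow> real" where \<psi>: "smooth \<psi>" "\<And>y. 0 \<le> \<psi> y" "\<And>y. \<psi> y \<le> 1"
    "\<And>y. dist x y \<le> r / 2 \<Longrightarrow> \<psi> y = 1" "\<And>y. 3 * r / 4 \<le> dist x y \<Longrightarrow> \<psi> y = 0"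
    using bump_exists[of "r / 2" "3 * r / 4" x] r by auto
  have g0: "gradient \<psi> y = 0" if "y \<notin> ball x r" for y
    by (rule gradient_eq_0[of x "3 * r / 4"]) (use that r \<psi>(5) in auto)
  \<comment> \<open>Points of the union outside \<open>U\<close> lie in the half ball, where \<psi>
    is constantly 1. So \<open>1 - \<psi>\<close> and the gradient of \<psi>, the factors of the
    terms with \<Phi>2, vanish there.\<close>
  have g1: "gradient \<psi> y = 0" if "y \<in> ball x (r / 2)" for y
    by (rule gradient_eq_0_open[OF open_ball that, of _ 1]) (use \<psi>(4) in auto)
  obtain C where C: "0 \<le> C" "\<And>y. norm (gradient \<psi> y) \<le> C"
    using continuous_compact_support_bounded[OF continuous_on_gradient[OF \<psi>(1)], of x r] g0
    by (metis subsetD ball_subset_cball)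
  \<comment> \<open>Two error terms of size \<open>e'\<close> and two of size \<open>C * e'\<close>
    have to add up to \<open>e\<close>.\<close>
  define e' where "e' = e / (2 + 2 * C)"
  have e': "0 < e'" "2 * e' + 2 * (C * e') = e" "0 \<le> C * e'"
  proof -
    have pos: "0 < 2 + 2 * C" using C(1) by simp
    then show "0 < e'" using e by (simp add: e'_def)
    then show "0 \<le> C * e'" using C(1) by simp
    have "(2 + 2 * C) * e' = e" using pos by (simp add: e'_def)
    then show "2 * e' + 2 * (C * e') = e" by (simp add: algebra_simps)
  qed
  then have e'2: "e' + e' \<le> e" by linarith
  obtain \<Phi>1 where \<Phi>1: "smooth \<Phi>1" "norm_L2 (D \<inter> ball x r) (\<lambda>y. \<Phi>1 y - f y) \<le> e'"
    "norm_L2 (D \<inter> ball x r) (\<lambda>y. gradient \<Phi>1 y - g y) \<le> e'"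
    using aB e'(1) unfolding smoothly_approximable_def by blast
  obtain \<Phi>2 where \<Phi>2: "smooth \<Phi>2" "norm_L2 (D \<inter> U) (\<lambda>y. \<Phi>2 y - f y) \<le> e'"
    "norm_L2 (D \<inter> U) (\<lambda>y. gradient \<Phi>2 y - g y) \<le> e'"
    using aU e'(1) unfolding smoothly_approximable_def by blast
  define \<Phi> where "\<Phi> y = \<psi> y * \<Phi>1 y + (1 - \<psi> y) * \<Phi>2 y" for y
  have s1: "smooth (\<lambda>y. 1 - \<psi> y)" by (intro smooth_diff smooth_const \<psi>)
  have sm: "smooth \<Phi>" unfolding \<Phi>_def by (intro smooth_add smooth_mult \<psi> \<Phi>1 \<Phi>2 s1)
  have \<psi>m: "\<psi> \<in> borel_measurable (lebesgue_on T)" "(\<lambda>y. 1 - \<psi> y) \<in> borel_measurable (lebesgue_on T)"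
    "gradient \<psi> \<in> borel_measurable (lebesgue_on T)" if "T \<in> sets lebesgue" for T
    using borel_measurable_lebesgue_on_continuous[OF that] smooth_continuous_on[OF \<psi>(1)]
      smooth_continuous_on[OF s1] continuous_on_gradient[OF \<psi>(1)] by auto
  have fS: "(\<lambda>y. \<Phi>' y - f y) \<in> L2 S" "(\<lambda>y. gradient \<Phi>' y - g y) \<in> L2 S" if "smooth \<Phi>'" for \<Phi>'
    using L2_smooth_minus[OF DL SL(1,3,2) that f] L2_gradient_minus[OF DL SL(1,3,2) that g] by auto
  have fT: "v \<in> L2 T" if "v \<in> L2 S" "T \<subseteq> S" "T \<in> sets lebesgue" for v :: "'a \<Rightarrow> real" and T
    using L2_subset(1)[OF SL(1) that(3,2,1)] .
  define T1 where "T1 = S \<inter> ball x r"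
  define T2 where "T2 = D \<inter> U"
  have T1: "T1 \<in> sets lebesgue" "T1 \<subseteq> S" "T1 \<subseteq> D \<inter> ball x r" "D \<inter> ball x r \<in> sets lebesgue"
    using SL DL by (auto simp: T1_def)
  have T2: "T2 \<in> sets lebesgue" "T2 \<subseteq> S" "S - T2 \<subseteq> ball x (r / 2)"
    using DL U by (auto simp: T2_def S_def)
  text \<open>A function that is damped by \<open>\<psi>\<close> or \<open>1 - \<psi>\<close> (or \<open>\<nabla>\<psi>\<close>) only sees the set where the
    corresponding approximation is good.\<close>
  have bound1: "(\<lambda>y. \<psi> y *\<^sub>R v y) \<in> L2 S \<and> norm_L2 S (\<lambda>y. \<psi> y *\<^sub>R v y) \<le> e'"
    if v: "v \<in> L2 S" "v \<in> L2 (D \<inter> ball x r)" "norm_L2 (D \<inter> ball x r) v \<le> e'" for v :: "'a \<Rightarrow> 'b::euclidean_space"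
  proof -
    have vT: "v \<in> L2 T1" by (rule L2_subset(1)[OF SL(1) T1(1,2) v(1)])
    note b = L2_bounded_scaleR[OF T1(1) vT \<psi>m(1)[OF T1(1)], of 1]
    have 1: "(\<lambda>y. \<psi> y *\<^sub>R v y) \<in> L2 T1" "norm_L2 T1 (\<lambda>y. \<psi> y *\<^sub>R v y) \<le> norm_L2 T1 v"
      using b \<psi>(2,3) by auto
    have z: "\<psi> y *\<^sub>R v y = 0" if "y \<in> S" "y \<notin> T1" for y
      using that \<psi>(5)[of y] r by (auto simp: T1_def)
    have "norm_L2 T1 v \<le> e'"
      using L2_subset(2)[OF T1(4,1,3) v(2)] v(3) by simp
    then show ?thesis
      using 1 L2_extend[OF SL(1) T1(1,2) 1(1) z] by auto
  qed
  have bound2: "(\<lambda>y. (1 - \<psi> y) *\<^sub>R v y) \<in> L2 S \<and> norm_L2 S (\<lambda>y. (1 - \<psi> y) *\<^sub>R v y) \<le> e'"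
    if v: "v \<in> L2 S" "norm_L2 (D \<inter> U) v \<le> e'" for v :: "'a \<Rightarrow> 'b::euclidean_space"
  proof -
    have vT: "v \<in> L2 T2" by (rule L2_subset(1)[OF SL(1) T2(1,2) v(1)])
    note b = L2_bounded_scaleR[OF T2(1) vT \<psi>m(2)[OF T2(1)], of 1]
    have 1: "(\<lambda>y. (1 - \<psi> y) *\<^sub>R v y) \<in> L2 T2" "norm_L2 T2 (\<lambda>y. (1 - \<psi> y) *\<^sub>R v y) \<le> norm_L2 T2 v"
      using b \<psi>(2,3) by auto
    have z: "(1 - \<psi> y) *\<^sub>R v y = 0" if "y \<in> S" "y \<notin> T2" for y
      using that \<psi>(4)[of y] T2(3) by force
    show ?thesis
      using 1 v(2) L2_extend[OF SL(1) T2(1,2) 1(1) z] by (auto simp: T2_def)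
  qed
  have bound3: "(\<lambda>y. v y *\<^sub>R gradient \<psi> y) \<in> L2 S \<and> norm_L2 S (\<lambda>y. v y *\<^sub>R gradient \<psi> y) \<le> C * e'"
    if T: "T \<in> sets lebesgue" "T \<subseteq> S" and v: "v \<in> L2 S" "norm_L2 T v \<le> e'"
      and z: "\<And>y. y \<in> S \<Longrightarrow> y \<notin> T \<Longrightarrow> gradient \<psi> y = 0" for v :: "'a \<Rightarrow> real" and T
  proof -
    have vT: "v \<in> L2 T" by (rule L2_subset(1)[OF SL(1) T v(1)])
    note 1 = L2_scaleR_vector[OF T(1) vT \<psi>m(3)[OF T(1)] C(2,1)]
    have "norm_L2 T (\<lambda>y. v y *\<^sub>R gradient \<psi> y) \<le> C * e'"
      using 1(2) v(2) C(1) by (meson mult_left_mono order_trans)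
    then show ?thesis
      using L2_extend[OF SL(1) T 1(1)] z by auto
  qed
  have BL: "(\<lambda>y. \<Phi>1 y - f y) \<in> L2 (D \<inter> ball x r)" "(\<lambda>y. gradient \<Phi>1 y - g y) \<in> L2 (D \<inter> ball x r)"
    using L2_smooth_minus[OF DL T1(4) _ _ \<Phi>1(1) f] L2_gradient_minus[OF DL T1(4) _ _ \<Phi>1(1) g] by auto
  have n1: "norm_L2 T1 (\<lambda>y. \<Phi>1 y - f y) \<le> e'"
    using L2_subset(2)[OF T1(4,1,3) BL(1)] \<Phi>1(2) by simp
  have p1: "(\<lambda>y. \<psi> y *\<^sub>R (\<Phi>1 y - f y)) \<in> L2 S" "norm_L2 S (\<lambda>y. \<psi> y *\<^sub>R (\<Phi>1 y - f y)) \<le> e'"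
    using bound1[OF fS(1)[OF \<Phi>1(1)] BL(1) \<Phi>1(2)] by auto
  have p2: "(\<lambda>y. (1 - \<psi> y) *\<^sub>R (\<Phi>2 y - f y)) \<in> L2 S" "norm_L2 S (\<lambda>y. (1 - \<psi> y) *\<^sub>R (\<Phi>2 y - f y)) \<le> e'"
    using bound2[OF fS(1)[OF \<Phi>2(1)] \<Phi>2(2)] by auto
  have p3: "(\<lambda>y. \<psi> y *\<^sub>R (gradient \<Phi>1 y - g y)) \<in> L2 S" "norm_L2 S (\<lambda>y. \<psi> y *\<^sub>R (gradient \<Phi>1 y - g y)) \<le> e'"
    using bound1[OF fS(2)[OF \<Phi>1(1)] BL(2) \<Phi>1(3)] by auto
  have p4: "(\<lambda>y. (1 - \<psi> y) *\<^sub>R (gradient \<Phi>2 y - g y)) \<in> L2 S" "norm_L2 S (\<lambda>y. (1 - \<psi> y) *\<^sub>R (gradient \<Phi>2 y - g y)) \<le> e'"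
    using bound2[OF fS(2)[OF \<Phi>2(1)] \<Phi>2(3)] by auto
  have p5: "(\<lambda>y. (\<Phi>1 y - f y) *\<^sub>R gradient \<psi> y) \<in> L2 S" "norm_L2 S (\<lambda>y. (\<Phi>1 y - f y) *\<^sub>R gradient \<psi> y) \<le> C * e'"
    using bound3[OF T1(1,2) fS(1)[OF \<Phi>1(1)] n1] g0 by (auto simp: T1_def)
  have p6: "(\<lambda>y. (\<Phi>2 y - f y) *\<^sub>R gradient \<psi> y) \<in> L2 S" "norm_L2 S (\<lambda>y. (\<Phi>2 y - f y) *\<^sub>R gradient \<psi> y) \<le> C * e'"
    using bound3[OF T2(1,2) fS(1)[OF \<Phi>2(1)] \<Phi>2(2)[folded T2_def]] g1 T2(3) by blast+
  have "norm_L2 S (\<lambda>y. \<Phi> y - f y) \<le> e"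
  proof -
    have "(\<lambda>y. \<Phi> y - f y) = (\<lambda>y. \<psi> y *\<^sub>R (\<Phi>1 y - f y) + (1 - \<psi> y) *\<^sub>R (\<Phi>2 y - f y))"
      by (simp add: \<Phi>_def fun_eq_iff algebra_simps)
    then show ?thesis
      using L2_add(2)[OF SL(1) p1(1) p2(1)] p1(2) p2(2) e'2 by simp
  qed
  moreover have "norm_L2 S (\<lambda>y. gradient \<Phi> y - g y) \<le> e"
  proof -
    have grad: "gradient \<Phi> y = \<psi> y *\<^sub>R gradient \<Phi>1 y + \<Phi>1 y *\<^sub>R gradient \<psi> y
        + ((1 - \<psi> y) *\<^sub>R gradient \<Phi>2 y - \<Phi>2 y *\<^sub>R gradient \<psi> y)" for y
    proof -
      have "gradient (\<lambda>y. 1 - \<psi> y) y = - gradient \<psi> y"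
        using gradient_diff[OF smooth_const[of 1] \<psi>(1), of y] gradient_eqI[OF GDERIV_const, of 1 y] by simp
      then show ?thesis
        unfolding \<Phi>_def
        by (simp add: gradient_add[OF smooth_mult[OF \<psi>(1) \<Phi>1(1)] smooth_mult[OF s1 \<Phi>2(1)]]
            gradient_mult[OF \<psi>(1) \<Phi>1(1)] gradient_mult[OF s1 \<Phi>2(1)])
    qed
    have "(\<lambda>y. gradient \<Phi> y - g y) = (\<lambda>y. (\<psi> y *\<^sub>R (gradient \<Phi>1 y - g y) + (1 - \<psi> y) *\<^sub>R (gradient \<Phi>2 y - g y))
        + ((\<Phi>1 y - f y) *\<^sub>R gradient \<psi> y - (\<Phi>2 y - f y) *\<^sub>R gradient \<psi> y))"
      by (simp add: grad fun_eq_iff algebra_simps)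
    then show ?thesis
      using L2_add[OF SL(1) L2_add(1)[OF SL(1) p3(1) p4(1)] L2_diff(1)[OF SL(1) p5(1) p6(1)]]
        L2_add(2)[OF SL(1) p3(1) p4(1)] L2_diff(2)[OF SL(1) p5(1) p6(1)] p3(2) p4(2) p5(2) p6(2) e'(2)
      by simp
  qed
  ultimately show "\<exists>\<Phi>. smooth \<Phi> \<and> norm_L2 (D \<inter> (U \<union> ball x (r / 2))) (\<lambda>y. \<Phi> y - f y) \<le> e
      \<and> norm_L2 (D \<inter> (U \<union> ball x (r / 2))) (\<lambda>y. gradient \<Phi> y - g y) \<le> e"
    using sm unfolding S_def by blast
qed

text \<open>Every point has a ball on which approximation is possible; by compactness finitely many
  of the balls with half the radius cover \<open>cball 0 R\<close>. They are glued one at a time,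
  and the half radii in the covering absorb the shrinking caused by the gluing.\<close>

lemma smooth_dense_H1:
  fixes D :: "'a::euclidean_space set"
  assumes D: "open D" and bd: "locally_C11_boundary D"
    and f: "f \<in> L2 D" and g: "g \<in> L2 D" and wg: "weak_gradient D f g"
  shows "smoothly_approximable (D \<inter> ball 0 R) f g"
proof -
  have DL: "D \<in> sets lebesgue" using D by auto
  have "\<exists>r>0. smoothly_approximable (D \<inter> ball x r) f g" for x
  proof -
    obtain r where r: "0 < r" "\<And>\<delta>. 0 < \<delta> \<Longrightarrow>
      \<exists>a s. 0 < s \<and> cball a s \<subseteq> cball 0 \<delta> \<and> (\<forall>x\<in>D \<inter> ball x r. cball (x - a) s \<subseteq> D)"
      using interior_cone[OF D bd, of x] by blast
    have "smoothly_approximable (D \<inter> ball x r) f g"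
      unfolding smoothly_approximable_def
      using local_approximation[OF D f g wg open_ball bounded_ball r(2)] by blast
    with r(1) show ?thesis by blast
  qed
  then obtain r where r: "\<And>x. 0 < r x" "\<And>x. smoothly_approximable (D \<inter> ball x (r x)) f g"
    by metis
  have cov: "cball 0 R \<subseteq> (\<Union>x\<in>cball 0 R. ball x (r x / 2))"
    using r(1) by (auto intro!: bexI)
  obtain X where X: "X \<subseteq> cball 0 R" "finite X" "cball 0 R \<subseteq> (\<Union>x\<in>X. ball x (r x / 2))"
    by (rule compactE_image[OF compact_cball _ cov]) auto
  have "smoothly_approximable (D \<inter> (\<Union>x\<in>X. ball x (r x / 2))) f g"
    using X(2)
  proof (induction X)
    case empty
    show ?case unfolding smoothly_approximable_def
      by (auto simp: norm_L2_def set_lebesgue_integral_def intro!: exI[of _ "\<lambda>x. 0"])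
  next
    case (insert x X)
    have "smoothly_approximable (D \<inter> ((\<Union>x\<in>X. ball x (r x / 2)) \<union> ball x (r x / 2))) f g"
      using insert by (intro smoothly_approximable_union[OF D f g _ _ r(1) _ r(2)]) auto
    then show ?case by (simp add: Un_commute)
  qed
  moreover have "smoothly_approximable (D \<inter> ball 0 R) f g"
    if a: "smoothly_approximable (D \<inter> V) f g" and V: "open V" "bounded V" "ball 0 R \<subseteq> V" for V
    unfolding smoothly_approximable_def
  proof (intro allI impI)
    fix e :: real assume "0 < e"
    then obtain \<Phi> where \<Phi>: "smooth \<Phi>" "norm_L2 (D \<inter> V) (\<lambda>x. \<Phi> x - f x) \<le> e"
      "norm_L2 (D \<inter> V) (\<lambda>x. gradient \<Phi> x - g x) \<le> e"
      using a unfolding smoothly_approximable_def by blast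
    have L: "D \<inter> V \<in> sets lebesgue" "D \<inter> ball 0 R \<in> sets lebesgue" "D \<inter> ball 0 R \<subseteq> D \<inter> V" "bounded (D \<inter> V)"
      using D V by auto
    have L2s: "(\<lambda>x. \<Phi> x - f x) \<in> L2 (D \<inter> V)" "(\<lambda>x. gradient \<Phi> x - g x) \<in> L2 (D \<inter> V)"
      using L2_smooth_minus[OF DL L(1) _ _ \<Phi>(1) f] L2_gradient_minus[OF DL L(1) _ _ \<Phi>(1) g] L(4) by auto
    show "\<exists>\<Phi>. smooth \<Phi> \<and> norm_L2 (D \<inter> ball 0 R) (\<lambda>x. \<Phi> x - f x) \<le> e
        \<and> norm_L2 (D \<inter> ball 0 R) (\<lambda>x. gradient \<Phi> x - g x) \<le> e"
      using \<Phi> L2_subset(2)[OF L(1,2,3) L2s(1)] L2_subset(2)[OF L(1,2,3) L2s(2)] by (intro exI[of _ \<Phi>]) auto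
  qed
  moreover have "bounded (\<Union>x\<in>X. ball x (r x / 2))" using X(2) by auto
  ultimately show ?thesis
    using X(3) ball_subset_cball[of 0 R] by (meson open_UN open_ball order_trans)
qed

section \<open>Time averages of curves in a Bochner space\<close>

text \<open>Since Lebesgue measure is complete, \<open>v\<close> itself is measurable and not only
  some modification of it. Quantities built from \<open>wgrad\<close> along a curve are accessible
  only as almost everywhere limits, and their measurability in time is obtained this way.\<close>

lemma borel_measurable_AE_LIMSEQ:
  fixes v :: "'a::euclidean_space \<Rightarrow> real"
  assumes S: "S \<in> sets lebesgue" and u: "\<And>k. u k \<in> borel_measurable (lebesgue_on S)"
    and lim: "AE x in lebesgue_on S. (\<lambda>k. u k x) \<longlonglongrightarrow> v x"
  shows "v \<in> borel_measurable (lebesgue_on S)"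
proof -
  have m: "(\<lambda>x. indicator S x *\<^sub>R u k x) \<in> borel_measurable lebesgue" for k
    using u[of k] S by (subst borel_measurable_restrict_space_iff[symmetric]) auto
  have "AE x in lebesgue. x \<in> S \<longrightarrow> (\<lambda>k. u k x) \<longlonglongrightarrow> v x"
    using lim S by (simp add: AE_restrict_space_iff)
  then have "AE x in lebesgue. lim (\<lambda>k. indicator S x *\<^sub>R u k x) = indicator S x *\<^sub>R v x"
  proof eventually_elim
    case (elim x)
    show ?case
      using elim by (cases "x \<in> S") (auto simp: limI)
  qed
  then have "(\<lambda>x. indicator S x *\<^sub>R v x) \<in> borel_measurable lebesgue"
    by (rule borel_measurable_AE[rotated]) (intro borel_measurable_lim_metric m)
  then show ?thesis
    using S by (subst borel_measurable_restrict_space_iff) auto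
qed

text \<open>Completeness transfers measurability from \<open>g\<close> to \<open>f\<close>. It is
  applied to the integrand of the flux, about whose measurability in time nothing is known
  beforehand.\<close>

lemma integral_lebesgue_on_cong_AE:
  fixes f g :: "'a::euclidean_space \<Rightarrow> real"
  assumes S: "S \<in> sets lebesgue" and g: "g \<in> borel_measurable (lebesgue_on S)"
    and eq: "AE x in lebesgue_on S. f x = g x"
  shows "(LINT x|lebesgue_on S. f x) = (LINT x|lebesgue_on S. g x)"
proof (rule integral_cong_AE)
  show "f \<in> borel_measurable (lebesgue_on S)"
    by (rule borel_measurable_AE_LIMSEQ[OF S, of "\<lambda>k. g"]) (use g eq in auto)
qed (use g eq in auto)

text \<open>The values of \<open>s\<close> will be functions on \<open>D\<close>, and
  \<open>q\<close> an arbitrary real functional of them. As the range is finite, no measurable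
  structure on the value space is involved, and integrals in time become finite sums.\<close>

lemma integral_simple_compose:
  fixes s :: "'a::euclidean_space \<Rightarrow> 'b" and q :: "'b \<Rightarrow> real"
  assumes s: "simple_function lebesgue s" and I: "I \<in> lmeasurable"
  shows "integrable (lebesgue_on I) (\<lambda>t. q (s t))"
    and "(LINT t|lebesgue_on I. q (s t)) = (\<Sum>a\<in>range s. measure lebesgue (s -` {a} \<inter> I) * q a)"
proof -
  have fin: "finite (range s)" using s by (simp add: simple_function_def)
  have IS: "I \<in> sets lebesgue" using I by auto
  have A: "s -` {a} \<inter> I \<in> lmeasurable" for a
  proof (cases "a \<in> range s")
    case True
    then have "s -` {a} \<in> sets lebesgue" using s by (auto simp: simple_function_def)
    then have "I \<inter> s -` {a} \<in> lmeasurable" by (rule fmeasurable_Int_fmeasurable[OF I])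
    then show ?thesis by (simp add: Int_commute)
  next
    case False
    then have "s -` {a} \<inter> I = {}" by auto
    then show ?thesis by simp
  qed
  have int: "has_bochner_integral lebesgue (\<lambda>t. indicator (s -` {a} \<inter> I) t * q a) (measure lebesgue (s -` {a} \<inter> I) * q a)" for a
    using A[of a] by (intro has_bochner_integral_mult_left has_bochner_integral_real_indicator) (auto simp: fmeasurable_def)
  have eq: "(\<lambda>t. indicator I t *\<^sub>R q (s t)) = (\<lambda>t. \<Sum>a\<in>range s. indicator (s -` {a} \<inter> I) t * q a)"
  proof
    fix t
    have "(\<Sum>a\<in>range s. indicator (s -` {a} \<inter> I) t * q a) = (\<Sum>a\<in>range s. if a = s t then indicator I t * q a else 0)"
      by (intro sum.cong) (auto simp: indicator_def)
    then show "indicator I t *\<^sub>R q (s t) = (\<Sum>a\<in>range s. indicator (s -` {a} \<inter> I) t * q a)"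
      using fin by simp
  qed
  have "has_bochner_integral lebesgue (\<lambda>t. indicator I t *\<^sub>R q (s t)) (\<Sum>a\<in>range s. measure lebesgue (s -` {a} \<inter> I) * q a)"
    unfolding eq by (intro has_bochner_integral_sum int)
  then show "integrable (lebesgue_on I) (\<lambda>t. q (s t))"
    and "(LINT t|lebesgue_on I. q (s t)) = (\<Sum>a\<in>range s. measure lebesgue (s -` {a} \<inter> I) * q a)"
    using IS by (auto simp: integrable_restrict_space integral_restrict_space has_bochner_integral_iff)
qed

lemma bochner_L2_subset:
  assumes "bochner_L2 J X N f" "I \<subseteq> J" "I \<in> sets lebesgue"
  shows "bochner_L2 I X N f"
proof -
  have "AE t\<in>I in lebesgue. f t \<in> X"
    using assms unfolding bochner_L2_def by auto
  moreover have "set_integrable lebesgue I (\<lambda>t. (N (f t))\<^sup>2)"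
    using assms set_integrable_subset unfolding bochner_L2_def by blast
  moreover have "bochner_measurable I X N f"
  proof -
    obtain s where s: "\<forall>n::nat. simple_function lebesgue (s n) \<and> range (s n) \<subseteq> X"
      "AE t\<in>J in lebesgue. (\<lambda>n. N (\<lambda>x. s n t x - f t x)) \<longlonglongrightarrow> 0"
      using assms(1) unfolding bochner_L2_def bochner_measurable_def by blast
    from s(2) have "AE t\<in>I in lebesgue. (\<lambda>n. N (\<lambda>x. s n t x - f t x)) \<longlonglongrightarrow> 0"
      by eventually_elim (use assms(2) in auto)
    with s(1) show ?thesis unfolding bochner_measurable_def by blast
  qed
  ultimately show ?thesis unfolding bochner_L2_def by blast
qed

text \<open>The norm is measurable as the square root of its integrable square, and on a set of
  finite measure square integrability implies integrability.\<close>

lemma bochner_norm_integrable: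
  fixes f :: "real \<Rightarrow> 'a::euclidean_space \<Rightarrow> real"
  assumes I: "I \<in> lmeasurable" and f: "bochner_L2 I (H1 D) (norm_H1 D) f"
  shows "integrable (lebesgue_on I) (\<lambda>t. norm_H1 D (f t))"
proof -
  have IS: "I \<in> sets lebesgue" using I by auto
  have i: "integrable (lebesgue_on I) (\<lambda>t. (norm_H1 D (f t))\<^sup>2)"
    using f IS by (simp add: bochner_L2_def set_integrable_eq_restrict)
  have "(\<lambda>t. sqrt ((norm_H1 D (f t))\<^sup>2)) \<in> borel_measurable (lebesgue_on I)"
    by (rule measurable_compose[OF borel_measurable_integrable[OF i]])
       (intro borel_measurable_continuous_onI continuous_intros)
  then have m: "(\<lambda>t. norm_H1 D (f t)) \<in> borel_measurable (lebesgue_on I)" by simp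
  have "(\<lambda>t. norm_H1 D (f t)) \<in> L2 I"
    using m i by (simp add: L2_iff[OF IS])
  then have "integrable (lebesgue_on I) (\<lambda>t. norm_H1 D (f t) * 1)"
    using L2_bounded(1)[OF I, of "\<lambda>x. 1::real" 1] by (intro L2_mult(1)[OF IS]) auto
  then show ?thesis by simp
qed

text \<open>Truncating the approximating simple functions where their norm exceeds \<open>2 * norm_H1 D (f t) + 1\<close>
  gives a dominating function.\<close>

lemma bochner_simple_approximation:
  fixes f :: "real \<Rightarrow> 'a::euclidean_space \<Rightarrow> real"
  assumes D: "open D" and I: "I \<in> lmeasurable" and f: "bochner_L2 I (H1 D) (norm_H1 D) f"
  obtains s where "\<And>n::nat. simple_function lebesgue (s n)" "\<And>n t. s n t \<in> H1 D"
    "AE t in lebesgue_on I. (\<lambda>n. norm_H1 D (\<lambda>x. s n t x - f t x)) \<longlonglongrightarrow> 0"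
    "\<And>n. integrable (lebesgue_on I) (\<lambda>t. norm_H1 D (\<lambda>x. s n t x - f t x))"
    "(\<lambda>n. LINT t|lebesgue_on I. norm_H1 D (\<lambda>x. s n t x - f t x)) \<longlonglongrightarrow> 0"
proof -
  let ?N = "norm_H1 D"
  have IS: "I \<in> sets lebesgue" using I by auto
  obtain s0 where s0: "\<And>n::nat. simple_function lebesgue (s0 n)" "\<And>n. range (s0 n) \<subseteq> H1 D"
    and lim0: "AE t\<in>I in lebesgue. (\<lambda>n. ?N (\<lambda>x. s0 n t x - f t x)) \<longlonglongrightarrow> 0"
    using f unfolding bochner_L2_def bochner_measurable_def by blast
  have fH: "AE t in lebesgue_on I. f t \<in> H1 D"
    using f IS by (simp add: bochner_L2_def AE_restrict_space_iff)
  have fi: "integrable (lebesgue_on I) (\<lambda>t. ?N (f t))" by (rule bochner_norm_integrable[OF I f])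
  have lim1: "AE t in lebesgue_on I. (\<lambda>n. ?N (\<lambda>x. s0 n t x - f t x)) \<longlonglongrightarrow> 0"
    using lim0 IS by (simp add: AE_restrict_space_iff)
  define Nf where "Nf t = indicator I t *\<^sub>R ?N (f t)" for t
  have Nfm: "Nf \<in> borel_measurable lebesgue"
    unfolding Nf_def using fi IS by (subst borel_measurable_restrict_space_iff[symmetric]) auto
  define s where "s n t = (if ?N (s0 n t) \<le> 2 * Nf t + 1 then s0 n t else (\<lambda>x. 0))" for n t
  have s_simple: "simple_function lebesgue (s n)" for n
  proof -
    have "(\<lambda>t. ?N (s0 n t)) \<in> borel_measurable lebesgue"
      by (rule borel_measurable_simple_function[OF simple_function_compose1[OF s0(1)]])
    then have "{t \<in> space lebesgue. ?N (s0 n t) \<le> 2 * Nf t + 1} \<in> sets lebesgue"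
      using Nfm by measurable
    then have "simple_function lebesgue (\<lambda>t. if t \<in> {t. ?N (s0 n t) \<le> 2 * Nf t + 1} then s0 n t else (\<lambda>x. 0))"
      by (intro simple_function_If_set s0(1) simple_function_const) auto
    then show ?thesis by (simp add: s_def[abs_def])
  qed
  have sH: "s n t \<in> H1 D" for n t
    using s0(2)[of n] H1_zero[of D] by (auto simp: s_def)
  have pair_m: "(\<lambda>t. ?N (\<lambda>x. s n t x - s k t x)) \<in> borel_measurable (lebesgue_on I)" for n k
  proof -
    have "simple_function lebesgue (\<lambda>t. ?N (\<lambda>x. s n t x - s k t x))"
      by (rule simple_function_compose2[OF s_simple s_simple, where h = "\<lambda>a b. ?N (\<lambda>x. a x - b x)"])
    from borel_measurable_simple_function[OF this] show ?thesis
      by (rule measurable_restrict_space1)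
  qed
  have lim: "AE t in lebesgue_on I. (\<lambda>n. ?N (\<lambda>x. s n t x - f t x)) \<longlonglongrightarrow> 0"
    using lim1 fH AE_space
  proof eventually_elim
    case (elim t)
    then have Nft: "Nf t = ?N (f t)" by (simp add: Nf_def)
    have "\<forall>\<^sub>F n in sequentially. ?N (\<lambda>x. s0 n t x - f t x) < 1"
      using elim(1) by (rule order_tendstoD(2)) simp
    then have "\<forall>\<^sub>F n in sequentially. ?N (\<lambda>x. s0 n t x - f t x) = ?N (\<lambda>x. s n t x - f t x)"
    proof eventually_elim
      case (elim n)
      have "?N (s0 n t) \<le> ?N (\<lambda>x. s0 n t x - f t x) + ?N (f t)"
        using s0(2) \<open>f t \<in> H1 D\<close> by (intro norm_H1_triangle' D) auto
      with elim have "?N (s0 n t) \<le> 2 * Nf t + 1"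
        unfolding Nft using norm_H1_nonneg[of D "f t"] by linarith
      then show ?case by (simp add: s_def)
    qed
    then show ?case using elim(1) by (rule Lim_transform_eventually[rotated])
  qed
  \<comment> \<open>\<open>s k\<close> approximates \<open>f\<close>, so this norm is the limit in
    \<open>k\<close> of the norms of \<open>s n - s k\<close>, which are simple functions of
    time.\<close>
  have m: "(\<lambda>t. ?N (\<lambda>x. s n t x - f t x)) \<in> borel_measurable (lebesgue_on I)" for n
  proof (rule borel_measurable_AE_LIMSEQ[OF IS pair_m[of n]])
    show "AE t in lebesgue_on I. (\<lambda>k. ?N (\<lambda>x. s n t x - s k t x)) \<longlonglongrightarrow> ?N (\<lambda>x. s n t x - f t x)"
      using lim fH
    proof eventually_elim
      case (elim t)
      have le: "\<bar>?N (\<lambda>x. s n t x - s k t x) - ?N (\<lambda>x. s n t x - f t x)\<bar> \<le> ?N (\<lambda>x. s k t x - f t x)" for k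
        using norm_H1_triangle[OF D sH[of n t] elim(2) sH[of k t]]
          norm_H1_triangle[OF D sH[of n t] sH[of k t] elim(2)]
          norm_H1_commute[OF D sH[of k t] elim(2)] by simp
      have "(\<lambda>k. ?N (\<lambda>x. s n t x - s k t x) - ?N (\<lambda>x. s n t x - f t x)) \<longlonglongrightarrow> 0"
        by (rule Lim_null_comparison[OF _ elim(1)]) (use le in auto)
      then show ?case by (simp add: LIM_zero_iff)
    qed
  qed
  have dom: "AE t in lebesgue_on I. norm (?N (\<lambda>x. s n t x - f t x)) \<le> 3 * ?N (f t) + 1" for n
    using fH AE_space
  proof eventually_elim
    case (elim t)
    then have Nft: "Nf t = ?N (f t)" by (simp add: Nf_def)
    \<comment> \<open>The truncation inserts the zero function, whose norm involves a chosen weak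
      gradient. The triangle inequality bounds it by \<open>2 * Nf t\<close>, so the level
      \<open>2 * Nf t + 1\<close> covers both branches of \<open>s\<close>.\<close>
    have z: "?N (\<lambda>x. 0) \<le> 2 * Nf t + 1"
    proof -
      have "?N (\<lambda>x. 0) \<le> ?N (\<lambda>x. 0 - f t x) + ?N (f t)"
        by (rule norm_H1_triangle'[OF D H1_zero elim(1)])
      also have "?N (\<lambda>x. 0 - f t x) = ?N (f t)"
        using norm_H1_commute[OF D H1_zero elim(1)] by simp
      finally show ?thesis unfolding Nft by simp
    qed
    have sN: "?N (s n t) \<le> 2 * ?N (f t) + 1"
      using z by (auto simp: s_def Nft)
    have "?N (\<lambda>x. s n t x - f t x) \<le> ?N (\<lambda>x. s n t x - 0) + ?N (\<lambda>x. 0 - f t x)"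
      by (rule norm_H1_triangle[OF D sH H1_zero elim(1)])
    also have "?N (\<lambda>x. 0 - f t x) = ?N (f t)"
      using norm_H1_commute[OF D H1_zero elim(1)] by simp
    finally show ?case using sN by simp
  qed
  have ci: "integrable (lebesgue_on I) (\<lambda>t. 3 * ?N (f t) + 1)"
    using fi integral_simple_compose(1)[OF simple_function_const I, of "\<lambda>x. 1"] by simp
  have i: "integrable (lebesgue_on I) (\<lambda>t. ?N (\<lambda>x. s n t x - f t x))" for n
    by (rule Bochner_Integration.integrable_bound[OF ci m])
       (use dom[of n] in \<open>auto elim!: eventually_mono intro: order_trans[OF _ abs_ge_self]\<close>)
  have "(\<lambda>n. LINT t|lebesgue_on I. ?N (\<lambda>x. s n t x - f t x)) \<longlonglongrightarrow> (LINT t|lebesgue_on I. 0)"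
    by (rule integral_dominated_convergence[OF _ _ ci lim dom]) (use m in auto)
  then show ?thesis
    by (intro that[of s] s_simple sH lim i) simp
qed

text \<open>Gradients of smooth functions are in general square integrable only on bounded sets;
  over \<open>D\<close> they are paired with fields that vanish off such a set.\<close>

lemma L2_inner_bounded_support:
  fixes v G :: "'a::euclidean_space \<Rightarrow> 'b::euclidean_space"
  assumes D: "D \<in> sets lebesgue" and B: "B \<in> sets lebesgue" "B \<subseteq> D" and v: "v \<in> L2 D" "\<And>x. x \<in> D \<Longrightarrow> x \<notin> B \<Longrightarrow> v x = 0"
    and G: "G \<in> L2 B"
  shows "integrable (lebesgue_on D) (\<lambda>x. G x \<bullet> v x)"
    and "\<bar>LINT x|lebesgue_on D. G x \<bullet> v x\<bar> \<le> norm_L2 B G * norm_L2 D v"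
proof -
  have vB: "v \<in> L2 B" "norm_L2 B v \<le> norm_L2 D v" using L2_subset[OF D B v(1)] by auto
  have eq: "(\<lambda>x. indicator D x *\<^sub>R (G x \<bullet> v x)) = (\<lambda>x. indicator B x *\<^sub>R (G x \<bullet> v x))"
  proof
    fix x show "indicator D x *\<^sub>R (G x \<bullet> v x) = indicator B x *\<^sub>R (G x \<bullet> v x)"
      using v(2)[of x] B(2) by (cases "x \<in> B"; cases "x \<in> D") auto
  qed
  note i = L2_inner[OF B(1) G vB(1)]
  show "integrable (lebesgue_on D) (\<lambda>x. G x \<bullet> v x)"
    using i(1) B(1) D by (simp add: integrable_restrict_space eq[simplified])
  have "(LINT x|lebesgue_on D. G x \<bullet> v x) = (LINT x|lebesgue_on B. G x \<bullet> v x)"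
    using B(1) D by (simp add: integral_restrict_space eq[simplified])
  also have "\<bar>\<dots>\<bar> \<le> norm_L2 B G * norm_L2 B v" by (rule i(2))
  also have "\<dots> \<le> norm_L2 B G * norm_L2 D v" using vB(2) by (intro mult_left_mono) auto
  finally show "\<bar>LINT x|lebesgue_on D. G x \<bullet> v x\<bar> \<le> norm_L2 B G * norm_L2 D v" .
qed

text \<open>The pairing is Lipschitz in the value of the curve with respect to
  \<open>norm_H1\<close>. So it inherits measurability from the approximating simple curves and a
  dominating function from the norm of the curve.\<close>

lemma bochner_gradient_integrable:
  fixes f :: "real \<Rightarrow> 'a::euclidean_space \<Rightarrow> real"
  assumes D: "open D" and I: "I \<in> lmeasurable" and f: "bochner_L2 I (H1 D) (norm_H1 D) f" and v: "v \<in> L2 D"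
  shows "integrable (lebesgue_on I) (\<lambda>t. LINT x|lebesgue_on D. wgrad D (f t) x \<bullet> v x)"
proof -
  let ?N = "norm_H1 D"
  let ?J = "\<lambda>h. LINT x|lebesgue_on D. wgrad D h x \<bullet> v x"
  have S: "D \<in> sets lebesgue" and IS: "I \<in> sets lebesgue" using D I by auto
  obtain s where s: "\<And>n::nat. simple_function lebesgue (s n)" "\<And>n t. s n t \<in> H1 D"
    "AE t in lebesgue_on I. (\<lambda>n. ?N (\<lambda>x. s n t x - f t x)) \<longlonglongrightarrow> 0"
    by (rule bochner_simple_approximation[OF D I f]) (rule that, assumption+)
  have fH: "AE t in lebesgue_on I. f t \<in> H1 D"
    using f IS by (simp add: bochner_L2_def AE_restrict_space_iff)
  have diff: "\<bar>?J a - ?J b\<bar> \<le> ?N (\<lambda>x. a x - b x) * norm_L2 D v" if ab: "a \<in> H1 D" "b \<in> H1 D" for a b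
  proof -
    note wa = wgrad(2)[OF ab(1)] and wb = wgrad(2)[OF ab(2)]
    have "?J a - ?J b = (LINT x|lebesgue_on D. (wgrad D a x - wgrad D b x) \<bullet> v x)"
      using L2_inner(1)[OF S wa v] L2_inner(1)[OF S wb v] by (simp add: inner_diff_left)
    also have "\<bar>\<dots>\<bar> \<le> norm_L2 D (\<lambda>x. wgrad D a x - wgrad D b x) * norm_L2 D v"
      by (rule L2_inner(2)[OF S L2_diff(1)[OF S wa wb] v])
    also have "\<dots> \<le> ?N (\<lambda>x. a x - b x) * norm_L2 D v"
      using norm_L2_wgrad_diff[OF D ab] norm_L2_le_norm_H1(2)[of D "\<lambda>x. a x - b x"]
      by (intro mult_right_mono) auto
    finally show ?thesis .
  qed
  have m: "(\<lambda>t. ?J (f t)) \<in> borel_measurable (lebesgue_on I)"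
  proof (rule borel_measurable_AE_LIMSEQ[OF IS])
    show "(\<lambda>t. ?J (s n t)) \<in> borel_measurable (lebesgue_on I)" for n
      by (rule measurable_restrict_space1, rule borel_measurable_simple_function,
          rule simple_function_compose1[OF s(1)])
    show "AE t in lebesgue_on I. (\<lambda>n. ?J (s n t)) \<longlonglongrightarrow> ?J (f t)"
      using s(3) fH
    proof eventually_elim
      case (elim t)
      have "(\<lambda>n. ?N (\<lambda>x. s n t x - f t x) * norm_L2 D v) \<longlonglongrightarrow> 0 * norm_L2 D v"
        by (intro tendsto_intros elim)
      then have z: "(\<lambda>n. ?N (\<lambda>x. s n t x - f t x) * norm_L2 D v) \<longlonglongrightarrow> 0" by simp
      have "\<forall>\<^sub>F n in sequentially. norm (?J (s n t) - ?J (f t)) \<le> ?N (\<lambda>x. s n t x - f t x) * norm_L2 D v"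
        using diff[OF s(2) elim(2)] by (intro always_eventually allI) (simp only: real_norm_def)
      then have "(\<lambda>n. ?J (s n t) - ?J (f t)) \<longlonglongrightarrow> 0"
        using z by (rule Lim_null_comparison)
      then show ?case by (rule LIM_zero_cancel)
    qed
  qed
  have bi: "integrable (lebesgue_on I) (\<lambda>t. ?N (f t) * norm_L2 D v)"
    using bochner_norm_integrable[OF I f] by simp
  show ?thesis
  proof (rule Bochner_Integration.integrable_bound[OF bi m])
    show "AE t in lebesgue_on I. norm (?J (f t)) \<le> norm (?N (f t) * norm_L2 D v)"
      using fH
    proof eventually_elim
      case (elim t)
      have "\<bar>?J (f t)\<bar> \<le> norm_L2 D (wgrad D (f t)) * norm_L2 D v"
        by (rule L2_inner(2)[OF S wgrad(2)[OF elim] v])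
      also have "\<dots> \<le> ?N (f t) * norm_L2 D v"
        by (intro mult_right_mono norm_L2_le_norm_H1) auto
      finally show ?case by simp
    qed
  qed
qed

text \<open>\<Phi> stands in for the Bochner integral of \<open>f\<close> over \<open>I\<close>,
  which is never formed. The properties are those of the integral that the energy estimate uses: its
  gradient pairs with a field like the time integral of the pairings, its value is close to the
  length of \<open>I\<close> times any \<open>z\<close> near the curve, and its gradient is
  controlled by the integrated norm. \<Phi> is fixed before \<open>v\<close> and \<open>z\<close>,
  because the field \<open>v\<close> will be built from \<Phi>.\<close>

lemma time_integral_approximation:
  fixes f :: "real \<Rightarrow> 'a::euclidean_space \<Rightarrow> real"
  assumes D: "open D" "locally_C11_boundary D" and I: "I \<in> lmeasurable"
    and f: "bochner_L2 I (H1 D) (norm_H1 D) f" and e: "0 < e"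
  obtains \<Phi> where "smooth \<Phi>"
    "\<forall>v\<in>L2 D. (\<forall>x. x \<notin> ball 0 R \<longrightarrow> v x = 0) \<longrightarrow>
       \<bar>(LINT t|lebesgue_on I. LINT x|lebesgue_on D. wgrad D (f t) x \<bullet> v x)
         - (LINT x|lebesgue_on D. gradient \<Phi> x \<bullet> v x)\<bar> \<le> e * norm_L2 D v"
    "\<forall>z\<in>L2 D. \<forall>\<omega>. (AE t in lebesgue_on I. norm_L2 D (\<lambda>x. f t x - z x) \<le> \<omega>) \<longrightarrow>
       norm_L2 (D \<inter> ball 0 R) (\<lambda>x. \<Phi> x - measure lebesgue I * z x) \<le> e + measure lebesgue I * \<omega>"
    "norm_L2 (D \<inter> ball 0 R) (gradient \<Phi>) \<le> e + (LINT t|lebesgue_on I. norm_H1 D (f t))"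
proof -
  let ?N = "norm_H1 D"
  define B where "B = D \<inter> ball 0 R"
  define l where "l = measure lebesgue I"
  \<comment> \<open>Half of the tolerance is spent on the simple curve, the other half on smoothing
    its values; the latter error is integrated over the length \<open>l\<close>.\<close>
  define e' where "e' = e / 2 / (l + 1)"
  have l: "0 \<le> l" by (simp add: l_def)
  have e': "0 < e'" using e l by (simp add: e'_def)
  have e'l: "l * e' \<le> e / 2"
  proof -
    have "l + 1 \<noteq> 0" using l by linarith
    then have "e' * (l + 1) = e / 2" by (metis e'_def nonzero_eq_divide_eq)
    then show ?thesis using e' by (simp add: algebra_simps)
  qed
  have S: "D \<in> sets lebesgue" and IS: "I \<in> sets lebesgue" using D I by auto
  have B: "B \<in> sets lebesgue" "B \<subseteq> D" "bounded B" using S by (auto simp: B_def)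
  obtain s' where s': "\<And>n::nat. simple_function lebesgue (s' n)" "\<And>n t. s' n t \<in> H1 D"
    "\<And>n. integrable (lebesgue_on I) (\<lambda>t. ?N (\<lambda>x. s' n t x - f t x))"
    "(\<lambda>n. LINT t|lebesgue_on I. ?N (\<lambda>x. s' n t x - f t x)) \<longlonglongrightarrow> 0"
    by (rule bochner_simple_approximation[OF D(1) I f]) (rule that, assumption+)
  have "\<forall>\<^sub>F n in sequentially. (LINT t|lebesgue_on I. ?N (\<lambda>x. s' n t x - f t x)) < e / 2"
    by (rule order_tendstoD(2)[OF s'(4)]) (use e in simp)
  then obtain n where n: "(LINT t|lebesgue_on I. ?N (\<lambda>x. s' n t x - f t x)) < e / 2"
    by (auto dest: eventually_happens)
  define s where "s = s' n"
  have s: "simple_function lebesgue s" "\<And>t. s t \<in> H1 D" "integrable (lebesgue_on I) (\<lambda>t. ?N (\<lambda>x. s t x - f t x))"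
    "(LINT t|lebesgue_on I. ?N (\<lambda>x. s t x - f t x)) \<le> e / 2"
    using s'(1,2,3) n by (auto simp: s_def)
  have fH: "AE t in lebesgue_on I. f t \<in> H1 D"
    using f IS by (simp add: bochner_L2_def AE_restrict_space_iff)
  note fi = bochner_norm_integrable[OF I f]
  have "\<exists>\<Psi>. smooth \<Psi> \<and> norm_L2 B (\<lambda>x. \<Psi> x - a x) \<le> e' \<and> norm_L2 B (\<lambda>x. gradient \<Psi> x - wgrad D a x) \<le> e'"
    if a: "a \<in> H1 D" for a
    using smooth_dense_H1[OF D wgrad(1)[OF a] wgrad(2)[OF a] wgrad(3)[OF a], of R] e'
    unfolding smoothly_approximable_def B_def by blast
  then obtain \<Psi> where \<Psi>: "\<And>a. a \<in> H1 D \<Longrightarrow> smooth (\<Psi> a)"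
    "\<And>a. a \<in> H1 D \<Longrightarrow> norm_L2 B (\<lambda>x. \<Psi> a x - a x) \<le> e'"
    "\<And>a. a \<in> H1 D \<Longrightarrow> norm_L2 B (\<lambda>x. gradient (\<Psi> a) x - wgrad D a x) \<le> e'"
    by metis
  have fin: "finite (range s)" using s(1) by (simp add: simple_function_def)
  have rH: "a \<in> H1 D" if "a \<in> range s" for a using that s(2) by auto
  define m where "m a = measure lebesgue (s -` {a} \<inter> I)" for a
  have m: "0 \<le> m a" for a by (simp add: m_def)
  note int = integral_simple_compose(2)[OF s(1) I, folded m_def]
    and intb = integral_simple_compose(1)[OF s(1) I]
  have one: "(LINT t|lebesgue_on I. c) = l * c" for c :: real
    using IS by (simp add: l_def measure_restrict_space)
  have sum_m: "(\<Sum>a\<in>range s. m a) = l"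
    using int[of "\<lambda>a. 1"] one[of 1] by simp
  have ci: "integrable (lebesgue_on I) (\<lambda>t. c)" for c :: real
    using integral_simple_compose(1)[OF simple_function_const I, of "\<lambda>x. c"] by simp
  \<comment> \<open>This is the time integral of \<open>\<Psi> (s t)\<close>; it is a finite sum of
    smooth functions because \<open>s\<close> is simple.\<close>
  define \<Phi> where "\<Phi> x = (\<Sum>a\<in>range s. m a * \<Psi> a x)" for x
  have sm: "smooth \<Phi>" unfolding \<Phi>_def by (intro smooth_sum smooth_cmult \<Psi>(1) rH)
  have grad: "gradient \<Phi> x = (\<Sum>a\<in>range s. m a *\<^sub>R gradient (\<Psi> a) x)" for x
    unfolding \<Phi>_def
    by (subst gradient_sum) (auto intro!: smooth_cmult \<Psi>(1) s(2) sum.cong gradient_cmult)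
  have \<Psi>L: "\<Psi> a \<in> L2 B" "gradient (\<Psi> a) \<in> L2 B" if "a \<in> H1 D" for a
    using L2_continuous_bounded_set[OF B(1,3) smooth_continuous_on[OF \<Psi>(1)[OF that]]]
      L2_continuous_bounded_set[OF B(1,3) continuous_on_gradient[OF \<Psi>(1)[OF that]]] by auto
  have aB: "a \<in> L2 B" "wgrad D a \<in> L2 B" if "a \<in> H1 D" for a
    using L2_subset(1)[OF S B(1,2)] wgrad[OF that] by auto
  show ?thesis
  proof (rule that[OF sm]; (intro ballI allI impI)?)
    fix v :: "'a \<Rightarrow> 'a" assume v: "v \<in> L2 D" and v0: "\<forall>x. x \<notin> ball 0 R \<longrightarrow> v x = 0"
    have v0': "\<And>x. x \<in> D \<Longrightarrow> x \<notin> B \<Longrightarrow> v x = 0" using v0 by (auto simp: B_def)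
    have inn: "G \<in> L2 B \<Longrightarrow> integrable (lebesgue_on D) (\<lambda>x. G x \<bullet> v x)"
      "G \<in> L2 B \<Longrightarrow> \<bar>LINT x|lebesgue_on D. G x \<bullet> v x\<bar> \<le> norm_L2 B G * norm_L2 D v" for G
      using L2_inner_bounded_support[of D B v G] S B v v0' by blast+
    let ?J = "\<lambda>h. LINT x|lebesgue_on D. wgrad D h x \<bullet> v x"
    let ?G = "\<lambda>a. LINT x|lebesgue_on D. gradient (\<Psi> a) x \<bullet> v x"
    have "(LINT x|lebesgue_on D. gradient \<Phi> x \<bullet> v x) = (LINT x|lebesgue_on D. (\<Sum>a\<in>range s. m a * (gradient (\<Psi> a) x \<bullet> v x)))"
      by (simp add: grad inner_sum_left)
    also have "\<dots> = (\<Sum>a\<in>range s. m a * ?G a)"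
    proof (subst Bochner_Integration.integral_sum)
      show "integrable (lebesgue_on D) (\<lambda>x. m a * (gradient (\<Psi> a) x \<bullet> v x))" if "a \<in> range s" for a
        using inn(1)[OF \<Psi>L(2)[OF rH[OF that]]] by simp
    qed simp
    also have "\<dots> = (LINT t|lebesgue_on I. ?G (s t))" by (rule int[symmetric])
    finally have eq: "(LINT x|lebesgue_on D. gradient \<Phi> x \<bullet> v x) = (LINT t|lebesgue_on I. ?G (s t))" .
    have le: "AE t in lebesgue_on I. \<bar>?J (f t) - ?G (s t)\<bar> \<le> (?N (\<lambda>x. s t x - f t x) + e') * norm_L2 D v"
      using fH
    proof eventually_elim
      case (elim t)
      note wf = wgrad(2)[OF elim] and ws = wgrad(2)[OF s(2)[of t]]
      have "?J (f t) - ?J (s t) = (LINT x|lebesgue_on D. (wgrad D (f t) x - wgrad D (s t) x) \<bullet> v x)"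
        using L2_inner(1)[OF S wf v] L2_inner(1)[OF S ws v] by (simp add: inner_diff_left)
      also have "\<bar>\<dots>\<bar> \<le> norm_L2 D (\<lambda>x. wgrad D (f t) x - wgrad D (s t) x) * norm_L2 D v"
        by (rule L2_inner(2)[OF S L2_diff(1)[OF S wf ws] v])
      also have "norm_L2 D (\<lambda>x. wgrad D (f t) x - wgrad D (s t) x) \<le> ?N (\<lambda>x. s t x - f t x)"
        using norm_L2_wgrad_diff[OF D(1) elim s(2)] norm_L2_le_norm_H1(2)[of D "\<lambda>x. f t x - s t x"]
          norm_H1_commute[OF D(1) elim s(2)] by simp
      finally have 1: "\<bar>?J (f t) - ?J (s t)\<bar> \<le> ?N (\<lambda>x. s t x - f t x) * norm_L2 D v"
        by (simp add: mult_right_mono)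
      have "?G (s t) - ?J (s t) = (LINT x|lebesgue_on D. (gradient (\<Psi> (s t)) x - wgrad D (s t) x) \<bullet> v x)"
        using inn(1)[OF \<Psi>L(2)[OF s(2)]] L2_inner(1)[OF S ws v] by (simp add: inner_diff_left)
      also have "\<bar>\<dots>\<bar> \<le> norm_L2 B (\<lambda>x. gradient (\<Psi> (s t)) x - wgrad D (s t) x) * norm_L2 D v"
        by (rule inn(2)[OF L2_diff(1)[OF B(1) \<Psi>L(2)[OF s(2)] aB(2)[OF s(2)]]])
      also have "\<dots> \<le> e' * norm_L2 D v" by (intro mult_right_mono \<Psi>(3) s(2)) auto
      finally show ?case using 1 by (simp add: distrib_right)
    qed
    note Ji = bochner_gradient_integrable[OF D(1) I f v]
    have "(LINT t|lebesgue_on I. ?J (f t)) - (LINT t|lebesgue_on I. ?G (s t)) = (LINT t|lebesgue_on I. ?J (f t) - ?G (s t))"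
      using Ji intb[of ?G] by simp
    also have "\<bar>\<dots>\<bar> \<le> (LINT t|lebesgue_on I. \<bar>?J (f t) - ?G (s t)\<bar>)" by (rule integral_abs_bound)
    also have "\<dots> \<le> (LINT t|lebesgue_on I. (?N (\<lambda>x. s t x - f t x) + e') * norm_L2 D v)"
      by (rule integral_mono_AE[OF _ _ le]) (use Ji intb[of ?G] s(3) ci in auto)
    also have "\<dots> = ((LINT t|lebesgue_on I. ?N (\<lambda>x. s t x - f t x)) + l * e') * norm_L2 D v"
      using s(3) ci one by simp
    also have "\<dots> \<le> e * norm_L2 D v" using s(4) e'l by (intro mult_right_mono) auto
    finally show "\<bar>(LINT t|lebesgue_on I. ?J (f t)) - (LINT x|lebesgue_on D. gradient \<Phi> x \<bullet> v x)\<bar> \<le> e * norm_L2 D v"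
      unfolding eq .
  next
    fix z \<omega> assume z: "z \<in> L2 D" and \<omega>: "AE t in lebesgue_on I. norm_L2 D (\<lambda>x. f t x - z x) \<le> \<omega>"
    have zB: "z \<in> L2 B" by (rule L2_subset(1)[OF S B(1,2) z])
    have "norm_L2 B (\<lambda>x. \<Phi> x - l * z x) = norm_L2 B (\<lambda>x. \<Sum>a\<in>range s. m a * (\<Psi> a x - z x))"
    proof (rule norm_L2_cong[OF B(1)])
      fix x show "\<Phi> x - l * z x = (\<Sum>a\<in>range s. m a * (\<Psi> a x - z x))"
        by (simp add: \<Phi>_def right_diff_distrib sum_subtractf sum_m[symmetric] sum_distrib_right)
    qed
    also have "\<dots> \<le> (\<Sum>a\<in>range s. norm_L2 B (\<lambda>x. m a * (\<Psi> a x - z x)))"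
      by (rule L2_sum(2)[OF B(1) L2_cmult(1)[OF B(1) L2_diff(1)[OF B(1) \<Psi>L(1)[OF rH] zB]]])
    also have "\<dots> = (\<Sum>a\<in>range s. m a * norm_L2 B (\<lambda>x. \<Psi> a x - z x))"
      using m by (intro sum.cong refl) (subst L2_cmult(2)[OF B(1)], auto intro!: L2_diff(1) B \<Psi>L s(2) zB)
    also have "\<dots> = (LINT t|lebesgue_on I. norm_L2 B (\<lambda>x. \<Psi> (s t) x - z x))"
      by (rule int[symmetric])
    also have "\<dots> \<le> (LINT t|lebesgue_on I. e' + ?N (\<lambda>x. s t x - f t x) + \<omega>)"
    proof (rule integral_mono_AE[OF intb])
      show "integrable (lebesgue_on I) (\<lambda>t. e' + ?N (\<lambda>x. s t x - f t x) + \<omega>)" using s(3) ci by auto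
      show "AE t in lebesgue_on I. norm_L2 B (\<lambda>x. \<Psi> (s t) x - z x) \<le> e' + ?N (\<lambda>x. s t x - f t x) + \<omega>"
        using fH \<omega>
      proof eventually_elim
        case (elim t)
        note fB = aB(1)[OF elim(1)] and sB = aB(1)[OF s(2)[of t]]
        have "norm_L2 B (\<lambda>x. \<Psi> (s t) x - z x) \<le> norm_L2 B (\<lambda>x. \<Psi> (s t) x - s t x) + norm_L2 B (\<lambda>x. s t x - z x)"
          by (rule norm_L2_triangle[OF B(1) \<Psi>L(1)[OF s(2)] sB zB])
        moreover have "norm_L2 B (\<lambda>x. s t x - z x) \<le> norm_L2 B (\<lambda>x. s t x - f t x) + norm_L2 B (\<lambda>x. f t x - z x)"
          by (rule norm_L2_triangle[OF B(1) sB fB zB])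
        moreover have "norm_L2 B (\<lambda>x. s t x - f t x) \<le> norm_L2 D (\<lambda>x. s t x - f t x)"
          by (rule L2_subset(2)[OF S B(1,2) L2_diff(1)[OF S wgrad(1)[OF s(2)] wgrad(1)[OF elim(1)]]])
        moreover have "norm_L2 B (\<lambda>x. f t x - z x) \<le> norm_L2 D (\<lambda>x. f t x - z x)"
          by (rule L2_subset(2)[OF S B(1,2) L2_diff(1)[OF S wgrad(1)[OF elim(1)] z]])
        moreover note norm_L2_le_norm_H1(1)[of D "\<lambda>x. s t x - f t x"] \<Psi>(2)[OF s(2)[of t]] elim(2)
        ultimately show ?case by linarith
      qed
    qed
    also have "\<dots> = l * e' + (LINT t|lebesgue_on I. ?N (\<lambda>x. s t x - f t x)) + l * \<omega>"
      using s(3) ci one[of 1] by simp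
    also have "\<dots> \<le> e + l * \<omega>" using s(4) e'l by simp
    finally show "norm_L2 (D \<inter> ball 0 R) (\<lambda>x. \<Phi> x - measure lebesgue I * z x) \<le> e + measure lebesgue I * \<omega>"
      by (simp add: B_def l_def)
  next
    have "norm_L2 B (gradient \<Phi>) = norm_L2 B (\<lambda>x. \<Sum>a\<in>range s. m a *\<^sub>R gradient (\<Psi> a) x)"
      by (intro norm_L2_cong B grad)
    also have "\<dots> \<le> (\<Sum>a\<in>range s. norm_L2 B (\<lambda>x. m a *\<^sub>R gradient (\<Psi> a) x))"
      by (rule L2_sum(2)[OF B(1) L2_scaleR(1)[OF B(1) \<Psi>L(2)[OF rH]]])
    also have "\<dots> = (\<Sum>a\<in>range s. m a * norm_L2 B (gradient (\<Psi> a)))"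
      using m by (intro sum.cong refl) (subst L2_scaleR(2)[OF B(1)], auto intro!: \<Psi>L s(2))
    also have "\<dots> = (LINT t|lebesgue_on I. norm_L2 B (gradient (\<Psi> (s t))))"
      by (rule int[symmetric])
    also have "\<dots> \<le> (LINT t|lebesgue_on I. e' + ?N (\<lambda>x. s t x - f t x) + ?N (f t))"
    proof (rule integral_mono_AE[OF intb])
      show "integrable (lebesgue_on I) (\<lambda>t. e' + ?N (\<lambda>x. s t x - f t x) + ?N (f t))" using s(3) ci fi by auto
      show "AE t in lebesgue_on I. norm_L2 B (gradient (\<Psi> (s t))) \<le> e' + ?N (\<lambda>x. s t x - f t x) + ?N (f t)"
        using fH
      proof eventually_elim
        case (elim t)
        have "norm_L2 B (gradient (\<Psi> (s t))) \<le> norm_L2 B (\<lambda>x. gradient (\<Psi> (s t)) x - wgrad D (s t) x) + norm_L2 B (wgrad D (s t))"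
          by (rule norm_L2_triangle'[OF B(1) \<Psi>L(2)[OF s(2)] aB(2)[OF s(2)]])
        moreover have "norm_L2 B (wgrad D (s t)) \<le> norm_L2 D (wgrad D (s t))"
          by (rule L2_subset(2)[OF S B(1,2) wgrad(2)[OF s(2)]])
        moreover note norm_L2_le_norm_H1(2)[of D "s t"] \<Psi>(3)[OF s(2)[of t]]
          norm_H1_triangle'[OF D(1) s(2)[of t] elim]
        ultimately show ?case by linarith
      qed
    qed
    also have "\<dots> = l * e' + (LINT t|lebesgue_on I. ?N (\<lambda>x. s t x - f t x)) + (LINT t|lebesgue_on I. ?N (f t))"
      using s(3) ci one fi by simp
    also have "\<dots> \<le> e + (LINT t|lebesgue_on I. ?N (f t))" using s(4) e'l by simp
    finally show "norm_L2 (D \<inter> ball 0 R) (gradient \<Phi>) \<le> e + (LINT t|lebesgue_on I. ?N (f t))"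
      by (simp add: B_def)
  qed
qed

text \<open>Multiplying \<phi> by a time cutoff that equals 1 around the interval gives a test
  function in space and time without a time derivative there. The term with \<mu> drops out of the
  flux, and the measurability in time of the whole integrand follows from that of the gradient
  pairing.\<close>

lemma enthalpy_flux_static:
  fixes u \<mu> :: "'a::euclidean_space \<times> real \<Rightarrow> real" and \<phi> :: "'a \<Rightarrow> real"
  assumes D: "open D" and F: "F \<in> L2 D" and u: "bochner_L2 {t1..t2} (H1 D) (norm_H1 D) (slice u)"
    and t: "t1 \<le> t2" and \<phi>: "test_function UNIV \<phi>" "\<And>x. 0 \<le> \<phi> x"
  obtains \<eta> where "test_function UNIV \<eta>" "\<And>z. 0 \<le> \<eta> z" "\<And>x. \<eta> (x, t1) = \<phi> x" "\<And>x. \<eta> (x, t2) = \<phi> x"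
    "enthalpy_flux D F u \<mu> \<eta> t1 t2
      = - (LINT t|lebesgue_on {t1..t2}. LINT x|lebesgue_on D. wgrad D (slice u t) x \<bullet> gradient \<phi> x)
        - (t2 - t1) * (LINT x|lebesgue_on D. F x \<bullet> gradient \<phi> x)"
proof -
  \<comment> \<open>The summand 1 puts both endpoints in the interior of the region where \<psi> is
    1, so the time derivative vanishes at the endpoints too.\<close>
  define r where "r = \<bar>t1\<bar> + \<bar>t2\<bar> + 1"
  have r: "0 < r" by (simp add: r_def)
  have S: "D \<in> sets lebesgue" and IS: "{t1..t2} \<in> sets lebesgue" using D by auto
  obtain \<psi> :: "real \<Rightarrow> real" where \<psi>: "smooth \<psi>" "\<And>y. 0 \<le> \<psi> y"
    "\<And>y. dist 0 y \<le> r \<Longrightarrow> \<psi> y = 1" "\<And>y. r + 1 \<le> dist 0 y \<Longrightarrow> \<psi> y = 0"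
    by (rule bump_exists[of r "r + 1" "0::real"]) (use r in simp, simp, rule that, assumption+)
  define \<eta> where "\<eta> z = \<phi> (fst z) * \<psi> (snd z)" for z :: "'a \<times> real"
  obtain R where R: "0 < R" "\<And>x. \<phi> x \<noteq> 0 \<Longrightarrow> x \<in> ball 0 R"
    using test_function_bounded_support[OF \<phi>(1)] by blast
  have s\<phi>: "smooth \<phi>" by (rule test_function_smooth[OF \<phi>(1)])
  have s: "smooth \<eta>"
    unfolding \<eta>_def using smooth_compose_affine[OF bounded_linear_fst s\<phi>, of 0]
      smooth_compose_affine[OF bounded_linear_snd \<psi>(1), of 0]
    by (intro smooth_mult) auto
  have tf: "test_function UNIV \<eta>"
  proof (rule test_functionI[OF s, of "cball 0 R \<times> cball 0 (r + 1)"])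
    show "compact (cball (0::'a) R \<times> cball (0::real) (r + 1))" by (intro compact_Times compact_cball)
    fix z :: "'a \<times> real" assume z: "z \<notin> cball 0 R \<times> cball 0 (r + 1)"
    then consider "fst z \<notin> cball 0 R" | "snd z \<notin> cball 0 (r + 1)" by (cases z) auto
    then show "\<eta> z = 0"
    proof cases
      case 1
      then have "\<phi> (fst z) = 0" using R(2)[of "fst z"] by (auto simp: dist_norm)
      then show ?thesis by (simp add: \<eta>_def)
    next
      case 2
      then have "\<psi> (snd z) = 0" by (intro \<psi>(4)) auto
      then show ?thesis by (simp add: \<eta>_def)
    qed
  qed auto
  have \<psi>1: "\<psi> t = 1" if "t \<in> {t1..t2}" for t
    using that by (intro \<psi>(3)) (auto simp: r_def)
  have sl: "slice \<eta> t = \<phi>" if "t \<in> {t1..t2}" for t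
    using \<psi>1[OF that] by (simp add: slice_def \<eta>_def fun_eq_iff)
  have der: "deriv (\<lambda>s. \<eta> (x, s)) t = 0" if t: "t \<in> {t1..t2}" for x t
  proof (rule DERIV_imp_deriv)
    have "((\<lambda>s. \<phi> x) has_real_derivative 0) (at t)" by simp
    then show "((\<lambda>s. \<eta> (x, s)) has_real_derivative 0) (at t)"
    proof (rule has_field_derivative_transform_within_open[of _ _ _ "ball 0 r"])
      show "t \<in> ball 0 r" using t by (auto simp: r_def)
      show "\<phi> x = \<eta> (x, y)" if "y \<in> ball 0 r" for y using that \<psi>(3)[of y] by (simp add: \<eta>_def)
    qed auto
  qed
  note \<phi>L = test_function_L2(2)[OF S \<phi>(1)]
  let ?J = "\<lambda>t. LINT x|lebesgue_on D. wgrad D (slice u t) x \<bullet> gradient \<phi> x"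
  let ?K = "LINT x|lebesgue_on D. F x \<bullet> gradient \<phi> x"
  have I: "{t1..t2} \<in> lmeasurable" by auto
  have fH: "AE t in lebesgue_on {t1..t2}. slice u t \<in> H1 D"
    using u IS by (simp add: bochner_L2_def AE_restrict_space_iff)
  note Ji = bochner_gradient_integrable[OF D I u \<phi>L]
  have ci: "integrable (lebesgue_on {t1..t2}) (\<lambda>t. c)" for c :: real
    using integral_simple_compose(1)[OF simple_function_const I, of "\<lambda>x. c"] by simp
  have "enthalpy_flux D F u \<mu> \<eta> t1 t2 = (LINT t|lebesgue_on {t1..t2}. LINT x|lebesgue_on D.
      (u (x, t) + \<mu> (x, t)) * deriv (\<lambda>s. \<eta> (x, s)) t
        - wgrad D (slice u t) x \<bullet> gradient (slice \<eta> t) x - F x \<bullet> gradient (slice \<eta> t) x)"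
    by (simp only: enthalpy_flux_def set_lebesgue_integral_eq_restrict[OF S] set_lebesgue_integral_eq_restrict[OF IS])
  also have "\<dots> = (LINT t|lebesgue_on {t1..t2}. - ?J t - ?K)"
  proof (rule integral_lebesgue_on_cong_AE[OF IS])
    show "(\<lambda>t. - ?J t - ?K) \<in> borel_measurable (lebesgue_on {t1..t2})" using Ji by measurable
    show "AE t in lebesgue_on {t1..t2}. (LINT x|lebesgue_on D. (u (x, t) + \<mu> (x, t)) * deriv (\<lambda>s. \<eta> (x, s)) t
        - wgrad D (slice u t) x \<bullet> gradient (slice \<eta> t) x - F x \<bullet> gradient (slice \<eta> t) x) = - ?J t - ?K"
      using fH AE_space
    proof eventually_elim
      case (elim t)
      then have t: "t \<in> {t1..t2}" by simp
      show ?case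
        using L2_inner(1)[OF S wgrad(2)[OF elim(1)] \<phi>L] L2_inner(1)[OF S F \<phi>L]
        by (simp add: sl[OF t] der[OF t])
    qed
  qed
  also have "\<dots> = - (LINT t|lebesgue_on {t1..t2}. ?J t) - (t2 - t1) * ?K"
    using Ji ci t by (simp add: measure_restrict_space)
  finally show ?thesis
    using \<phi>(2) \<psi>(2) \<psi>1[of t1] \<psi>1[of t2] t by (intro that[OF tf]) (auto simp: \<eta>_def)
qed

section \<open>Enthalpy pairs\<close>

lemma enthalpy_pairD:
  fixes u \<mu> :: "'a::euclidean_space \<times> real \<Rightarrow> real"
  assumes D: "open D" and p: "enthalpy_pair D Tstar uM u \<mu>" and t: "t \<in> times Tstar"
  shows "(\<lambda>x. u (x, t)) \<in> L2 D" "(\<lambda>x. \<mu> (x, t)) \<in> borel_measurable (lebesgue_on D)"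
    "AE x in lebesgue_on D. \<bar>\<mu> (x, t)\<bar> \<le> 1 \<and> (u (x, t) > uM x \<longrightarrow> \<mu> (x, t) = 1) \<and> (u (x, t) < uM x \<longrightarrow> \<mu> (x, t) = - 1)"
    "((\<lambda>s. norm_L2 D (\<lambda>x. u (x, s) - u (x, t))) \<longlongrightarrow> 0) (at t within times Tstar)"
proof -
  have S: "D \<in> sets lebesgue" using D by auto
  show "(\<lambda>x. u (x, t)) \<in> L2 D" "((\<lambda>s. norm_L2 D (\<lambda>x. u (x, s) - u (x, t))) \<longlongrightarrow> 0) (at t within times Tstar)"
    using p t by (auto simp: enthalpy_pair_def slice_def)
  show "(\<lambda>x. \<mu> (x, t)) \<in> borel_measurable (lebesgue_on D)"
    using p t S unfolding enthalpy_pair_def Linf_def slice_def by (auto simp: set_borel_measurable_eq_restrict)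
  show "AE x in lebesgue_on D. \<bar>\<mu> (x, t)\<bar> \<le> 1 \<and> (u (x, t) > uM x \<longrightarrow> \<mu> (x, t) = 1) \<and> (u (x, t) < uM x \<longrightarrow> \<mu> (x, t) = - 1)"
    using p t S unfolding enthalpy_pair_def AE_eq_restrict[OF S] by blast
qed

text \<open>\<mu> is merely bounded, so the enthalpy is in general square integrable only on sets of
  finite measure. This is why \<open>b\<close> is estimated on intersections of \<open>D\<close>
  with balls.\<close>

lemma enthalpy_L2:
  fixes u \<mu> :: "'a::euclidean_space \<times> real \<Rightarrow> real"
  assumes D: "open D" and p: "enthalpy_pair D Tstar uM u \<mu>" and t: "t \<in> times Tstar"
    and B: "B \<in> lmeasurable" "B \<subseteq> D"
  shows "(\<lambda>x. \<mu> (x, t)) \<in> L2 B" "norm_L2 B (\<lambda>x. \<mu> (x, t)) \<le> sqrt (measure lebesgue B)"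
    "(\<lambda>x. u (x, t) + \<mu> (x, t)) \<in> L2 B"
proof -
  note e = enthalpy_pairD[OF D p t]
  have S: "D \<in> sets lebesgue" and BS: "B \<in> sets lebesgue" using D B by auto
  have m: "(\<lambda>x. \<mu> (x, t)) \<in> borel_measurable (lebesgue_on B)"
    using e(2) B(2) by (rule measurable_restrict_mono)
  have "AE x in lebesgue. x \<in> D \<longrightarrow> \<bar>\<mu> (x, t)\<bar> \<le> 1"
    using e(3) S by (simp add: AE_restrict_space_iff)
  then have "AE x in lebesgue. x \<in> B \<longrightarrow> norm (\<mu> (x, t)) \<le> 1"
    by eventually_elim (use B in auto)
  then have "AE x in lebesgue_on B. norm (\<mu> (x, t)) \<le> 1"
    using BS by (simp add: AE_restrict_space_iff)
  note b = L2_bounded[OF B(1) m this]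
  show mL: "(\<lambda>x. \<mu> (x, t)) \<in> L2 B" and "norm_L2 B (\<lambda>x. \<mu> (x, t)) \<le> sqrt (measure lebesgue B)"
    using b by auto
  show "(\<lambda>x. u (x, t) + \<mu> (x, t)) \<in> L2 B"
    by (rule L2_add(1)[OF BS L2_subset(1)[OF S BS B(2) e(1)] mL])
qed

lemma times_downward: "0 \<le> s \<Longrightarrow> s \<le> t \<Longrightarrow> ereal t < Tstar \<Longrightarrow> s \<in> times Tstar"
  unfolding times_def using le_less_trans[of "ereal s" "ereal t" Tstar] by auto

section \<open>A smooth positive part and its energy inequality\<close>

definition smooth_pos :: "real \<Rightarrow> real \<Rightarrow> real" where
  "smooth_pos \<delta> r = (r + sqrt (r\<^sup>2 + \<delta>\<^sup>2)) / 2"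

text \<open>The lower bounds keep the new test function admissible and above its untruncated
  argument; the upper bound limits the price of the smoothing. Which side is used depends on the
  sign of \<open>b\<close>.\<close>

lemma smooth_pos_bounds:
  assumes "0 < \<delta>"
  shows "r \<le> smooth_pos \<delta> r" "0 \<le> smooth_pos \<delta> r" "smooth_pos \<delta> r \<le> max 0 r + \<delta> / 2"
proof -
  have 1: "\<bar>r\<bar> \<le> sqrt (r\<^sup>2 + \<delta>\<^sup>2)" by (rule real_le_rsqrt) simp
  have "sqrt (r\<^sup>2 + \<delta>\<^sup>2) \<le> \<bar>r\<bar> + \<delta>"
    using assms by (intro real_le_lsqrt) (auto simp: power2_sum)
  then show "smooth_pos \<delta> r \<le> max 0 r + \<delta> / 2"
    unfolding smooth_pos_def by (cases "0 \<le> r") (simp_all add: max_def)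
  show "r \<le> smooth_pos \<delta> r" "0 \<le> smooth_pos \<delta> r"
    using 1 unfolding smooth_pos_def abs_le_iff by simp_all
qed

lemma smooth_smooth_pos:
  assumes "0 < \<delta>" "smooth f"
  shows "smooth (\<lambda>x. smooth_pos \<delta> (f x))"
proof -
  have pos: "0 < f x * f x + \<delta>\<^sup>2" for x
    using assms(1) by (simp add: add_nonneg_pos)
  have "smooth (\<lambda>x. (1/2) * (f x + sqrt (f x * f x + \<delta>\<^sup>2)))"
    by (intro smooth_cmult smooth_add smooth_sqrt smooth_mult assms smooth_const pos)
  then show ?thesis by (simp add: smooth_pos_def power2_eq_square)
qed

text \<open>The slope \<open>(1 + r / sqrt (r\<^sup>2 + \<delta>\<^sup>2)) / 2\<close> lies between
  0 and 1, like that of the positive part; this is the property on which the energy estimate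
  rests.\<close>

lemma gradient_smooth_pos:
  assumes "0 < \<delta>" "smooth f"
  obtains k where "0 \<le> k" "k \<le> 1" "gradient (\<lambda>x. smooth_pos \<delta> (f x)) x = k *\<^sub>R gradient f x"
proof -
  define q where "q = sqrt ((f x)\<^sup>2 + \<delta>\<^sup>2)"
  have pos: "0 < (f x)\<^sup>2 + \<delta>\<^sup>2" using assms(1) by (simp add: add_nonneg_pos)
  have q: "0 < q" "\<bar>f x\<bar> \<le> q" using pos by (auto simp: q_def intro!: real_le_rsqrt)
  define k where "k = (1 + f x / q) / 2"
  have "\<bar>f x / q\<bar> \<le> 1" using q by (simp add: abs_divide)
  then have "- 1 \<le> f x / q" "f x / q \<le> 1" unfolding abs_le_iff by linarith+
  then have k: "0 \<le> k" "k \<le> 1" by (auto simp: k_def)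
  have "(smooth_pos \<delta> has_real_derivative k) (at (f x))"
    unfolding smooth_pos_def k_def q_def using pos
    by (auto intro!: derivative_eq_intros simp: field_simps)
  then have "gradient (\<lambda>x. smooth_pos \<delta> (f x)) x = k *\<^sub>R gradient f x"
    by (intro gradient_eqI GDERIV_DERIV_compose smooth_GDERIV assms)
  with k show ?thesis by (rule that)
qed

text \<open>The algebraic core of the energy estimate: \<open>c\<close>, \<open>a\<close> and \<open>k a\<close> stand for the gradients of
  the old test function, of the argument of the smoothed positive part, and of the new test function.\<close>

lemma truncation_energy:
  fixes a c :: "'a::real_inner"
  assumes "0 \<le> k" "k \<le> 1"
  shows "(c - a) \<bullet> (k *\<^sub>R a) \<le> (1/2) * ((norm c)\<^sup>2 - (norm (k *\<^sub>R a))\<^sup>2)"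
proof -
  have "0 \<le> (norm (c - k *\<^sub>R a))\<^sup>2" by simp
  also have "\<dots> = (norm c)\<^sup>2 - 2 * (c \<bullet> (k *\<^sub>R a)) + (norm (k *\<^sub>R a))\<^sup>2"
    by (simp only: power2_norm_eq_inner inner_diff_left inner_diff_right) (simp add: inner_commute)
  finally have 1: "2 * (c \<bullet> (k *\<^sub>R a)) \<le> (norm c)\<^sup>2 + (norm (k *\<^sub>R a))\<^sup>2" by simp
  have "k * (k * (a \<bullet> a)) \<le> 1 * (k * (a \<bullet> a))"
    using assms by (intro mult_right_mono) auto
  then have 2: "(norm (k *\<^sub>R a))\<^sup>2 \<le> a \<bullet> (k *\<^sub>R a)"
    by (simp only: power2_norm_eq_inner inner_scaleR_left inner_scaleR_right mult_1)
  have half: "p - q \<le> (1/2) * (r - s)" if "2 * p \<le> r + s" "s \<le> q" for p q r s :: real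
    using that by simp
  show ?thesis unfolding inner_diff_left by (rule half[OF 1 2])
qed

section \<open>The difference of a subsolution and a supersolution\<close>

locale enthalpy_comparison =
  fixes D :: "'a::euclidean_space set" and Tstar :: ereal and uM :: "'a \<Rightarrow> real" and F :: "'a \<Rightarrow> 'a"
    and u1 m1 u2 m2 :: "'a \<times> real \<Rightarrow> real"
  assumes D: "open D" and bd: "locally_C11_boundary D" and F: "F \<in> L2 D"
    and sub: "neumann_enthalpy_subsolution D Tstar uM F u1 m1"
    and super: "neumann_enthalpy_supersolution D Tstar uM F u2 m2"
begin

definition w :: "real \<Rightarrow> 'a \<Rightarrow> real" where "w t x = u1 (x, t) - u2 (x, t)"

definition b :: "real \<Rightarrow> 'a \<Rightarrow> real" where "b t x = (u1 (x, t) + m1 (x, t)) - (u2 (x, t) + m2 (x, t))"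

text \<open>A bound for the \<open>L2\<close> norm of the gradient of the time integral of
  \<open>w\<close>. It is additive over adjacent intervals, so the cutoff errors of all steps add up
  to a quantity that does not depend on the partition.\<close>

definition gnorm :: "real \<Rightarrow> real \<Rightarrow> real" where
  "gnorm s t = (LINT r|lebesgue_on {s..t}. norm_H1 D (slice u1 r)) + (LINT r|lebesgue_on {s..t}. norm_H1 D (slice u2 r))"

lemma DL: "D \<in> sets lebesgue" using D by auto

lemma pair1: "enthalpy_pair D Tstar uM u1 m1" and pair2: "enthalpy_pair D Tstar uM u2 m2"
  using sub super by (auto simp: neumann_enthalpy_subsolution_def neumann_enthalpy_supersolution_def)

lemma bochner1: "0 < T \<Longrightarrow> ereal T < Tstar \<Longrightarrow> bochner_L2 {0..T} (H1 D) (norm_H1 D) (slice u1)"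
  and bochner2: "0 < T \<Longrightarrow> ereal T < Tstar \<Longrightarrow> bochner_L2 {0..T} (H1 D) (norm_H1 D) (slice u2)"
  using pair1 pair2 unfolding enthalpy_pair_def bochner_L2_loc_def by blast+

lemma bochner_sub:
  assumes "0 \<le> s" "s \<le> t" "t \<le> T" "0 < T" "ereal T < Tstar"
  shows "bochner_L2 {s..t} (H1 D) (norm_H1 D) (slice u1)" "bochner_L2 {s..t} (H1 D) (norm_H1 D) (slice u2)"
  using assms by (auto intro!: bochner_L2_subset[OF bochner1[of T]] bochner_L2_subset[OF bochner2[of T]])

lemma w_L2: "t \<in> times Tstar \<Longrightarrow> w t \<in> L2 D"
  unfolding w_def[abs_def]
  by (intro L2_diff(1) DL enthalpy_pairD(1)[OF D pair1] enthalpy_pairD(1)[OF D pair2])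

lemma b_L2:
  assumes t: "t \<in> times Tstar" and B: "B \<in> lmeasurable" "B \<subseteq> D"
  shows "b t \<in> L2 B" "norm_L2 B (b t) \<le> norm_L2 D (w t) + 2 * sqrt (measure lebesgue B)"
proof -
  have BS: "B \<in> sets lebesgue" using B by auto
  note e1 = enthalpy_L2[OF D pair1 t B] and e2 = enthalpy_L2[OF D pair2 t B]
  show "b t \<in> L2 B"
    unfolding b_def[abs_def] by (rule L2_diff(1)[OF BS e1(3) e2(3)])
  have wB: "w t \<in> L2 B" "norm_L2 B (w t) \<le> norm_L2 D (w t)"
    using L2_subset[OF DL BS B(2) w_L2[OF t]] by auto
  have m: "(\<lambda>x. m1 (x, t) - m2 (x, t)) \<in> L2 B" "norm_L2 B (\<lambda>x. m1 (x, t) - m2 (x, t)) \<le> 2 * sqrt (measure lebesgue B)"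
    using L2_diff[OF BS e1(1) e2(1)] e1(2) e2(2) by auto
  have "b t = (\<lambda>x. w t x + (m1 (x, t) - m2 (x, t)))"
    by (auto simp: b_def w_def)
  then show "norm_L2 B (b t) \<le> norm_L2 D (w t) + 2 * sqrt (measure lebesgue B)"
    using L2_add(2)[OF BS wB(1) m(1)] wB(2) m(2) by simp
qed

text \<open>If \<open>u1 < u2\<close>, then either \<open>uM < u2\<close> and \<open>m2\<close> has
  its largest value 1, or \<open>u1 < uM\<close> and \<open>m1\<close> has its smallest value -1; in
  both cases \<open>m1 \<le> m2\<close>. The same holds with the roles exchanged. So
  \<open>u1 - u2\<close> and \<open>m1 - m2\<close> never have opposite signs, and the sign of their
  sum \<open>b\<close> decides.\<close>

lemma signs:
  assumes t: "t \<in> times Tstar"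
  shows "AE x in lebesgue_on D. (0 < b t x \<longrightarrow> 0 \<le> w t x) \<and> (b t x < 0 \<longrightarrow> w t x \<le> 0)
    \<and> (b t x \<le> 0 \<longrightarrow> u1 (x, t) \<le> u2 (x, t) \<and> m1 (x, t) \<le> m2 (x, t))"
  using enthalpy_pairD(3)[OF D pair1 t] enthalpy_pairD(3)[OF D pair2 t]
proof eventually_elim
  case (elim x)
  have pos: "m2 (x, t) \<le> m1 (x, t)" if "u2 (x, t) < u1 (x, t)"
    using elim that by (cases "uM x < u1 (x, t)") auto
  have neg: "m1 (x, t) \<le> m2 (x, t)" if "u1 (x, t) < u2 (x, t)"
    using elim that by (cases "uM x < u2 (x, t)") auto
  show ?case
    using pos neg unfolding b_def w_def by (cases "u1 (x, t)" "u2 (x, t)" rule: linorder_cases) auto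
qed

text \<open>Both inequalities are tested with the same frozen \<phi>, so the terms with
  \<open>F\<close> cancel. The extensions \<eta>1 and \<eta>2 are obtained separately; only their
  end slices and their fluxes enter.\<close>

lemma static_inequality:
  assumes t: "0 \<le> t1" "t1 < t2" "ereal t2 < Tstar" and \<phi>: "test_function UNIV \<phi>" "\<And>x. 0 \<le> \<phi> x"
  shows "(LINT x|lebesgue_on D. b t2 x * \<phi> x) - (LINT x|lebesgue_on D. b t1 x * \<phi> x)
    \<le> (LINT t|lebesgue_on {t1..t2}. LINT x|lebesgue_on D. wgrad D (slice u2 t) x \<bullet> gradient \<phi> x)
      - (LINT t|lebesgue_on {t1..t2}. LINT x|lebesgue_on D. wgrad D (slice u1 t) x \<bullet> gradient \<phi> x)"
proof -
  note bs = bochner_sub[of t1 t2 t2]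
  have t': "t1 \<le> t2" using t by simp
  obtain R where R: "0 < R" "\<And>x. \<phi> x \<noteq> 0 \<Longrightarrow> x \<in> ball 0 R"
    using test_function_bounded_support[OF \<phi>(1)] by blast
  define B where "B = D \<inter> ball 0 R"
  have B: "B \<in> sets lebesgue" "B \<subseteq> D" "B \<in> lmeasurable"
    using DL by (auto simp: B_def intro!: bounded_set_imp_lmeasurable)
  have z: "\<And>x. x \<in> D \<Longrightarrow> x \<notin> B \<Longrightarrow> \<phi> x = 0" using R(2) by (auto simp: B_def)
  note \<phi>L = test_function_L2(1)[OF DL \<phi>(1)]
  have int: "integrable (lebesgue_on D) (\<lambda>x. G x * \<phi> x)" if "G \<in> L2 B" for G
    using L2_inner_bounded_support(1)[of D B \<phi> G] DL B \<phi>L z that by auto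
  have tt: "t1 \<in> times Tstar" "t2 \<in> times Tstar"
    using t by (auto intro!: times_downward[of _ t2])
  have split: "(LINT x|lebesgue_on D. b t x * \<phi> x)
      = (LINT x|lebesgue_on D. (u1 (x, t) + m1 (x, t)) * \<phi> x) - (LINT x|lebesgue_on D. (u2 (x, t) + m2 (x, t)) * \<phi> x)"
    if "t \<in> times Tstar" for t
    using int[OF enthalpy_L2(3)[OF D pair1 that B(3,2)]] int[OF enthalpy_L2(3)[OF D pair2 that B(3,2)]]
    by (simp add: b_def left_diff_distrib)
  have b1: "bochner_L2 {t1..t2} (H1 D) (norm_H1 D) (slice u1)"
    and b2: "bochner_L2 {t1..t2} (H1 D) (norm_H1 D) (slice u2)" using bs t by auto
  obtain \<eta>1 where \<eta>1: "test_function UNIV \<eta>1" "\<And>z. 0 \<le> \<eta>1 z" "\<And>x. \<eta>1 (x, t1) = \<phi> x" "\<And>x. \<eta>1 (x, t2) = \<phi> x"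
    "enthalpy_flux D F u1 m1 \<eta>1 t1 t2
      = - (LINT t|lebesgue_on {t1..t2}. LINT x|lebesgue_on D. wgrad D (slice u1 t) x \<bullet> gradient \<phi> x)
        - (t2 - t1) * (LINT x|lebesgue_on D. F x \<bullet> gradient \<phi> x)"
    by (rule enthalpy_flux_static[OF D F b1 t' \<phi>]) (rule that, assumption+)
  obtain \<eta>2 where \<eta>2: "test_function UNIV \<eta>2" "\<And>z. 0 \<le> \<eta>2 z" "\<And>x. \<eta>2 (x, t1) = \<phi> x" "\<And>x. \<eta>2 (x, t2) = \<phi> x"
    "enthalpy_flux D F u2 m2 \<eta>2 t1 t2
      = - (LINT t|lebesgue_on {t1..t2}. LINT x|lebesgue_on D. wgrad D (slice u2 t) x \<bullet> gradient \<phi> x)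
        - (t2 - t1) * (LINT x|lebesgue_on D. F x \<bullet> gradient \<phi> x)"
    by (rule enthalpy_flux_static[OF D F b2 t' \<phi>]) (rule that, assumption+)
  have "enthalpy_increment D u1 m1 \<eta>1 t1 t2 \<le> enthalpy_flux D F u1 m1 \<eta>1 t1 t2"
    using sub t t' \<eta>1(1,2) unfolding neumann_enthalpy_subsolution_def by blast
  moreover have "enthalpy_flux D F u2 m2 \<eta>2 t1 t2 \<le> enthalpy_increment D u2 m2 \<eta>2 t1 t2"
    using super t t' \<eta>2(1,2) unfolding neumann_enthalpy_supersolution_def by blast
  ultimately show ?thesis
    unfolding enthalpy_increment_def \<eta>1(3,4,5) \<eta>2(3,4,5) set_lebesgue_integral_eq_restrict[OF DL]
      split[OF tt(1)] split[OF tt(2)] by linarith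
qed

text \<open>One backward step of the construction of the test functions, \<open>\<eta>' \<approx> max 0 (\<eta> + \<Phi> / \<epsilon>)\<close>, where \<open>\<Phi>\<close>
  approximates the time integral of \<open>w\<close>. The set where the positive part is active contributes
  \<open>- \<nabla>\<Phi> \<cdot> \<nabla>\<eta>' = - \<epsilon> (\<nabla>\<eta>' - \<nabla>\<eta>) \<cdot> \<nabla>\<eta>'\<close>, which telescopes, and
  \<open>b (\<eta> - \<eta>') = - b \<Phi> / \<epsilon> \<approx> - (t2 - t1) b w / \<epsilon> \<le> 0\<close>, since \<open>b\<close> and \<open>w\<close> have the same sign.\<close>

lemma one_step_raw:
  fixes \<theta> \<eta> :: "'a \<Rightarrow> real" and R :: real
  defines "B \<equiv> D \<inter> ball 0 R"
  assumes t: "0 \<le> t1" "t1 < t2" "ereal t2 < Tstar"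
    and \<theta>: "smooth \<theta>" "\<And>x. 0 \<le> \<theta> x" "\<And>x. \<theta> x \<le> 1" "\<And>x. x \<notin> cball 0 R' \<Longrightarrow> \<theta> x = 0" "R' < R"
      "\<And>x. norm (gradient \<theta> x) \<le> c" "0 \<le> c"
    and \<eta>: "smooth \<eta>" "\<And>x. 0 \<le> \<eta> x"
    and \<epsilon>: "0 < \<epsilon>" and \<kappa>: "0 < \<kappa>" and \<delta>: "0 < \<delta>"
    and \<omega>1: "\<And>t. t \<in> {t1..t2} \<Longrightarrow> norm_L2 D (\<lambda>x. u1 (x, t) - u1 (x, t2)) \<le> \<omega>"
    and \<omega>2: "\<And>t. t \<in> {t1..t2} \<Longrightarrow> norm_L2 D (\<lambda>x. u2 (x, t) - u2 (x, t2)) \<le> \<omega>"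
  obtains \<eta>' where "smooth \<eta>'" "\<And>x. 0 \<le> \<eta>' x"
    "norm_L2 B \<eta>' \<le> norm_L2 B \<eta> + (2 * \<kappa> + (t2 - t1) * (norm_L2 D (w t2) + 2 * \<omega>)) / \<epsilon> + (\<delta> / 2) * sqrt (measure lebesgue B)"
    "(LINT x|lebesgue_on D. b t2 x * (\<eta> x * \<theta> x)) - \<epsilon> / 2 * (LINT x|lebesgue_on D. \<theta> x * (norm (gradient \<eta> x))\<^sup>2)
     \<le> (LINT x|lebesgue_on D. b t1 x * (\<eta>' x * \<theta> x)) - \<epsilon> / 2 * (LINT x|lebesgue_on D. \<theta> x * (norm (gradient \<eta>' x))\<^sup>2)
      + 2 * \<kappa> * (c * norm_L2 B \<eta>' + norm_L2 B (gradient \<eta>) + (2 * \<kappa> + gnorm t1 t2) / \<epsilon>)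
      + c * norm_L2 B \<eta>' * (2 * \<kappa> + gnorm t1 t2)
      + norm_L2 B (b t2) * ((2 * \<kappa> + 2 * (t2 - t1) * \<omega>) / \<epsilon> + (\<delta> / 2) * sqrt (measure lebesgue B))"
proof -
  define h where "h = t2 - t1"
  have h: "0 < h" using t by (simp add: h_def)
  define m where "m = sqrt (measure lebesgue B)"
  have B: "B \<in> sets lebesgue" "B \<subseteq> D" "bounded B" "B \<in> lmeasurable"
    using DL by (auto simp: B_def intro!: bounded_set_imp_lmeasurable)
  have tt: "t1 \<in> times Tstar" "t2 \<in> times Tstar"
    using t by (auto intro!: times_downward[of _ t2])
  have b1: "bochner_L2 {t1..t2} (H1 D) (norm_H1 D) (slice u1)"
    and b2: "bochner_L2 {t1..t2} (H1 D) (norm_H1 D) (slice u2)" using bochner_sub[of t1 t2 t2] t by auto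
  have I: "{t1..t2} \<in> lmeasurable" by auto
  have Im: "measure lebesgue {t1..t2} = h" using t by (simp add: h_def)
  note z1 = enthalpy_pairD(1)[OF D pair1 tt(2)] and z2 = enthalpy_pairD(1)[OF D pair2 tt(2)]
  let ?J1 = "\<lambda>v. LINT t|lebesgue_on {t1..t2}. LINT x|lebesgue_on D. wgrad D (slice u1 t) x \<bullet> v x"
  let ?J2 = "\<lambda>v. LINT t|lebesgue_on {t1..t2}. LINT x|lebesgue_on D. wgrad D (slice u2 t) x \<bullet> v x"
  obtain \<Phi>1 where \<Phi>1: "smooth \<Phi>1"
    "\<forall>v\<in>L2 D. (\<forall>x. x \<notin> ball 0 R \<longrightarrow> v x = 0) \<longrightarrow>
       \<bar>?J1 v - (LINT x|lebesgue_on D. gradient \<Phi>1 x \<bullet> v x)\<bar> \<le> \<kappa> * norm_L2 D v"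
    "\<forall>z\<in>L2 D. \<forall>\<omega>. (AE t in lebesgue_on {t1..t2}. norm_L2 D (\<lambda>x. slice u1 t x - z x) \<le> \<omega>) \<longrightarrow>
       norm_L2 (D \<inter> ball 0 R) (\<lambda>x. \<Phi>1 x - measure lebesgue {t1..t2} * z x) \<le> \<kappa> + measure lebesgue {t1..t2} * \<omega>"
    "norm_L2 (D \<inter> ball 0 R) (gradient \<Phi>1) \<le> \<kappa> + (LINT t|lebesgue_on {t1..t2}. norm_H1 D (slice u1 t))"
    by (rule time_integral_approximation[OF D bd I b1 \<kappa>, of R]) (rule that, assumption+)
  obtain \<Phi>2 where \<Phi>2: "smooth \<Phi>2"
    "\<forall>v\<in>L2 D. (\<forall>x. x \<notin> ball 0 R \<longrightarrow> v x = 0) \<longrightarrow>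
       \<bar>?J2 v - (LINT x|lebesgue_on D. gradient \<Phi>2 x \<bullet> v x)\<bar> \<le> \<kappa> * norm_L2 D v"
    "\<forall>z\<in>L2 D. \<forall>\<omega>. (AE t in lebesgue_on {t1..t2}. norm_L2 D (\<lambda>x. slice u2 t x - z x) \<le> \<omega>) \<longrightarrow>
       norm_L2 (D \<inter> ball 0 R) (\<lambda>x. \<Phi>2 x - measure lebesgue {t1..t2} * z x) \<le> \<kappa> + measure lebesgue {t1..t2} * \<omega>"
    "norm_L2 (D \<inter> ball 0 R) (gradient \<Phi>2) \<le> \<kappa> + (LINT t|lebesgue_on {t1..t2}. norm_H1 D (slice u2 t))"
    by (rule time_integral_approximation[OF D bd I b2 \<kappa>, of R]) (rule that, assumption+)
  define \<Phi> where "\<Phi> x = \<Phi>1 x - \<Phi>2 x" for x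
  have \<Phi>s: "smooth \<Phi>" unfolding \<Phi>_def by (intro smooth_diff \<Phi>1(1) \<Phi>2(1))
  have \<Phi>g: "gradient \<Phi> x = gradient \<Phi>1 x - gradient \<Phi>2 x" for x
    unfolding \<Phi>_def by (intro gradient_diff \<Phi>1(1) \<Phi>2(1))
  have BL: "q \<in> L2 B" "gradient q \<in> L2 B" if "smooth q" for q
    using L2_continuous_bounded_set[OF B(1,3) smooth_continuous_on[OF that]]
      L2_continuous_bounded_set[OF B(1,3) continuous_on_gradient[OF that]] by auto
  \<comment> \<open>The sign information concerns \<open>w t2\<close>, at the end of the interval,
    whereas \<Phi> approximates a time integral. \<open>X\<close> is the discrepancy, paid for by
    \<kappa> and by the modulus of continuity \<omega>.\<close>
  define X where "X x = \<Phi> x - h * w t2 x" for x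
  have wB: "w t2 \<in> L2 B" "norm_L2 B (w t2) \<le> norm_L2 D (w t2)"
    using L2_subset[OF DL B(1,2) w_L2[OF tt(2)]] by auto
  have XL: "X \<in> L2 B" unfolding X_def by (intro L2_diff(1) B BL \<Phi>s L2_cmult(1) wB)
  have Xn: "norm_L2 B X \<le> 2 * \<kappa> + 2 * h * \<omega>"
  proof -
    have "X = (\<lambda>x. (\<Phi>1 x - h * u1 (x, t2)) - (\<Phi>2 x - h * u2 (x, t2)))"
      by (auto simp: X_def \<Phi>_def w_def algebra_simps)
    moreover have "norm_L2 B (\<lambda>x. \<Phi>1 x - h * u1 (x, t2)) \<le> \<kappa> + h * \<omega>"
    proof -
      have "AE t in lebesgue_on {t1..t2}. norm_L2 D (\<lambda>x. slice u1 t x - u1 (x, t2)) \<le> \<omega>"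
        using \<omega>1 by (intro AE_I2) (simp add: slice_def)
      then show ?thesis using bspec[OF \<Phi>1(3) z1] unfolding Im B_def by blast
    qed
    moreover have "norm_L2 B (\<lambda>x. \<Phi>2 x - h * u2 (x, t2)) \<le> \<kappa> + h * \<omega>"
    proof -
      have "AE t in lebesgue_on {t1..t2}. norm_L2 D (\<lambda>x. slice u2 t x - u2 (x, t2)) \<le> \<omega>"
        using \<omega>2 by (intro AE_I2) (simp add: slice_def)
      then show ?thesis using bspec[OF \<Phi>2(3) z2] unfolding Im B_def by blast
    qed
    moreover have "(\<lambda>x. \<Phi>1 x - h * u1 (x, t2)) \<in> L2 B" "(\<lambda>x. \<Phi>2 x - h * u2 (x, t2)) \<in> L2 B"
      by (intro L2_diff(1) B BL \<Phi>1(1) \<Phi>2(1) L2_cmult(1) L2_subset(1)[OF DL B(1,2)] z1 z2)+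
    ultimately show ?thesis
      using L2_diff(2)[OF B(1), of "\<lambda>x. \<Phi>1 x - h * u1 (x, t2)" "\<lambda>x. \<Phi>2 x - h * u2 (x, t2)"] by simp
  qed
  have \<Phi>n: "norm_L2 B \<Phi> \<le> 2 * \<kappa> + h * (norm_L2 D (w t2) + 2 * \<omega>)"
  proof -
    have "norm_L2 B \<Phi> \<le> norm_L2 B X + norm_L2 B (\<lambda>x. h * w t2 x)"
      using L2_add(2)[OF B(1) XL L2_cmult(1)[OF B(1) wB(1), of h]] by (simp add: X_def)
    also have "norm_L2 B (\<lambda>x. h * w t2 x) \<le> h * norm_L2 D (w t2)"
      using L2_cmult(2)[OF B(1) wB(1), of h] wB(2) h by simp
    finally show ?thesis using Xn by (simp add: algebra_simps)
  qed
  have \<Phi>gn: "norm_L2 B (gradient \<Phi>) \<le> 2 * \<kappa> + gnorm t1 t2"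
  proof -
    have "norm_L2 B (gradient \<Phi>) = norm_L2 B (\<lambda>x. gradient \<Phi>1 x - gradient \<Phi>2 x)"
      by (intro norm_L2_cong B \<Phi>g)
    also have "\<dots> \<le> norm_L2 B (gradient \<Phi>1) + norm_L2 B (gradient \<Phi>2)"
      by (intro L2_diff(2) B BL \<Phi>1(1) \<Phi>2(1))
    finally show ?thesis using \<Phi>1(4) \<Phi>2(4) by (simp add: B_def gnorm_def)
  qed
  \<comment> \<open>The step before truncation. Solved for \<Phi>, it expresses the gradient of
    \<Phi> as \<epsilon> times the difference of the gradients of \<open>f\<close> and \<eta>, which
    is the source of the telescoping.\<close>
  define f where "f x = \<eta> x + (1 / \<epsilon>) * \<Phi> x" for x
  have fs: "smooth f" unfolding f_def by (intro smooth_add smooth_cmult \<eta> \<Phi>s)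
  have fg: "gradient f x = gradient \<eta> x + (1 / \<epsilon>) *\<^sub>R gradient \<Phi> x" for x
    unfolding f_def by (simp only: gradient_add[OF \<eta>(1) smooth_cmult[OF \<Phi>s]] gradient_cmult[OF \<Phi>s])
  define \<eta>' where "\<eta>' x = smooth_pos \<delta> (f x)" for x
  have \<eta>': "smooth \<eta>'" "\<And>x. 0 \<le> \<eta>' x"
    unfolding \<eta>'_def using smooth_smooth_pos[OF \<delta> fs] smooth_pos_bounds[OF \<delta>] by auto
  have gk: "\<exists>k. 0 \<le> k \<and> k \<le> 1 \<and> gradient \<eta>' x = k *\<^sub>R gradient f x" for x
    unfolding \<eta>'_def using gradient_smooth_pos[OF \<delta> fs, of x] by metis
  have \<eta>'n: "norm_L2 B \<eta>' \<le> norm_L2 B \<eta> + (2 * \<kappa> + h * (norm_L2 D (w t2) + 2 * \<omega>)) / \<epsilon> + (\<delta> / 2) * m"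
  proof -
    have cL: "(\<lambda>x. \<delta> / 2) \<in> L2 B" "norm_L2 B (\<lambda>x. \<delta> / 2) \<le> (\<delta> / 2) * m"
      using L2_bounded[OF B(4), of "\<lambda>x. \<delta> / 2" "\<delta> / 2"] \<delta> unfolding m_def by auto
    have aL: "(\<lambda>x. \<bar>\<Phi> x\<bar>) \<in> L2 B" "norm_L2 B (\<lambda>x. \<bar>\<Phi> x\<bar>) = norm_L2 B \<Phi>"
      using L2_mono(1)[OF B(1) BL(1)[OF \<Phi>s], of "\<lambda>x. \<bar>\<Phi> x\<bar>"] L2_measurable[OF B(1) BL(1)[OF \<Phi>s]]
      by (auto simp: norm_L2_def)
    note a2 = L2_cmult[OF B(1) aL(1), of "1 / \<epsilon>"]
    note s1 = L2_add[OF B(1) BL(1)[OF \<eta>(1)] a2(1)]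
    note s2 = L2_add[OF B(1) s1(1) cL(1)]
    have "norm_L2 B \<eta>' \<le> norm_L2 B (\<lambda>x. \<eta> x + (1 / \<epsilon>) * \<bar>\<Phi> x\<bar> + \<delta> / 2)"
    proof (rule L2_mono(2)[OF B(1) s2(1) L2_measurable[OF B(1) BL(1)[OF \<eta>'(1)]]], rule AE_I2)
      fix x
      have "\<eta>' x \<le> max 0 (f x) + \<delta> / 2" unfolding \<eta>'_def by (rule smooth_pos_bounds(3)[OF \<delta>])
      moreover have "(1 / \<epsilon>) * \<Phi> x \<le> (1 / \<epsilon>) * \<bar>\<Phi> x\<bar>" using \<epsilon> by (intro mult_left_mono) auto
      moreover have "0 \<le> (1 / \<epsilon>) * \<bar>\<Phi> x\<bar>" using \<epsilon> by simp
      ultimately have "\<eta>' x \<le> \<eta> x + (1 / \<epsilon>) * \<bar>\<Phi> x\<bar> + \<delta> / 2"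
        unfolding f_def using \<eta>(2)[of x] by (simp only: max_def split: if_splits; linarith)
      then show "norm (\<eta>' x) \<le> norm (\<eta> x + (1 / \<epsilon>) * \<bar>\<Phi> x\<bar> + \<delta> / 2)"
        using \<eta>'(2)[of x] by (simp only: real_norm_def; linarith)
    qed
    also have "\<dots> \<le> norm_L2 B \<eta> + norm_L2 B \<Phi> / \<epsilon> + (\<delta> / 2) * m"
      using s1(2) s2(2) a2(2) aL(2) cL(2) \<epsilon> by simp
    also have "\<dots> \<le> norm_L2 B \<eta> + (2 * \<kappa> + h * (norm_L2 D (w t2) + 2 * \<omega>)) / \<epsilon> + (\<delta> / 2) * m"
      using \<Phi>n \<epsilon> by (intro add_mono divide_right_mono) auto
    finally show ?thesis .
  qed
  \<comment> \<open>\<eta>' need not have compact support. The cutoff makes it admissible, at the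
    price of a term with the gradient of \<theta>.\<close>
  define \<phi> where "\<phi> x = \<eta>' x * \<theta> x" for x
  have \<phi>t: "test_function UNIV \<phi>"
  proof (rule test_functionI[of _ "cball 0 R'"])
    show "smooth \<phi>" unfolding \<phi>_def by (intro smooth_mult \<eta>' \<theta>(1))
  qed (auto simp: \<phi>_def \<theta>(4))
  have \<phi>0: "0 \<le> \<phi> x" for x by (simp add: \<phi>_def \<eta>'(2) \<theta>(2))
  have \<phi>g: "gradient \<phi> x = \<eta>' x *\<^sub>R gradient \<theta> x + \<theta> x *\<^sub>R gradient \<eta>' x" for x
    unfolding \<phi>_def by (rule gradient_mult[OF \<eta>'(1) \<theta>(1)])
  have out: "x \<notin> cball 0 R'" if "x \<notin> ball 0 R" for x using that \<theta>(5) by auto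
  have \<theta>0: "\<theta> x = 0" if "x \<notin> ball 0 R" for x using \<theta>(4)[OF out[OF that]] .
  have \<theta>g0: "gradient \<theta> x = 0" if "x \<notin> ball 0 R" for x
    using gradient_eq_0[of 0 R' \<theta> x] \<theta>(4) out[OF that] by blast
  have \<phi>g0: "gradient \<phi> x = 0" if "x \<notin> ball 0 R" for x
    using \<theta>0[OF that] \<theta>g0[OF that] by (simp add: \<phi>g)
  note \<phi>L = test_function_L2[OF DL \<phi>t]
  have \<theta>m: "\<theta> \<in> borel_measurable (lebesgue_on B)" "gradient \<theta> \<in> borel_measurable (lebesgue_on B)"
    using borel_measurable_lebesgue_on_continuous[OF B(1)] smooth_continuous_on[OF \<theta>(1)]
      continuous_on_gradient[OF \<theta>(1)] by auto
  have \<theta>abs: "\<bar>\<theta> x\<bar> \<le> 1" for x using \<theta>(2,3)[of x] by simp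
  note p1 = L2_scaleR_vector[OF B(1) BL(1)[OF \<eta>'(1)] \<theta>m(2) \<theta>(6,7)]
  note p2 = L2_bounded_scaleR[OF B(1) BL(2)[OF \<eta>'(1)] \<theta>m(1) \<theta>abs zero_le_one]
  have f\<eta>: "norm_L2 B (gradient \<eta>') \<le> norm_L2 B (gradient \<eta>) + (2 * \<kappa> + gnorm t1 t2) / \<epsilon>"
  proof -
    have "norm_L2 B (gradient \<eta>') \<le> norm_L2 B (gradient f)"
    proof (rule L2_mono(2)[OF B(1) BL(2)[OF fs] L2_measurable[OF B(1) BL(2)[OF \<eta>'(1)]]], rule AE_I2)
      fix x
      obtain k where k: "0 \<le> k" "k \<le> 1" "gradient \<eta>' x = k *\<^sub>R gradient f x" using gk by blast
      then show "norm (gradient \<eta>' x) \<le> norm (gradient f x)"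
        by (simp add: mult_left_le_one_le)
    qed
    also have "\<dots> = norm_L2 B (\<lambda>x. gradient \<eta> x + (1 / \<epsilon>) *\<^sub>R gradient \<Phi> x)"
      by (intro norm_L2_cong B fg)
    also have "\<dots> \<le> norm_L2 B (gradient \<eta>) + norm_L2 B (gradient \<Phi>) / \<epsilon>"
      using L2_add(2)[OF B(1) BL(2)[OF \<eta>(1)] L2_scaleR(1)[OF B(1) BL(2)[OF \<Phi>s], of "1 / \<epsilon>"]]
        L2_scaleR(2)[OF B(1) BL(2)[OF \<Phi>s], of "1 / \<epsilon>"] \<epsilon> by simp
    also have "\<dots> \<le> norm_L2 B (gradient \<eta>) + (2 * \<kappa> + gnorm t1 t2) / \<epsilon>"
      using \<Phi>gn \<epsilon> by (intro add_mono divide_right_mono) auto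
    finally show ?thesis .
  qed
  have \<phi>gn: "norm_L2 D (gradient \<phi>) \<le> c * norm_L2 B \<eta>' + norm_L2 B (gradient \<eta>) + (2 * \<kappa> + gnorm t1 t2) / \<epsilon>"
  proof -
    have "norm_L2 D (gradient \<phi>) = norm_L2 B (gradient \<phi>)"
      using \<phi>g0 by (intro L2_extend(2)[OF DL B(1,2) L2_subset(1)[OF DL B(1,2) \<phi>L(2)]]) (auto simp: B_def)
    also have "\<dots> = norm_L2 B (\<lambda>x. \<eta>' x *\<^sub>R gradient \<theta> x + \<theta> x *\<^sub>R gradient \<eta>' x)"
      by (intro norm_L2_cong B \<phi>g)
    also have "\<dots> \<le> norm_L2 B (\<lambda>x. \<eta>' x *\<^sub>R gradient \<theta> x) + norm_L2 B (\<lambda>x. \<theta> x *\<^sub>R gradient \<eta>' x)"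
      by (rule L2_add(2)[OF B(1) p1(1) p2(1)])
    finally show ?thesis using p1(2) p2(2) f\<eta> by simp
  qed
  have restr: "(LINT x|lebesgue_on D. G x) = (LINT x|lebesgue_on B. G x)"
    if "\<And>x. x \<notin> ball 0 R \<Longrightarrow> G x = 0" for G :: "'a \<Rightarrow> real"
  proof -
    have "(\<lambda>x. indicator D x *\<^sub>R G x) = (\<lambda>x. indicator B x *\<^sub>R G x)"
      using that by (intro ext) (auto simp: B_def indicator_def)
    then show ?thesis using DL B(1) by (simp add: integral_restrict_space)
  qed
  \<comment> \<open>The product rule splits the gradient of \<phi>: the part with the gradient of
    \<theta> is the cutoff error, the part with the gradient of \<eta>' is treated pointwise by
    \<open>truncation_energy\<close>, weighted with \<theta>.\<close>
  have energy: "(LINT x|lebesgue_on B. - (gradient \<Phi> x \<bullet> gradient \<phi> x))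
      \<le> c * norm_L2 B \<eta>' * (2 * \<kappa> + gnorm t1 t2)
        + \<epsilon> / 2 * ((LINT x|lebesgue_on B. \<theta> x * (norm (gradient \<eta> x))\<^sup>2) - (LINT x|lebesgue_on B. \<theta> x * (norm (gradient \<eta>' x))\<^sup>2))"
  proof -
    have sq: "integrable (lebesgue_on B) (\<lambda>x. \<theta> x * (norm (gradient q x))\<^sup>2)" if "smooth q" for q
    proof (rule Bochner_Integration.integrable_bound[OF L2_integrable_sq[OF B(1) BL(2)[OF that]]])
      show "(\<lambda>x. \<theta> x * (norm (gradient q x))\<^sup>2) \<in> borel_measurable (lebesgue_on B)"
        using \<theta>m(1) L2_measurable[OF B(1) BL(2)[OF that]] by measurable
      show "AE x in lebesgue_on B. norm (\<theta> x * (norm (gradient q x))\<^sup>2) \<le> norm ((norm (gradient q x))\<^sup>2)"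
        using \<theta>abs by (intro AE_I2) (auto simp: abs_mult intro!: mult_left_le_one_le)
    qed
    have pt: "- (gradient \<Phi> x \<bullet> gradient \<phi> x)
        \<le> - (gradient \<Phi> x \<bullet> (\<eta>' x *\<^sub>R gradient \<theta> x))
          + \<epsilon> / 2 * (\<theta> x * (norm (gradient \<eta> x))\<^sup>2 - \<theta> x * (norm (gradient \<eta>' x))\<^sup>2)" for x
    proof -
      obtain k where k: "0 \<le> k" "k \<le> 1" "gradient \<eta>' x = k *\<^sub>R gradient f x" using gk by blast
      have "- gradient \<Phi> x = \<epsilon> *\<^sub>R (gradient \<eta> x - gradient f x)"
        using \<epsilon> by (simp add: fg)
      then have "- (gradient \<Phi> x \<bullet> gradient \<eta>' x) = \<epsilon> * ((gradient \<eta> x - gradient f x) \<bullet> (k *\<^sub>R gradient f x))"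
        unfolding k(3) by (metis inner_minus_left inner_scaleR_left)
      also have "\<dots> \<le> \<epsilon> * ((1/2) * ((norm (gradient \<eta> x))\<^sup>2 - (norm (k *\<^sub>R gradient f x))\<^sup>2))"
        using \<epsilon> by (intro mult_left_mono truncation_energy k) auto
      finally have "\<theta> x * - (gradient \<Phi> x \<bullet> gradient \<eta>' x)
          \<le> \<theta> x * (\<epsilon> * ((1/2) * ((norm (gradient \<eta> x))\<^sup>2 - (norm (gradient \<eta>' x))\<^sup>2)))"
        unfolding k(3)[symmetric] using \<theta>(2) by (intro mult_left_mono) auto
      then show ?thesis by (simp add: \<phi>g inner_add_right algebra_simps)
    qed
    note i1 = L2_inner[OF B(1) BL(2)[OF \<Phi>s] p1(1)]
    have i0: "integrable (lebesgue_on B) (\<lambda>x. gradient \<Phi> x \<bullet> gradient \<phi> x)"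
      by (rule L2_inner(1)[OF B(1) BL(2)[OF \<Phi>s] L2_subset(1)[OF DL B(1,2) \<phi>L(2)]])
    have "(LINT x|lebesgue_on B. - (gradient \<Phi> x \<bullet> gradient \<phi> x))
        \<le> (LINT x|lebesgue_on B. - (gradient \<Phi> x \<bullet> (\<eta>' x *\<^sub>R gradient \<theta> x))
          + \<epsilon> / 2 * (\<theta> x * (norm (gradient \<eta> x))\<^sup>2 - \<theta> x * (norm (gradient \<eta>' x))\<^sup>2))"
      by (rule integral_mono) (use i0 i1(1) sq[OF \<eta>(1)] sq[OF \<eta>'(1)] pt in auto)
    also have "\<dots> = - (LINT x|lebesgue_on B. gradient \<Phi> x \<bullet> (\<eta>' x *\<^sub>R gradient \<theta> x))
        + \<epsilon> / 2 * ((LINT x|lebesgue_on B. \<theta> x * (norm (gradient \<eta> x))\<^sup>2) - (LINT x|lebesgue_on B. \<theta> x * (norm (gradient \<eta>' x))\<^sup>2))"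
      using i1(1) sq[OF \<eta>(1)] sq[OF \<eta>'(1)] by simp
    also have "- (LINT x|lebesgue_on B. gradient \<Phi> x \<bullet> (\<eta>' x *\<^sub>R gradient \<theta> x)) \<le> norm_L2 B (gradient \<Phi>) * (c * norm_L2 B \<eta>')"
      using i1(2) p1(2) mult_left_mono[OF p1(2) norm_L2_nonneg[of B "gradient \<Phi>"]] by linarith
    also have "\<dots> \<le> (2 * \<kappa> + gnorm t1 t2) * (c * norm_L2 B \<eta>')"
      using \<Phi>gn \<theta>(7) by (intro mult_right_mono) auto
    finally show ?thesis by (simp add: mult.commute)
  qed
  have bL: "b t \<in> L2 B" if "t \<in> times Tstar" for t by (rule b_L2(1)[OF that B(4,2)])
  \<comment> \<open>The weak inequality controls \<open>b t2\<close> against the new function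
    \<phi>. This is the cost of replacing \<phi> by the old product of \<eta> and \<theta>, the
    remainder of the summation by parts.\<close>
  have bterm: "(LINT x|lebesgue_on B. b t2 x * (\<eta> x * \<theta> x)) - (LINT x|lebesgue_on B. b t2 x * \<phi> x)
      \<le> norm_L2 B (b t2) * ((2 * \<kappa> + 2 * h * \<omega>) / \<epsilon> + (\<delta> / 2) * m)"
  proof -
    have YL: "(\<lambda>x. (1 / \<epsilon>) * \<bar>X x\<bar> + \<delta> / 2) \<in> L2 B" "norm_L2 B (\<lambda>x. (1 / \<epsilon>) * \<bar>X x\<bar> + \<delta> / 2) \<le> norm_L2 B X / \<epsilon> + (\<delta> / 2) * m"
    proof -
      have cL: "(\<lambda>x. \<delta> / 2) \<in> L2 B" "norm_L2 B (\<lambda>x. \<delta> / 2) \<le> (\<delta> / 2) * m"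
        using L2_bounded[OF B(4), of "\<lambda>x. \<delta> / 2" "\<delta> / 2"] \<delta> unfolding m_def by auto
      have aL: "(\<lambda>x. \<bar>X x\<bar>) \<in> L2 B" "norm_L2 B (\<lambda>x. \<bar>X x\<bar>) = norm_L2 B X"
        using L2_mono(1)[OF B(1) XL, of "\<lambda>x. \<bar>X x\<bar>"] L2_measurable[OF B(1) XL]
        by (auto simp: norm_L2_def)
      note a2 = L2_cmult[OF B(1) aL(1), of "1 / \<epsilon>"]
      show "(\<lambda>x. (1 / \<epsilon>) * \<bar>X x\<bar> + \<delta> / 2) \<in> L2 B" "norm_L2 B (\<lambda>x. (1 / \<epsilon>) * \<bar>X x\<bar> + \<delta> / 2) \<le> norm_L2 B X / \<epsilon> + (\<delta> / 2) * m"
        using L2_add[OF B(1) a2(1) cL(1)] a2(2) aL(2) cL(2) \<epsilon> by auto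
    qed
    note bi = L2_mult_integrable[OF B(1) bL[OF tt(2)] YL(1)]
    have le: "AE x in lebesgue_on B. b t2 x * (\<eta> x * \<theta> x) - b t2 x * \<phi> x \<le> norm (b t2 x) * norm ((1 / \<epsilon>) * \<bar>X x\<bar> + \<delta> / 2)"
    proof -
      have "AE x in lebesgue. x \<in> D \<longrightarrow> (0 < b t2 x \<longrightarrow> 0 \<le> w t2 x) \<and> (b t2 x < 0 \<longrightarrow> w t2 x \<le> 0)"
      proof -
        have "AE x in lebesgue. x \<in> D \<longrightarrow> (0 < b t2 x \<longrightarrow> 0 \<le> w t2 x) \<and> (b t2 x < 0 \<longrightarrow> w t2 x \<le> 0)
            \<and> (b t2 x \<le> 0 \<longrightarrow> u1 (x, t2) \<le> u2 (x, t2) \<and> m1 (x, t2) \<le> m2 (x, t2))"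
          using signs[OF tt(2)] unfolding AE_eq_restrict[OF DL] .
        then show ?thesis by (rule eventually_mono) blast
      qed
      then have "AE x in lebesgue. x \<in> B \<longrightarrow> (0 < b t2 x \<longrightarrow> 0 \<le> w t2 x) \<and> (b t2 x < 0 \<longrightarrow> w t2 x \<le> 0)"
        by eventually_elim (use B(2) in auto)
      then have "AE x in lebesgue_on B. (0 < b t2 x \<longrightarrow> 0 \<le> w t2 x) \<and> (b t2 x < 0 \<longrightarrow> w t2 x \<le> 0)"
        by (rule iffD1[OF AE_eq_restrict[OF B(1)]])
      then show ?thesis
      proof eventually_elim
        case (elim x)
        define y where "y = (1 / \<epsilon>) * \<bar>X x\<bar> + \<delta> / 2"
        have X0: "0 \<le> (1 / \<epsilon>) * \<bar>X x\<bar>" using \<epsilon> by simp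
        then have y: "0 \<le> y" using \<delta> by (simp add: y_def)
        \<comment> \<open>For positive \<open>b\<close> the lower bound
          \<open>f \<le> \<eta>'\<close> is enough. For negative \<open>b\<close> the upper bound
          for \<eta>' enters, and where the truncation is active \<open>0 \<le> \<eta>\<close> takes
          the place of the comparison with \<open>f\<close>.\<close>
        have core: "b t2 x * (\<eta> x - \<eta>' x) \<le> \<bar>b t2 x\<bar> * y"
        proof (cases "b t2 x" "0::real" rule: linorder_cases)
          case greater
          then have "0 \<le> h * w t2 x" using elim h by simp
          then have "- \<Phi> x \<le> \<bar>X x\<bar>" by (simp add: X_def)
          then have "(1 / \<epsilon>) * - \<Phi> x \<le> (1 / \<epsilon>) * \<bar>X x\<bar>" using \<epsilon> by (intro mult_left_mono) auto
          moreover have "f x \<le> \<eta>' x" unfolding \<eta>'_def by (rule smooth_pos_bounds(1)[OF \<delta>])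
          ultimately have "\<eta> x - \<eta>' x \<le> y" using \<delta> unfolding f_def y_def by (simp only: mult_minus_right; linarith)
          with greater show ?thesis by simp
        next
          case less
          then have "h * w t2 x \<le> 0" using elim h by (simp add: mult_nonneg_nonpos)
          then have "\<Phi> x \<le> \<bar>X x\<bar>" by (simp add: X_def)
          then have "(1 / \<epsilon>) * \<Phi> x \<le> (1 / \<epsilon>) * \<bar>X x\<bar>" using \<epsilon> by (intro mult_left_mono) auto
          moreover have "\<eta>' x \<le> max 0 (f x) + \<delta> / 2" unfolding \<eta>'_def by (rule smooth_pos_bounds(3)[OF \<delta>])
          ultimately have "\<eta>' x - \<eta> x \<le> y"
            using \<eta>(2)[of x] X0 unfolding f_def y_def by (simp only: max_def split: if_splits; linarith)
          then have "\<bar>b t2 x\<bar> * (\<eta>' x - \<eta> x) \<le> \<bar>b t2 x\<bar> * y" by (intro mult_left_mono) auto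
          with less show ?thesis by (simp add: algebra_simps)
        qed simp
        have "b t2 x * (\<eta> x * \<theta> x) - b t2 x * \<phi> x = \<theta> x * (b t2 x * (\<eta> x - \<eta>' x))"
          by (simp add: \<phi>_def algebra_simps)
        also have "\<dots> \<le> \<theta> x * (\<bar>b t2 x\<bar> * y)" using core \<theta>(2) by (intro mult_left_mono) auto
        also have "\<dots> \<le> \<bar>b t2 x\<bar> * y" using \<theta>(2,3) y by (intro mult_left_le_one_le) auto
        finally show ?case using y by (simp add: y_def)
      qed
    qed
    have \<eta>\<theta>: "(\<lambda>x. \<eta> x * \<theta> x) \<in> L2 B" "\<phi> \<in> L2 B"
      using BL(1)[OF smooth_mult[OF \<eta>(1) \<theta>(1)]] L2_subset(1)[OF DL B(1,2) \<phi>L(1)] by auto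
    note j1 = L2_mult(1)[OF B(1) bL[OF tt(2)] \<eta>\<theta>(1)] and j2 = L2_mult(1)[OF B(1) bL[OF tt(2)] \<eta>\<theta>(2)]
    have "(LINT x|lebesgue_on B. b t2 x * (\<eta> x * \<theta> x)) - (LINT x|lebesgue_on B. b t2 x * \<phi> x)
        = (LINT x|lebesgue_on B. b t2 x * (\<eta> x * \<theta> x) - b t2 x * \<phi> x)"
      using j1 j2 by simp
    also have "\<dots> \<le> (LINT x|lebesgue_on B. norm (b t2 x) * norm ((1 / \<epsilon>) * \<bar>X x\<bar> + \<delta> / 2))"
      by (rule integral_mono_AE[OF Bochner_Integration.integrable_diff[OF j1 j2] bi le])
    also have "\<dots> \<le> norm_L2 B (b t2) * norm_L2 B (\<lambda>x. (1 / \<epsilon>) * \<bar>X x\<bar> + \<delta> / 2)"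
      by (rule L2_Cauchy_Schwarz_norm[OF B(1) bL[OF tt(2)] YL(1)])
    also have "\<dots> \<le> norm_L2 B (b t2) * ((2 * \<kappa> + 2 * h * \<omega>) / \<epsilon> + (\<delta> / 2) * m)"
    proof (intro mult_left_mono order_trans[OF YL(2)] add_mono)
      show "norm_L2 B X / \<epsilon> \<le> (2 * \<kappa> + 2 * h * \<omega>) / \<epsilon>" using Xn \<epsilon> by (intro divide_right_mono) auto
    qed (use \<delta> in auto)
    finally show ?thesis .
  qed
  \<comment> \<open>\<Phi>1 and \<Phi>2 replace the time integrals of the gradient pairings, each at
    the cost of \<kappa> times the norm of the gradient of \<phi>.\<close>
  have flux: "(LINT x|lebesgue_on D. b t2 x * \<phi> x) - (LINT x|lebesgue_on D. b t1 x * \<phi> x)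
      \<le> (LINT x|lebesgue_on B. - (gradient \<Phi> x \<bullet> gradient \<phi> x)) + 2 * \<kappa> * norm_L2 D (gradient \<phi>)"
  proof -
    let ?G = "\<lambda>q. LINT x|lebesgue_on D. gradient q x \<bullet> gradient \<phi> x"
    have G: "?G q = (LINT x|lebesgue_on B. gradient q x \<bullet> gradient \<phi> x)" for q
      by (rule restr) (simp add: \<phi>g0)
    have i: "integrable (lebesgue_on B) (\<lambda>x. gradient q x \<bullet> gradient \<phi> x)" if "smooth q" for q
      by (rule L2_inner(1)[OF B(1) BL(2)[OF that] L2_subset(1)[OF DL B(1,2) \<phi>L(2)]])
    have "(LINT x|lebesgue_on B. - (gradient \<Phi> x \<bullet> gradient \<phi> x)) = ?G \<Phi>2 - ?G \<Phi>1"
      unfolding G using i[OF \<Phi>1(1)] i[OF \<Phi>2(1)] by (simp add: \<Phi>g inner_diff_left)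
    moreover have "\<bar>?J1 (gradient \<phi>) - ?G \<Phi>1\<bar> \<le> \<kappa> * norm_L2 D (gradient \<phi>)"
      using bspec[OF \<Phi>1(2) \<phi>L(2)] \<phi>g0 by blast
    moreover have "\<bar>?J2 (gradient \<phi>) - ?G \<Phi>2\<bar> \<le> \<kappa> * norm_L2 D (gradient \<phi>)"
      using bspec[OF \<Phi>2(2) \<phi>L(2)] \<phi>g0 by blast
    ultimately show ?thesis
      using static_inequality[OF t \<phi>t \<phi>0] by linarith
  qed
  have e1: "(LINT x|lebesgue_on D. b t2 x * (\<eta> x * \<theta> x)) = (LINT x|lebesgue_on B. b t2 x * (\<eta> x * \<theta> x))"
    "(LINT x|lebesgue_on D. b t2 x * \<phi> x) = (LINT x|lebesgue_on B. b t2 x * \<phi> x)"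
    "(LINT x|lebesgue_on D. \<theta> x * (norm (gradient \<eta> x))\<^sup>2) = (LINT x|lebesgue_on B. \<theta> x * (norm (gradient \<eta> x))\<^sup>2)"
    "(LINT x|lebesgue_on D. \<theta> x * (norm (gradient \<eta>' x))\<^sup>2) = (LINT x|lebesgue_on B. \<theta> x * (norm (gradient \<eta>' x))\<^sup>2)"
    by (rule restr, simp add: \<theta>0 \<phi>_def)+
  have k\<phi>: "2 * \<kappa> * norm_L2 D (gradient \<phi>)
      \<le> 2 * \<kappa> * (c * norm_L2 B \<eta>' + norm_L2 B (gradient \<eta>) + (2 * \<kappa> + gnorm t1 t2) / \<epsilon>)"
    using \<phi>gn \<kappa> by (intro mult_left_mono) auto
  show ?thesis
  proof (rule that[OF \<eta>'])
    show "norm_L2 B \<eta>' \<le> norm_L2 B \<eta> + (2 * \<kappa> + (t2 - t1) * (norm_L2 D (w t2) + 2 * \<omega>)) / \<epsilon> + (\<delta> / 2) * sqrt (measure lebesgue B)"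
      using \<eta>'n by (simp add: h_def m_def)
    have "(LINT x|lebesgue_on D. b t2 x * (\<eta> x * \<theta> x)) - \<epsilon> / 2 * (LINT x|lebesgue_on D. \<theta> x * (norm (gradient \<eta> x))\<^sup>2)
     \<le> (LINT x|lebesgue_on D. b t1 x * \<phi> x) - \<epsilon> / 2 * (LINT x|lebesgue_on D. \<theta> x * (norm (gradient \<eta>' x))\<^sup>2)
      + 2 * \<kappa> * (c * norm_L2 B \<eta>' + norm_L2 B (gradient \<eta>) + (2 * \<kappa> + gnorm t1 t2) / \<epsilon>)
      + c * norm_L2 B \<eta>' * (2 * \<kappa> + gnorm t1 t2)
      + norm_L2 B (b t2) * ((2 * \<kappa> + 2 * h * \<omega>) / \<epsilon> + (\<delta> / 2) * m)"
      using flux energy bterm k\<phi> unfolding e1 right_diff_distrib by linarith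
    then show "(LINT x|lebesgue_on D. b t2 x * (\<eta> x * \<theta> x)) - \<epsilon> / 2 * (LINT x|lebesgue_on D. \<theta> x * (norm (gradient \<eta> x))\<^sup>2)
     \<le> (LINT x|lebesgue_on D. b t1 x * (\<eta>' x * \<theta> x)) - \<epsilon> / 2 * (LINT x|lebesgue_on D. \<theta> x * (norm (gradient \<eta>' x))\<^sup>2)
      + 2 * \<kappa> * (c * norm_L2 B \<eta>' + norm_L2 B (gradient \<eta>) + (2 * \<kappa> + gnorm t1 t2) / \<epsilon>)
      + c * norm_L2 B \<eta>' * (2 * \<kappa> + gnorm t1 t2)
      + norm_L2 B (b t2) * ((2 * \<kappa> + 2 * (t2 - t1) * \<omega>) / \<epsilon> + (\<delta> / 2) * sqrt (measure lebesgue B))"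
      by (simp only: \<phi>_def h_def m_def)
  qed
qed

end

section \<open>Choice of the tolerances and the backward iteration\<close>

lemma small_parameters:
  fixes \<alpha> \<epsilon> c M N g C m :: real
  assumes "0 < \<alpha>" "0 < \<epsilon>" "0 \<le> c" "0 \<le> M" "0 \<le> N" "0 \<le> g" "0 \<le> C" "0 \<le> m"
  obtains \<kappa> \<delta> where "0 < \<kappa>" "0 < \<delta>" "2 * \<kappa> / \<epsilon> + \<delta> / 2 * m \<le> \<alpha>"
    "2 * \<kappa> * (c * M + N + (2 * \<kappa> + g) / \<epsilon>) + c * M * (2 * \<kappa>) + C * (2 * \<kappa> / \<epsilon> + \<delta> / 2 * m) \<le> \<alpha>"
proof -
  define q1 q2 q3 q4 where "q1 = c * M" and "q2 = (2 + g) / \<epsilon>" and "q3 = 2 * C / \<epsilon>" and "q4 = 2 / \<epsilon>"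
  have nn: "0 \<le> q1" "0 \<le> q2" "0 \<le> q3" "0 \<le> q4" using assms by (auto simp: q1_def q2_def q3_def q4_def)
  \<comment> \<open>\<open>P\<close> collects the coefficients of \<kappa> once
    \<open>\<kappa> \<le> 1\<close> has made the only quadratic term linear. Below, \<open>S\<close>
    also covers the separate condition on \<open>2 * \<kappa> / \<epsilon>\<close>.\<close>
  define P where "P = 2 * (q1 + N + q2) + 2 * q1 + q3"
  have P: "0 \<le> P"
    unfolding P_def using nn assms(5) by (intro add_nonneg_nonneg mult_nonneg_nonneg) auto
  define S where "S = P + q4 + 1"
  have S: "1 \<le> S" "q4 \<le> S" "P \<le> S" using P nn(4) by (auto simp: S_def)
  define \<kappa> where "\<kappa> = min 1 (\<alpha> / 2 / S)"
  have "0 < \<alpha> / 2 / S" using assms(1) S(1) by (intro divide_pos_pos) linarith+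
  then have \<kappa>: "0 < \<kappa>" "\<kappa> \<le> 1" by (auto simp: \<kappa>_def)
  have \<kappa>S: "\<kappa> * S \<le> \<alpha> / 2"
  proof -
    have "\<kappa> * S \<le> (\<alpha> / 2 / S) * S" using S by (intro mult_right_mono) (auto simp: \<kappa>_def)
    also have "\<dots> = \<alpha> / 2" using S by simp
    finally show ?thesis .
  qed
  \<comment> \<open>It dominates both \<open>m\<close> and \<open>C * m\<close>, so a single
    \<delta> settles the two conditions, also when these numbers vanish.\<close>
  define p where "p = (C + 1) * (m + 1)"
  have p: "1 \<le> p" "m \<le> p" "C * m \<le> p" using assms(7,8) by (auto simp: p_def algebra_simps add_nonneg_nonneg)
  define \<delta> where "\<delta> = \<alpha> / 2 / p"
  have \<delta>: "0 < \<delta>" unfolding \<delta>_def using assms(1) p by (intro divide_pos_pos) linarith+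
  have \<delta>p: "\<delta> * p = \<alpha> / 2" using p by (simp add: \<delta>_def)
  have \<delta>m: "\<delta> * m \<le> \<alpha> / 2" "\<delta> * (C * m) \<le> \<alpha> / 2"
    unfolding \<delta>p[symmetric] using \<delta> p by (auto intro!: mult_left_mono)
  show ?thesis
  proof (rule that[OF \<kappa>(1) \<delta>])
    have "\<kappa> * q4 \<le> \<kappa> * S"
      using S(2) \<kappa>(1) by (intro mult_left_mono) auto
    also note \<kappa>S
    also have "\<kappa> * q4 = 2 * \<kappa> / \<epsilon>" by (simp add: q4_def)
    finally have "2 * \<kappa> / \<epsilon> \<le> \<alpha> / 2" .
    moreover have "\<delta> / 2 * m \<le> \<alpha> / 2" using \<delta>m(1) assms(1) by simp
    ultimately show "2 * \<kappa> / \<epsilon> + \<delta> / 2 * m \<le> \<alpha>" by linarith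
    have 1: "2 * \<kappa> * (c * M + N + (2 * \<kappa> + g) / \<epsilon>) \<le> 2 * \<kappa> * (c * M + N + (2 + g) / \<epsilon>)"
      using \<kappa> assms(2) by (intro mult_left_mono add_left_mono divide_right_mono) auto
    have "2 * \<kappa> * (c * M + N + (2 + g) / \<epsilon>) + c * M * (2 * \<kappa>) + C * (2 * \<kappa> / \<epsilon>)
        = \<kappa> * P"
      unfolding P_def q1_def q2_def q3_def by (simp add: algebra_simps)
    also have "\<dots> \<le> \<kappa> * S"
      using S(3) \<kappa>(1) by (intro mult_left_mono) auto
    finally have 2: "2 * \<kappa> * (c * M + N + (2 + g) / \<epsilon>) + c * M * (2 * \<kappa>) + C * (2 * \<kappa> / \<epsilon>) \<le> \<alpha> / 2"
      using \<kappa>S by linarith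
    have 3: "C * (\<delta> / 2 * m) \<le> \<alpha> / 2"
      using \<delta>m(2) assms(1) by (simp add: algebra_simps)
    show "2 * \<kappa> * (c * M + N + (2 * \<kappa> + g) / \<epsilon>) + c * M * (2 * \<kappa>) + C * (2 * \<kappa> / \<epsilon> + \<delta> / 2 * m) \<le> \<alpha>"
      using 1 2 3 unfolding distrib_left[of C] by linarith
  qed
qed

context enthalpy_comparison
begin

text \<open>Up to errors, a backward step does not decrease this quantity. At time 0 it is at most
  zero by the initial inequality, and at time \<open>T\<close> it differs from the integral to be
  estimated by a term of order \<epsilon>.\<close>

definition energy :: "real \<Rightarrow> ('a \<Rightarrow> real) \<Rightarrow> real \<Rightarrow> ('a \<Rightarrow> real) \<Rightarrow> real" where
  "energy \<epsilon> \<theta> t \<eta> = (LINT x|lebesgue_on D. b t x * (\<eta> x * \<theta> x))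
    - \<epsilon> / 2 * (LINT x|lebesgue_on D. \<theta> x * (norm (gradient \<eta> x))\<^sup>2)"

lemma gnorm_nonneg: "0 \<le> gnorm s t"
  unfolding gnorm_def by (intro add_nonneg_nonneg integral_nonneg_AE) auto

lemma gnorm_add:
  assumes "0 \<le> r" "r \<le> s" "s \<le> t" "t \<le> T" "0 < T" "ereal T < Tstar"
  shows "gnorm r t = gnorm r s + gnorm s t"
proof -
  have I: "{r..t} \<in> lmeasurable" by auto
  have "bochner_L2 {r..t} (H1 D) (norm_H1 D) (slice u1)" "bochner_L2 {r..t} (H1 D) (norm_H1 D) (slice u2)"
    using bochner_sub[of r t T] assms by auto
  from this[THEN bochner_norm_integrable[OF I]] show ?thesis
    unfolding gnorm_def using assms(2,3)
    by (simp add: Equivalence_Measurable_On_Borel.integral_combine[of r t _ s])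
qed

text \<open>Here \<kappa> and \<delta> disappear: they may depend on the gradient of the current
  \<eta> and are absorbed into \<alpha>. The errors that remain can be summed over a partition,
  being prescribed freely, proportional to the length of the interval, or proportional to
  \<open>gnorm\<close>.\<close>

lemma one_step:
  fixes \<theta> \<eta> :: "'a \<Rightarrow> real" and R :: real
  defines "B \<equiv> D \<inter> ball 0 R"
  assumes t: "0 \<le> t1" "t1 < t2" "ereal t2 < Tstar"
    and \<theta>: "smooth \<theta>" "\<And>x. 0 \<le> \<theta> x" "\<And>x. \<theta> x \<le> 1" "\<And>x. x \<notin> cball 0 R' \<Longrightarrow> \<theta> x = 0" "R' < R"
      "\<And>x. norm (gradient \<theta> x) \<le> c" "0 \<le> c"
    and \<eta>: "smooth \<eta>" "\<And>x. 0 \<le> \<eta> x"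
    and \<epsilon>: "0 < \<epsilon>" and \<alpha>: "0 < \<alpha>"
    and \<omega>1: "\<And>t. t \<in> {t1..t2} \<Longrightarrow> norm_L2 D (\<lambda>x. u1 (x, t) - u1 (x, t2)) \<le> \<omega>"
    and \<omega>2: "\<And>t. t \<in> {t1..t2} \<Longrightarrow> norm_L2 D (\<lambda>x. u2 (x, t) - u2 (x, t2)) \<le> \<omega>"
    and \<omega>: "0 \<le> \<omega>" and V: "norm_L2 D (w t2) + 2 * \<omega> \<le> V" and C: "norm_L2 B (b t2) \<le> C"
  obtains \<eta>' where "smooth \<eta>'" "\<And>x. 0 \<le> \<eta>' x"
    "norm_L2 B \<eta>' \<le> norm_L2 B \<eta> + (t2 - t1) * V / \<epsilon> + \<alpha>"
    "energy \<epsilon> \<theta> t2 \<eta> \<le> energy \<epsilon> \<theta> t1 \<eta>' + \<alpha> + C * (2 * (t2 - t1) * \<omega> / \<epsilon>) + c * norm_L2 B \<eta>' * gnorm t1 t2"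
proof -
  define h where "h = t2 - t1"
  have h: "0 < h" using t by (simp add: h_def)
  define m where "m = sqrt (measure lebesgue B)"
  define N where "N = norm_L2 B (gradient \<eta>)"
  \<comment> \<open>A bound for the norm of \<eta>' that has to be fixed before \<kappa> and
    \<delta> are chosen; it is confirmed afterwards, by means of the first condition on
    them.\<close>
  define M where "M = norm_L2 B \<eta> + h * V / \<epsilon> + \<alpha>"
  define g where "g = gnorm t1 t2"
  have C0: "0 \<le> C" using C norm_L2_nonneg order_trans by blast
  have V0: "0 \<le> V" using V \<omega> norm_L2_nonneg[of D "w t2"] by linarith
  have M0: "0 \<le> M" unfolding M_def using h V0 \<epsilon> \<alpha> by (intro add_nonneg_nonneg) auto
  obtain \<kappa> \<delta> where \<kappa>: "0 < \<kappa>" and \<delta>: "0 < \<delta>" and p1: "2 * \<kappa> / \<epsilon> + \<delta> / 2 * m \<le> \<alpha>"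
    and p2: "2 * \<kappa> * (c * M + N + (2 * \<kappa> + g) / \<epsilon>) + c * M * (2 * \<kappa>) + C * (2 * \<kappa> / \<epsilon> + \<delta> / 2 * m) \<le> \<alpha>"
    by (rule small_parameters[OF \<alpha> \<epsilon> \<theta>(7) M0 _ _ C0, of N g m])
       (auto simp: N_def g_def m_def gnorm_nonneg)
  obtain \<eta>' where \<eta>': "smooth \<eta>'" "\<And>x. 0 \<le> \<eta>' x"
    and n: "norm_L2 B \<eta>' \<le> norm_L2 B \<eta> + (2 * \<kappa> + h * (norm_L2 D (w t2) + 2 * \<omega>)) / \<epsilon> + (\<delta> / 2) * m"
    and E: "energy \<epsilon> \<theta> t2 \<eta> \<le> energy \<epsilon> \<theta> t1 \<eta>'
      + 2 * \<kappa> * (c * norm_L2 B \<eta>' + N + (2 * \<kappa> + g) / \<epsilon>)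
      + c * norm_L2 B \<eta>' * (2 * \<kappa> + g)
      + norm_L2 B (b t2) * ((2 * \<kappa> + 2 * h * \<omega>) / \<epsilon> + (\<delta> / 2) * m)"
    by (rule one_step_raw[OF t \<theta> \<eta> \<epsilon> \<kappa> \<delta> \<omega>1 \<omega>2])
       (assumption | (rule that, assumption, assumption,
         (simp only: h_def m_def N_def g_def energy_def B_def)+))+
  have n': "norm_L2 B \<eta>' \<le> M"
  proof -
    have "(2 * \<kappa> + h * (norm_L2 D (w t2) + 2 * \<omega>)) / \<epsilon> \<le> (2 * \<kappa> + h * V) / \<epsilon>"
      using V h \<epsilon> by (intro divide_right_mono add_left_mono mult_left_mono) auto
    also have "\<dots> = 2 * \<kappa> / \<epsilon> + h * V / \<epsilon>" by (rule add_divide_distrib)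
    finally show ?thesis using n p1 unfolding M_def by linarith
  qed
  have cn: "c * norm_L2 B \<eta>' \<le> c * M" using n' \<theta>(7) by (rule mult_left_mono)
  have "2 * \<kappa> * (c * norm_L2 B \<eta>' + N + (2 * \<kappa> + g) / \<epsilon>) \<le> 2 * \<kappa> * (c * M + N + (2 * \<kappa> + g) / \<epsilon>)"
    using cn \<kappa> by (intro mult_left_mono) auto
  moreover have "c * norm_L2 B \<eta>' * (2 * \<kappa> + g) \<le> c * M * (2 * \<kappa>) + c * norm_L2 B \<eta>' * g"
    using mult_right_mono[OF cn, of "2 * \<kappa>"] \<kappa> by (simp add: distrib_left)
  moreover have "norm_L2 B (b t2) * ((2 * \<kappa> + 2 * h * \<omega>) / \<epsilon> + (\<delta> / 2) * m)
      \<le> C * (2 * \<kappa> / \<epsilon> + \<delta> / 2 * m) + C * (2 * h * \<omega> / \<epsilon>)"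
  proof -
    have "0 \<le> (2 * \<kappa> + 2 * h * \<omega>) / \<epsilon> + (\<delta> / 2) * m"
      using \<kappa> h \<omega> \<epsilon> \<delta> by (auto simp: m_def)
    then have "norm_L2 B (b t2) * ((2 * \<kappa> + 2 * h * \<omega>) / \<epsilon> + (\<delta> / 2) * m)
        \<le> C * ((2 * \<kappa> + 2 * h * \<omega>) / \<epsilon> + (\<delta> / 2) * m)"
      by (rule mult_right_mono[OF C])
    also have "\<dots> = C * (2 * \<kappa> / \<epsilon> + \<delta> / 2 * m) + C * (2 * h * \<omega> / \<epsilon>)"
      by (simp add: add_divide_distrib distrib_left)
    finally show ?thesis .
  qed
  ultimately have "energy \<epsilon> \<theta> t2 \<eta> \<le> energy \<epsilon> \<theta> t1 \<eta>' + \<alpha> + C * (2 * h * \<omega> / \<epsilon>) + c * norm_L2 B \<eta>' * g"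
    using E p2 by linarith
  then show ?thesis
    using \<eta>' n' by (intro that[of \<eta>']) (auto simp: M_def h_def g_def)
qed

text \<open>No partition is written down. The bisection principle \<open>Bolzano\<close> yields the
  property for \<open>[0, T]\<close> from its stability under concatenation and its validity on
  short intervals around each point, where continuity in time keeps the oscillation of
  \<open>u1\<close> and \<open>u2\<close> below \<omega>.\<close>

lemma backward_iteration:
  fixes \<theta> \<eta>0 :: "'a \<Rightarrow> real" and R :: real
  defines "B \<equiv> D \<inter> ball 0 R"
  assumes T: "0 < T" "ereal T < Tstar"
    and \<theta>: "smooth \<theta>" "\<And>x. 0 \<le> \<theta> x" "\<And>x. \<theta> x \<le> 1" "\<And>x. x \<notin> cball 0 R' \<Longrightarrow> \<theta> x = 0" "R' < R"
      "\<And>x. norm (gradient \<theta> x) \<le> c" "0 \<le> c"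
    and \<eta>0: "smooth \<eta>0" "\<And>x. 0 \<le> \<eta>0 x"
    and \<epsilon>: "0 < \<epsilon>" and \<alpha>0: "0 < \<alpha>0" and \<omega>: "0 < \<omega>"
    and V: "\<And>t. t \<in> {0..T} \<Longrightarrow> norm_L2 D (w t) + 2 * \<omega> \<le> V"
    and C: "\<And>t. t \<in> {0..T} \<Longrightarrow> norm_L2 B (b t) \<le> C"
  obtains \<eta>' where "smooth \<eta>'" "\<And>x. 0 \<le> \<eta>' x"
    "energy \<epsilon> \<theta> T \<eta>0 \<le> energy \<epsilon> \<theta> 0 \<eta>' + \<alpha>0 + C * (2 * T * \<omega> / \<epsilon>)
      + c * (norm_L2 B \<eta>0 + T * V / \<epsilon> + \<alpha>0) * gnorm 0 T"
proof -
  \<comment> \<open>A common bound for the \<open>L2\<close> norms of all test functions in the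
    iteration; with it the cutoff errors become multiples of \<open>gnorm\<close> and can be
    added.\<close>
  define K where "K = norm_L2 B \<eta>0 + T * V / \<epsilon> + \<alpha>0"
  \<comment> \<open>The hypothesis with \<open>K\<close> says that the growth of the norm on
    \<open>[s, t]\<close> still fits into the common bound. \<alpha> is quantified inside
    \<open>Q\<close>, so that two intervals can share it in equal halves.\<close>
  define Q where "Q s t \<longleftrightarrow> (0 \<le> s \<longrightarrow> s \<le> t \<longrightarrow> t \<le> T \<longrightarrow>
      (\<forall>\<eta> \<alpha>. smooth \<eta> \<and> (\<forall>x. 0 \<le> \<eta> x) \<and> 0 < \<alpha> \<and> norm_L2 B \<eta> + (t - s) * V / \<epsilon> + \<alpha> \<le> K \<longrightarrow>
        (\<exists>\<eta>'. smooth \<eta>' \<and> (\<forall>x. 0 \<le> \<eta>' x) \<and> norm_L2 B \<eta>' \<le> norm_L2 B \<eta> + (t - s) * V / \<epsilon> + \<alpha> \<and>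
          energy \<epsilon> \<theta> t \<eta> \<le> energy \<epsilon> \<theta> s \<eta>' + \<alpha> + C * (2 * (t - s) * \<omega> / \<epsilon>) + c * K * gnorm s t)))" for s t
  have QD: "\<exists>\<eta>'. smooth \<eta>' \<and> (\<forall>x. 0 \<le> \<eta>' x) \<and> norm_L2 B \<eta>' \<le> norm_L2 B \<eta> + (t - s) * V / \<epsilon> + \<alpha> \<and>
        energy \<epsilon> \<theta> t \<eta> \<le> energy \<epsilon> \<theta> s \<eta>' + \<alpha> + C * (2 * (t - s) * \<omega> / \<epsilon>) + c * K * gnorm s t"
    if "Q s t" "0 \<le> s" "s \<le> t" "t \<le> T" "smooth \<eta>" "\<forall>x. 0 \<le> \<eta> x" "0 < \<alpha>"
      "norm_L2 B \<eta> + (t - s) * V / \<epsilon> + \<alpha> \<le> K" for s t \<eta> \<alpha>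
    using that(1)[unfolded Q_def] that(2-) by blast
  have C0: "0 \<le> C" using order_trans[OF norm_L2_nonneg C[of 0]] T(1) by simp
  have V0: "0 \<le> V" using order_trans[OF add_nonneg_nonneg[OF norm_L2_nonneg] V[of 0]] T(1) \<omega> by simp
  have tT: "t \<in> times Tstar" if "t \<in> {0..T}" for t
    using that T by (auto intro: times_downward)
  have "Q 0 T"
  proof (rule Bolzano[of 0 T Q])
    show "0 \<le> T" using T by simp
  next
    fix r s t assume Q1: "Q r s" and Q2: "Q s t" and le: "r \<le> s" "s \<le> t"
    show "Q r t"
      unfolding Q_def
    proof (intro impI allI, elim conjE)
      fix \<eta> :: "'a \<Rightarrow> real" and \<alpha> :: real
      assume r: "0 \<le> r" "t \<le> T" and \<eta>: "smooth \<eta>" "\<forall>x. 0 \<le> \<eta> x" and \<alpha>: "0 < \<alpha>"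
        and K: "norm_L2 B \<eta> + (t - r) * V / \<epsilon> + \<alpha> \<le> K"
      have split: "(t - r) * V / \<epsilon> = (t - s) * V / \<epsilon> + (s - r) * V / \<epsilon>"
        "C * (2 * (t - r) * \<omega> / \<epsilon>) = C * (2 * (t - s) * \<omega> / \<epsilon>) + C * (2 * (s - r) * \<omega> / \<epsilon>)"
        by (simp_all add: left_diff_distrib right_diff_distrib diff_divide_distrib)
      have nn: "0 \<le> (s - r) * V / \<epsilon>" "0 \<le> (t - s) * V / \<epsilon>" using le V0 \<epsilon> by auto
      have "norm_L2 B \<eta> + (t - s) * V / \<epsilon> + \<alpha> / 2 \<le> K" using K nn \<alpha> unfolding split by linarith
      then obtain \<eta>1 where \<eta>1: "smooth \<eta>1" "\<forall>x. 0 \<le> \<eta>1 x"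
        "norm_L2 B \<eta>1 \<le> norm_L2 B \<eta> + (t - s) * V / \<epsilon> + \<alpha> / 2"
        "energy \<epsilon> \<theta> t \<eta> \<le> energy \<epsilon> \<theta> s \<eta>1 + \<alpha> / 2 + C * (2 * (t - s) * \<omega> / \<epsilon>) + c * K * gnorm s t"
        using QD[OF Q2 order_trans[OF r(1) le(1)] le(2) r(2) \<eta> half_gt_zero[OF \<alpha>]] by blast
      have "norm_L2 B \<eta>1 + (s - r) * V / \<epsilon> + \<alpha> / 2 \<le> K" using K \<eta>1(3) unfolding split by linarith
      then obtain \<eta>2 where \<eta>2: "smooth \<eta>2" "\<forall>x. 0 \<le> \<eta>2 x"
        "norm_L2 B \<eta>2 \<le> norm_L2 B \<eta>1 + (s - r) * V / \<epsilon> + \<alpha> / 2"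
        "energy \<epsilon> \<theta> s \<eta>1 \<le> energy \<epsilon> \<theta> r \<eta>2 + \<alpha> / 2 + C * (2 * (s - r) * \<omega> / \<epsilon>) + c * K * gnorm r s"
        using QD[OF Q1 r(1) le(1) order_trans[OF le(2) r(2)] \<eta>1(1,2) half_gt_zero[OF \<alpha>]] by blast
      have g: "c * K * gnorm r t = c * K * gnorm r s + c * K * gnorm s t"
        using gnorm_add[OF r(1) le r(2) T] by (simp add: distrib_left)
      show "\<exists>\<eta>'. smooth \<eta>' \<and> (\<forall>x. 0 \<le> \<eta>' x) \<and> norm_L2 B \<eta>' \<le> norm_L2 B \<eta> + (t - r) * V / \<epsilon> + \<alpha> \<and>
          energy \<epsilon> \<theta> t \<eta> \<le> energy \<epsilon> \<theta> r \<eta>' + \<alpha> + C * (2 * (t - r) * \<omega> / \<epsilon>) + c * K * gnorm r t"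
        unfolding split g using \<eta>1(3,4) \<eta>2 by (intro exI[of _ \<eta>2]) auto
    qed
  next
    fix x assume x: "0 \<le> x" "x \<le> T"
    then have xt: "x \<in> times Tstar" using tT by auto
    \<comment> \<open>Half of \<omega>, because \<open>one_step\<close> compares with the right
      endpoint \<open>t\<close> of the interval and not with \<open>x\<close>; the triangle
      inequality through \<open>x\<close> doubles the bound.\<close>
    have near: "\<exists>d>0. \<forall>t\<in>{0..T}. \<bar>t - x\<bar> < d \<longrightarrow> norm_L2 D (\<lambda>y. u (y, t) - u (y, x)) < \<omega> / 2"
      if p: "enthalpy_pair D Tstar uM u \<mu>" for u \<mu>
    proof -
      have "eventually (\<lambda>t. norm_L2 D (\<lambda>y. u (y, t) - u (y, x)) < \<omega> / 2) (at x within times Tstar)"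
        by (rule order_tendstoD(2)[OF enthalpy_pairD(4)[OF D p xt]]) (use \<omega> in simp)
      then obtain d where d: "0 < d" "\<forall>t\<in>times Tstar. t \<noteq> x \<and> dist t x < d \<longrightarrow> norm_L2 D (\<lambda>y. u (y, t) - u (y, x)) < \<omega> / 2"
        unfolding eventually_at by blast
      have "norm_L2 D (\<lambda>y. u (y, t) - u (y, x)) < \<omega> / 2" if "t \<in> {0..T}" "\<bar>t - x\<bar> < d" for t
        using d(2) tT[OF that(1)] that(2) \<omega> by (cases "t = x") (auto simp: dist_real_def)
      with d(1) show ?thesis by blast
    qed
    obtain d1 where d1: "0 < d1" "\<And>t. t \<in> {0..T} \<Longrightarrow> \<bar>t - x\<bar> < d1 \<Longrightarrow> norm_L2 D (\<lambda>y. u1 (y, t) - u1 (y, x)) < \<omega> / 2"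
      using near[OF pair1] by blast
    obtain d2 where d2: "0 < d2" "\<And>t. t \<in> {0..T} \<Longrightarrow> \<bar>t - x\<bar> < d2 \<Longrightarrow> norm_L2 D (\<lambda>y. u2 (y, t) - u2 (y, x)) < \<omega> / 2"
      using near[OF pair2] by blast
    have tri: "norm_L2 D (\<lambda>y. u (y, t) - u (y, s)) \<le> \<omega>"
      if p: "enthalpy_pair D Tstar uM u \<mu>" and st: "s \<in> {0..T}" "t \<in> {0..T}"
        and "norm_L2 D (\<lambda>y. u (y, t) - u (y, x)) < \<omega> / 2" "norm_L2 D (\<lambda>y. u (y, s) - u (y, x)) < \<omega> / 2" for u \<mu> s t
      using norm_L2_triangle[OF DL enthalpy_pairD(1)[OF D p tT[OF st(2)]] enthalpy_pairD(1)[OF D p xt]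
          enthalpy_pairD(1)[OF D p tT[OF st(1)]]]
        norm_L2_minus_commute[of D "\<lambda>y. u (y, s)" "\<lambda>y. u (y, x)"] that(4,5) by simp
    show "\<exists>d>0. \<forall>s t. s \<le> x \<and> x \<le> t \<and> t - s < d \<longrightarrow> Q s t"
    proof (intro exI[of _ "min d1 d2"] conjI allI impI)
      show "0 < min d1 d2" using d1 d2 by simp
      fix s t assume "s \<le> x \<and> x \<le> t \<and> t - s < min d1 d2"
      then have st: "s \<le> x" "x \<le> t" "t - s < d1" "t - s < d2" by auto
      show "Q s t"
        unfolding Q_def
      proof (intro impI allI, elim conjE)
        fix \<eta> :: "'a \<Rightarrow> real" and \<alpha> :: real
        assume s: "0 \<le> s" "s \<le> t" "t \<le> T" and \<eta>: "smooth \<eta>" "\<forall>x. 0 \<le> \<eta> x" and \<alpha>: "0 < \<alpha>"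
          and K: "norm_L2 B \<eta> + (t - s) * V / \<epsilon> + \<alpha> \<le> K"
        show "\<exists>\<eta>'. smooth \<eta>' \<and> (\<forall>x. 0 \<le> \<eta>' x) \<and> norm_L2 B \<eta>' \<le> norm_L2 B \<eta> + (t - s) * V / \<epsilon> + \<alpha> \<and>
          energy \<epsilon> \<theta> t \<eta> \<le> energy \<epsilon> \<theta> s \<eta>' + \<alpha> + C * (2 * (t - s) * \<omega> / \<epsilon>) + c * K * gnorm s t"
        proof (cases "s = t")
          \<comment> \<open>\<open>one_step\<close> requires a proper interval; on a degenerate one
            \<eta> is kept and all error terms are nonnegative.\<close>
          case True
          have "norm_L2 B \<eta> + \<alpha> \<le> K" using K True by simp
          then have "0 \<le> K" using order_trans[OF add_nonneg_nonneg[OF norm_L2_nonneg less_imp_le[OF \<alpha>]]] by blast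
          then have "0 \<le> c * K * gnorm t t" using \<theta>(7) gnorm_nonneg by simp
          then show ?thesis using True \<eta> \<alpha> by (intro exI[of _ \<eta>]) auto
        next
          case False
          then have lt: "s < t" using s by simp
          have tt: "ereal t < Tstar" using tT[of t] s by (simp add: times_def)
          have o1: "norm_L2 D (\<lambda>y. u1 (y, r) - u1 (y, t)) \<le> \<omega>"
            and o2: "norm_L2 D (\<lambda>y. u2 (y, r) - u2 (y, t)) \<le> \<omega>" if "r \<in> {s..t}" for r
            using that st s by (auto intro!: tri[OF pair1] tri[OF pair2] d1(2) d2(2))
          have tT': "t \<in> {0..T}" using s by simp
          obtain \<eta>' where \<eta>': "smooth \<eta>'" "\<And>x. 0 \<le> \<eta>' x"
            "norm_L2 B \<eta>' \<le> norm_L2 B \<eta> + (t - s) * V / \<epsilon> + \<alpha>"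
            "energy \<epsilon> \<theta> t \<eta> \<le> energy \<epsilon> \<theta> s \<eta>' + \<alpha> + C * (2 * (t - s) * \<omega> / \<epsilon>) + c * norm_L2 B \<eta>' * gnorm s t"
            using one_step[OF s(1) lt tt \<theta> \<eta>(1) spec[OF \<eta>(2)] \<epsilon> \<alpha> o1 o2 less_imp_le[OF \<omega>] V[OF tT'] C[OF tT', unfolded B_def]]
            unfolding B_def by blast
          have "c * norm_L2 B \<eta>' * gnorm s t \<le> c * K * gnorm s t"
            using \<eta>'(3) K \<theta>(7) gnorm_nonneg by (intro mult_right_mono mult_left_mono) auto
          then show ?thesis using \<eta>' by (intro exI[of _ \<eta>']) auto
        qed
      qed
    qed
  qed
  then obtain \<eta>' where "smooth \<eta>'" "\<forall>x. 0 \<le> \<eta>' x"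
    "energy \<epsilon> \<theta> T \<eta>0 \<le> energy \<epsilon> \<theta> 0 \<eta>' + \<alpha>0 + C * (2 * (T - 0) * \<omega> / \<epsilon>) + c * K * gnorm 0 T"
    using QD[of 0 T \<eta>0 \<alpha>0] T(1) \<eta>0 \<alpha>0 by (auto simp: K_def)
  then show ?thesis by (intro that[of \<eta>']) (auto simp: K_def)
qed

section \<open>Passage to the limit in the partition, the cutoff and
  \<open>\<epsilon>\<close>\<close>

lemma w_bounded:
  assumes T: "0 < T" "ereal T < Tstar"
  obtains W where "0 \<le> W" "\<And>t. t \<in> {0..T} \<Longrightarrow> norm_L2 D (w t) \<le> W"
proof -
  have tT: "t \<in> times Tstar" if "t \<in> {0..T}" for t
    using that T by (auto intro: times_downward)
  have "continuous_on {0..T} (\<lambda>t. norm_L2 D (w t))"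
    unfolding continuous_on_def
  proof
    fix t assume t: "t \<in> {0..T}"
    let ?F = "at t within {0..T}"
    have sub: "{0..T} \<subseteq> times Tstar" using tT by blast
    have "((\<lambda>s. norm_L2 D (\<lambda>x. u1 (x, s) - u1 (x, t)) + norm_L2 D (\<lambda>x. u2 (x, s) - u2 (x, t))) \<longlongrightarrow> 0 + 0) ?F"
      by (intro tendsto_add tendsto_within_subset[OF enthalpy_pairD(4)[OF D pair1 tT[OF t]] sub]
          tendsto_within_subset[OF enthalpy_pairD(4)[OF D pair2 tT[OF t]] sub])
    then have z: "((\<lambda>s. norm_L2 D (\<lambda>x. u1 (x, s) - u1 (x, t)) + norm_L2 D (\<lambda>x. u2 (x, s) - u2 (x, t))) \<longlongrightarrow> 0) ?F"
      by simp
    have le: "\<bar>norm_L2 D (w s) - norm_L2 D (w t)\<bar>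
        \<le> norm_L2 D (\<lambda>x. u1 (x, s) - u1 (x, t)) + norm_L2 D (\<lambda>x. u2 (x, s) - u2 (x, t))" if s: "s \<in> {0..T}" for s
    proof -
      note ws = w_L2[OF tT[OF s]] and wt = w_L2[OF tT[OF t]]
      have "(\<lambda>x. w s x - w t x) = (\<lambda>x. (u1 (x, s) - u1 (x, t)) - (u2 (x, s) - u2 (x, t)))"
        by (auto simp: w_def)
      then have "norm_L2 D (\<lambda>x. w s x - w t x)
          \<le> norm_L2 D (\<lambda>x. u1 (x, s) - u1 (x, t)) + norm_L2 D (\<lambda>x. u2 (x, s) - u2 (x, t))"
        using L2_diff(2)[OF DL L2_diff(1)[OF DL enthalpy_pairD(1)[OF D pair1 tT[OF s]] enthalpy_pairD(1)[OF D pair1 tT[OF t]]]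
            L2_diff(1)[OF DL enthalpy_pairD(1)[OF D pair2 tT[OF s]] enthalpy_pairD(1)[OF D pair2 tT[OF t]]]] by simp
      then show ?thesis
        using norm_L2_triangle'[OF DL ws wt] norm_L2_triangle'[OF DL wt ws] norm_L2_minus_commute[of D "w s" "w t"]
        by linarith
    qed
    have "((\<lambda>s. norm_L2 D (w s) - norm_L2 D (w t)) \<longlongrightarrow> 0) ?F"
    proof (rule Lim_null_comparison[OF _ z])
      show "\<forall>\<^sub>F s in ?F. norm (norm_L2 D (w s) - norm_L2 D (w t))
          \<le> norm_L2 D (\<lambda>x. u1 (x, s) - u1 (x, t)) + norm_L2 D (\<lambda>x. u2 (x, s) - u2 (x, t))"
        unfolding eventually_at_filter real_norm_def using le by (intro always_eventually) blast
    qed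
    then show "((\<lambda>t. norm_L2 D (w t)) \<longlongrightarrow> norm_L2 D (w t)) ?F" by (rule LIM_zero_cancel)
  qed
  then have "bounded ((\<lambda>t. norm_L2 D (w t)) ` {0..T})"
    by (intro compact_imp_bounded compact_continuous_image) auto
  then obtain W where "0 < W" "\<forall>y\<in>(\<lambda>t. norm_L2 D (w t)) ` {0..T}. norm y \<le> W"
    unfolding bounded_pos by blast
  then show ?thesis by (intro that[of W]) auto
qed

text \<open>For fixed \<epsilon> and \<theta> the tolerances \<omega> and \<alpha> are sent to zero.
  The bound \<open>C\<close> for \<open>b\<close> grows with the volume of
  \<open>D \<inter> ball 0 R\<close>, but it multiplies only \<omega>. In what remains the cutoff
  appears through \<open>c\<close> and the norm of \<zeta> on the ball, so it can be widened
  afterwards.\<close>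

lemma cutoff_estimate:
  assumes T: "0 < T" "ereal T < Tstar" and init: "AE x in lebesgue_on D. b 0 x \<le> 0"
    and W: "\<And>t. t \<in> {0..T} \<Longrightarrow> norm_L2 D (w t) \<le> W" and W0: "0 \<le> W"
    and \<theta>: "smooth \<theta>" "\<And>x. 0 \<le> \<theta> x" "\<And>x. \<theta> x \<le> 1" "\<And>x. x \<notin> cball 0 R' \<Longrightarrow> \<theta> x = 0" "R' < R"
      "\<And>x. norm (gradient \<theta> x) \<le> c" "0 \<le> c"
    and \<zeta>: "smooth \<zeta>" "\<And>x. 0 \<le> \<zeta> x" and \<epsilon>: "0 < \<epsilon>"
  shows "energy \<epsilon> \<theta> T \<zeta> \<le> c * (norm_L2 (D \<inter> ball 0 R) \<zeta> + T * (W + 2) / \<epsilon> + 1) * gnorm 0 T"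
proof (rule field_le_epsilon)
  fix e :: real assume e: "0 < e"
  define B where "B = D \<inter> ball 0 R"
  have B: "B \<in> lmeasurable" "B \<subseteq> D"
    using DL by (auto simp: B_def intro!: bounded_set_imp_lmeasurable)
  have tT: "t \<in> times Tstar" if "t \<in> {0..T}" for t
    using that T by (auto intro: times_downward)
  define C where "C = W + 2 * sqrt (measure lebesgue B)"
  have C: "norm_L2 B (b t) \<le> C" if "t \<in> {0..T}" for t
    using b_L2(2)[OF tT[OF that] B] W[OF that] by (simp add: C_def)
  have C0: "0 \<le> C" using W0 by (simp add: C_def)
  define k where "k = C * (2 * T / \<epsilon>)"
  have k: "0 \<le> k" using C0 T \<epsilon> by (simp add: k_def)
  \<comment> \<open>\<open>\<omega> \<le> 1\<close> gives the fixed growth rate \<open>W + 2\<close>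
    for the norms of the test functions; the second bound makes \<open>k * \<omega>\<close> at most
    \<open>e / 2\<close>.\<close>
  define \<omega> where "\<omega> = min 1 (e / 2 / (k + 1))"
  have "0 < e / 2 / (k + 1)" using e k by (intro divide_pos_pos) linarith+
  then have \<omega>: "0 < \<omega>" "\<omega> \<le> 1" by (auto simp: \<omega>_def)
  have k\<omega>: "k * \<omega> \<le> e / 2"
  proof -
    have "k * \<omega> \<le> (k + 1) * (e / 2 / (k + 1))"
      using k \<omega>(1) by (intro mult_mono) (auto simp: \<omega>_def)
    also have "\<dots> = e / 2"
    proof -
      have "k + 1 \<noteq> 0" using k by linarith
      then show ?thesis by (metis nonzero_mult_div_cancel_left times_divide_eq_right)
    qed
    finally show ?thesis .
  qed
  define \<alpha> where "\<alpha> = min 1 (e / 2)"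
  have \<alpha>: "0 < \<alpha>" "\<alpha> \<le> 1" "\<alpha> \<le> e / 2" using e by (auto simp: \<alpha>_def)
  have V: "norm_L2 D (w t) + 2 * \<omega> \<le> W + 2" if "t \<in> {0..T}" for t using W[OF that] \<omega>(2) by simp
  obtain \<eta>' where \<eta>': "smooth \<eta>'" "\<And>x. 0 \<le> \<eta>' x"
    "energy \<epsilon> \<theta> T \<zeta> \<le> energy \<epsilon> \<theta> 0 \<eta>' + \<alpha> + C * (2 * T * \<omega> / \<epsilon>)
      + c * (norm_L2 B \<zeta> + T * (W + 2) / \<epsilon> + \<alpha>) * gnorm 0 T"
    using backward_iteration[OF T \<theta> \<zeta> \<epsilon> \<alpha>(1) \<omega>(1) V C[unfolded B_def]] unfolding B_def by blast
  \<comment> \<open>This holds for every nonnegative \<eta>': the initial inequality makes the first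
    integral nonpositive, and the Dirichlet term enters with a minus sign.\<close>
  have "energy \<epsilon> \<theta> 0 \<eta>' \<le> 0"
  proof -
    have "(LINT x|lebesgue_on D. - (b 0 x * (\<eta>' x * \<theta> x))) \<ge> 0"
      by (rule integral_nonneg_AE) (use init in \<open>auto elim!: eventually_mono simp: mult_nonpos_nonneg \<eta>'(2) \<theta>(2)\<close>)
    then have "(LINT x|lebesgue_on D. b 0 x * (\<eta>' x * \<theta> x)) \<le> 0" by simp
    moreover have "0 \<le> (LINT x|lebesgue_on D. \<theta> x * (norm (gradient \<eta>' x))\<^sup>2)"
      by (rule integral_nonneg_AE) (use \<theta>(2) in auto)
    then have "0 \<le> \<epsilon> / 2 * (LINT x|lebesgue_on D. \<theta> x * (norm (gradient \<eta>' x))\<^sup>2)" using \<epsilon> by simp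
    ultimately show ?thesis unfolding energy_def by linarith
  qed
  moreover have "C * (2 * T * \<omega> / \<epsilon>) = k * \<omega>" by (simp add: k_def)
  moreover have "c * (norm_L2 B \<zeta> + T * (W + 2) / \<epsilon> + \<alpha>) * gnorm 0 T \<le> c * (norm_L2 B \<zeta> + T * (W + 2) / \<epsilon> + 1) * gnorm 0 T"
    using \<alpha>(2) \<theta>(7) gnorm_nonneg by (intro mult_right_mono mult_left_mono) auto
  ultimately show "energy \<epsilon> \<theta> T \<zeta> \<le> c * (norm_L2 (D \<inter> ball 0 R) \<zeta> + T * (W + 2) / \<epsilon> + 1) * gnorm 0 T + e"
    using \<eta>'(3) k\<omega> \<alpha>(3) unfolding B_def by linarith
qed

end

text \<open>Dilating a fixed bump by \<rho> divides its gradient by \<rho>. So \<rho> is taken at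
  least \<open>C / c\<close>, and at least \<open>\<bar>r\<bar>\<close> in order that the value 1 is
  kept on the given ball.\<close>

lemma wide_cutoff:
  fixes r c :: real
  assumes "0 < c"
  obtains \<theta> :: "'a::euclidean_space \<Rightarrow> real" and R where "smooth \<theta>" "\<And>x. 0 \<le> \<theta> x" "\<And>x. \<theta> x \<le> 1"
    "\<And>x. x \<in> ball 0 r \<Longrightarrow> \<theta> x = 1" "\<And>x. x \<notin> cball 0 R \<Longrightarrow> \<theta> x = 0" "\<And>x. norm (gradient \<theta> x) \<le> c"
proof -
  obtain \<psi> :: "'a \<Rightarrow> real" where \<psi>: "smooth \<psi>" "\<And>x. 0 \<le> \<psi> x" "\<And>x. \<psi> x \<le> 1"
    "\<And>x. dist 0 x \<le> 1 \<Longrightarrow> \<psi> x = 1" "\<And>x. 2 \<le> dist 0 x \<Longrightarrow> \<psi> x = 0"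
    by (rule bump_exists[of 1 2 "0::'a"]) (simp, simp, rule that, assumption+)
  have "gradient \<psi> x = 0" if "x \<notin> cball 0 2" for x
    by (rule gradient_eq_0[of 0 2]) (use that \<psi>(5) in auto)
  then obtain C where C: "0 \<le> C" "\<And>x. norm (gradient \<psi> x) \<le> C"
    using continuous_compact_support_bounded[OF continuous_on_gradient[OF \<psi>(1)], of 0 2] by blast
  define \<rho> where "\<rho> = \<bar>r\<bar> + C / c + 1"
  have \<rho>: "0 < \<rho>" "\<bar>r\<bar> \<le> \<rho>" "C / c \<le> \<rho>"
    using assms C(1) by (auto simp: \<rho>_def add_nonneg_pos)
  define \<theta> where "\<theta> x = \<psi> ((1 / \<rho>) *\<^sub>R x)" for x
  have s: "smooth \<theta>"
    unfolding \<theta>_def using smooth_compose_affine[OF bounded_linear_scaleR_right \<psi>(1), of "1 / \<rho>" 0] by simp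
  have g: "gradient \<theta> x = (1 / \<rho>) *\<^sub>R gradient \<psi> ((1 / \<rho>) *\<^sub>R x)" for x
  proof (rule gradient_eqI)
    have "((\<lambda>x. (1 / \<rho>) *\<^sub>R x) has_derivative (\<lambda>h. (1 / \<rho>) *\<^sub>R h)) (at x)"
      by (auto intro!: derivative_eq_intros)
    from has_derivative_compose[OF this smooth_GDERIV[OF \<psi>(1), unfolded gderiv_def]]
    show "GDERIV \<theta> x :> (1 / \<rho>) *\<^sub>R gradient \<psi> ((1 / \<rho>) *\<^sub>R x)"
      unfolding gderiv_def \<theta>_def by simp
  qed
  have "norm (gradient \<theta> x) \<le> c" for x
  proof -
    have "norm (gradient \<theta> x) \<le> C / \<rho>"
      unfolding g using C(2)[of "(1 / \<rho>) *\<^sub>R x"] \<rho>(1) by (simp add: divide_right_mono)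
    also have "\<dots> \<le> c"
      using \<rho> assms by (simp add: pos_divide_le_eq mult.commute)
    finally show ?thesis .
  qed
  moreover have "\<theta> x = 1" if "x \<in> ball 0 r" for x
    unfolding \<theta>_def using that \<rho> by (intro \<psi>(4)) auto
  moreover have "\<theta> x = 0" if "x \<notin> cball 0 (2 * \<rho>)" for x
    unfolding \<theta>_def using that \<rho>(1) by (intro \<psi>(5)) (auto simp: pos_le_divide_eq)
  ultimately show ?thesis
    using s \<psi>(2,3) by (intro that[of \<theta> "2 * \<rho>"]) (auto simp: \<theta>_def)
qed

context enthalpy_comparison
begin

text \<open>Half of \<open>e\<close> pays for the Dirichlet term of \<zeta>, which fixes \<epsilon>,
  the other half for the cutoff error, which fixes \<open>c\<close>. The cutoff equals 1 on the
  support of \<zeta> and hence leaves the integral in question unchanged.\<close>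

lemma enthalpy_test_nonpos:
  assumes T: "0 < T" "ereal T < Tstar" and init: "AE x in lebesgue_on D. b 0 x \<le> 0"
    and \<zeta>: "test_function UNIV \<zeta>" "\<And>x. 0 \<le> \<zeta> x"
  shows "(LINT x|lebesgue_on D. b T x * \<zeta> x) \<le> 0"
proof (rule field_le_epsilon)
  fix e :: real assume e: "0 < e"
  obtain W where W: "0 \<le> W" "\<And>t. t \<in> {0..T} \<Longrightarrow> norm_L2 D (w t) \<le> W"
    using w_bounded[OF T] by blast
  obtain r where r: "0 < r" "\<And>x. \<zeta> x \<noteq> 0 \<Longrightarrow> x \<in> ball 0 r"
    using test_function_bounded_support[OF \<zeta>(1)] by blast
  have s: "smooth \<zeta>" by (rule test_function_smooth[OF \<zeta>(1)])
  note \<zeta>L = test_function_L2[OF DL \<zeta>(1)]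
  define n where "n = (norm_L2 D (gradient \<zeta>))\<^sup>2"
  have n: "0 \<le> n" by (simp add: n_def)
  define \<epsilon> where "\<epsilon> = e / (n + 1)"
  have \<epsilon>: "0 < \<epsilon>" using e n by (simp add: \<epsilon>_def)
  have \<epsilon>n: "\<epsilon> / 2 * n \<le> e / 2"
  proof -
    have "\<epsilon> * (n + 1) = e" using n by (simp add: \<epsilon>_def)
    then show ?thesis using \<epsilon> by (simp add: algebra_simps)
  qed
  \<comment> \<open>The cutoff error is at most \<open>c * p\<close>. The norm of \<zeta> is taken
    over all of \<open>D\<close>, so \<open>p\<close> does not depend on the radius of the cutoff,
    which is known only after \<open>c\<close>.\<close>
  define p where "p = (norm_L2 D \<zeta> + T * (W + 2) / \<epsilon> + 1) * gnorm 0 T"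
  have p: "0 \<le> p"
    unfolding p_def using T W(1) \<epsilon> gnorm_nonneg by (intro mult_nonneg_nonneg add_nonneg_nonneg) auto
  define c where "c = e / 2 / (p + 1)"
  have c: "0 < c" using e p by (simp add: c_def)
  have cp: "c * p \<le> e / 2"
  proof -
    have "p + 1 \<noteq> 0" using p by linarith
    then have "c * (p + 1) = e / 2" by (metis c_def nonzero_eq_divide_eq)
    then show ?thesis using c by (simp add: algebra_simps)
  qed
  obtain \<theta> :: "'a \<Rightarrow> real" and R' where \<theta>: "smooth \<theta>" "\<And>x. 0 \<le> \<theta> x" "\<And>x. \<theta> x \<le> 1"
    "\<And>x. x \<in> ball 0 r \<Longrightarrow> \<theta> x = 1" "\<And>x. x \<notin> cball 0 R' \<Longrightarrow> \<theta> x = 0" "\<And>x. norm (gradient \<theta> x) \<le> c"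
    by (rule wide_cutoff[OF c, of r]) (rule that, assumption+)
  define R where "R = R' + 1"
  have RR: "R' < R" by (simp add: R_def)
  have eq: "b T x * (\<zeta> x * \<theta> x) = b T x * \<zeta> x" for x
    using \<theta>(4)[of x] r(2)[of x] by (cases "\<zeta> x = 0") auto
  have est: "energy \<epsilon> \<theta> T \<zeta> \<le> c * (norm_L2 (D \<inter> ball 0 R) \<zeta> + T * (W + 2) / \<epsilon> + 1) * gnorm 0 T"
    by (rule cutoff_estimate[OF T init W(2,1) \<theta>(1,2,3,5) RR \<theta>(6) less_imp_le[OF c] s \<zeta>(2) \<epsilon>])
  have "norm_L2 (D \<inter> ball 0 R) \<zeta> \<le> norm_L2 D \<zeta>"
    using DL by (intro L2_subset(2)[OF DL _ _ \<zeta>L(1)]) auto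
  then have "c * (norm_L2 (D \<inter> ball 0 R) \<zeta> + T * (W + 2) / \<epsilon> + 1) * gnorm 0 T \<le> c * p"
    unfolding p_def mult.assoc using c gnorm_nonneg by (intro mult_left_mono mult_right_mono) auto
  moreover have "\<epsilon> / 2 * (LINT x|lebesgue_on D. \<theta> x * (norm (gradient \<zeta> x))\<^sup>2) \<le> \<epsilon> / 2 * n"
  proof (rule mult_left_mono)
    have i: "integrable (lebesgue_on D) (\<lambda>x. (norm (gradient \<zeta> x))\<^sup>2)" by (rule L2_integrable_sq[OF DL \<zeta>L(2)])
    have le: "\<theta> x * (norm (gradient \<zeta> x))\<^sup>2 \<le> (norm (gradient \<zeta> x))\<^sup>2" for x
      using \<theta>(2,3)[of x] by (intro mult_left_le_one_le) auto
    have m: "\<theta> \<in> borel_measurable (lebesgue_on D)"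
      by (rule borel_measurable_lebesgue_on_continuous[OF DL smooth_continuous_on[OF \<theta>(1)]])
    have j: "integrable (lebesgue_on D) (\<lambda>x. \<theta> x * (norm (gradient \<zeta> x))\<^sup>2)"
      by (rule Bochner_Integration.integrable_bound[OF i])
         (use m L2_measurable[OF DL \<zeta>L(2)] le \<theta>(2) in \<open>auto simp: abs_mult\<close>)
    show "(LINT x|lebesgue_on D. \<theta> x * (norm (gradient \<zeta> x))\<^sup>2) \<le> n"
      unfolding n_def norm_L2_sq[OF DL] by (rule integral_mono[OF j i le])
  qed (use \<epsilon> in simp)
  moreover have "(LINT x|lebesgue_on D. b T x * (\<zeta> x * \<theta> x)) = (LINT x|lebesgue_on D. b T x * \<zeta> x)"
    by (simp only: eq)
  ultimately show "(LINT x|lebesgue_on D. b T x * \<zeta> x) \<le> 0 + e"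
    using est cp \<epsilon>n unfolding energy_def by linarith
qed

text \<open>At time 0 the two inequalities add up to \<open>b 0 \<le> 0\<close>. At time
  \<open>T\<close> the integral inequality for all test functions gives \<open>b T \<le> 0\<close>
  almost everywhere, and \<open>signs\<close> separates this again into two inequalities.\<close>

lemma comparison:
  assumes T: "0 < T" "ereal T < Tstar"
    and init: "AE x\<in>D in lebesgue. u1 (x, 0) \<le> u2 (x, 0) \<and> m1 (x, 0) \<le> m2 (x, 0)"
  shows "AE x\<in>D in lebesgue. u1 (x, T) \<le> u2 (x, T) \<and> m1 (x, T) \<le> m2 (x, T)"
proof -
  have tT: "T \<in> times Tstar" using T by (auto intro: times_downward)
  have "AE x\<in>D in lebesgue. b 0 x \<le> 0"
    using init by (rule eventually_mono) (auto simp: b_def)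
  then have init': "AE x in lebesgue_on D. b 0 x \<le> 0"
    by (rule iffD1[OF AE_eq_restrict[OF DL]])
  have "AE y in lebesgue. y \<in> D \<longrightarrow> b T y \<le> 0"
  proof (rule AE_nonpos_if_test_nonpos[OF D])
    show "b T \<in> L2 (D \<inter> ball 0 R)" for R
      using DL by (intro b_L2(1)[OF tT] bounded_set_imp_lmeasurable) auto
    fix \<zeta> :: "'a \<Rightarrow> real" assume "test_function D \<zeta>" "\<And>x. 0 \<le> \<zeta> x"
    then show "(LINT x|lebesgue_on D. b T x * \<zeta> x) \<le> 0"
      by (intro enthalpy_test_nonpos[OF T init']) (auto simp: test_function_def)
  qed
  moreover have "AE x in lebesgue. x \<in> D \<longrightarrow> b T x \<le> 0 \<longrightarrow> u1 (x, T) \<le> u2 (x, T) \<and> m1 (x, T) \<le> m2 (x, T)"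
    using iffD2[OF AE_eq_restrict[OF DL] signs[OF tT]] by (rule eventually_mono) blast
  ultimately show ?thesis
    by eventually_elim auto
qed

end

theorem theorem1p15:
  fixes D :: "(real ^ 'd) set"
    and Tstar :: ereal
    and uM :: "real ^ 'd \<Rightarrow> real"
    and F :: "real ^ 'd \<Rightarrow> real ^ 'd"
    and u1 \<mu>1 u2 \<mu>2 :: "(real ^ 'd) \<times> real \<Rightarrow> real"
  assumes "open D"
    and "locally_C11_boundary D"
    and "0 < Tstar"
    and "set_borel_measurable lebesgue D uM"
    and "F \<in> L2 D"
    and "neumann_enthalpy_subsolution D Tstar uM F u1 \<mu>1"
    and "neumann_enthalpy_supersolution D Tstar uM F u2 \<mu>2"
    and "AE x\<in>D in lebesgue. u1 (x, 0) \<le> u2 (x, 0) \<and> \<mu>1 (x, 0) \<le> \<mu>2 (x, 0)"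
  shows "\<forall>T. 0 < T \<and> ereal T < Tstar \<longrightarrow>
           (AE x\<in>D in lebesgue. u1 (x, T) \<le> u2 (x, T) \<and> \<mu>1 (x, T) \<le> \<mu>2 (x, T))"
proof -
  interpret enthalpy_comparison D Tstar uM F u1 \<mu>1 u2 \<mu>2
    using assms by unfold_locales
  show ?thesis
    using comparison assms(8) by blast
qed

end
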